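(* Let $K$ be an algebraically closed field, let $n\ge 2$ and $m\ge 1$ be integers, and let $A,B\in (K^{n\times n})^m$. If $A<_{\mathrm{hom}}B$, then $\dim\mathcal{O}(A)>\dim\mathcal{O}(B)$.
   Context: $\mathrm{GL}_n(K)$ acts on $(K^{n\times n})^m$ by simultaneous conjugation: $g\cdot(A_1,\dots,A_m)=(gA_1g^{-1},\dots,gA_mg^{-1})$; $\mathcal{O}(A)$ is the orbit of $A$, and $\dim\mathcal{O}(A)$ is its dimension as a locally closed algebraic variety. Let $R=K\langle x_1,\dots,x_m\rangle$ be the free associative unital $K$-algebra. For a matrix $\varphi=(\varphi_{ij})\in R^{k\times l}$ let $\varphi(A)$ be the $kn\times ln$ matrix over $K$ whose $(i,j)$ block of size $n\times n$ is $\varphi_{ij}(A_1,\dots,A_m)$. $A\le_{\mathrm{hom}}B$ means $\mathrm{rk}\,\varphi(A)\ge\mathrm{rk}\,\varphi(B)$ for all $k,l\ge1$ and all $\varphi\in R^{k\times l}$. $A<_{\mathrm{hom}}B$ means $A\le_{\mathrm{hom}}B$ and $\mathcal{O}(A)\ne\mathcal{O}(B)$. *)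

theory Defs
  imports
    "HOL-Library.Poly_Mapping"
    "HOL-Library.Extended_Nat"
    "HOL-Analysis.Abstract_Topology"
    "HOL-Computational_Algebra.Polynomial"
    "Jordan_Normal_Form.DL_Rank"
begin

section \<open>Tuples of matrices and simultaneous conjugation\<close>

definition mat_tuples :: "nat \<Rightarrow> nat \<Rightarrow> 'a mat list set" where
  "mat_tuples m n = {A. length A = m \<and> set A \<subseteq> carrier_mat n n}"

definition conj_orbit :: "nat \<Rightarrow> 'a::field mat list \<Rightarrow> 'a mat list set" where
  "conj_orbit n A =
     {map (\<lambda>X. g * X * h) A | g h.
        g \<in> carrier_mat n n \<and> h \<in> carrier_mat n n \<and> g * h = 1\<^sub>m n \<and> h * g = 1\<^sub>m n}"


section \<open>The free associative algebra and evaluation of matrices over it\<close>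

text \<open>
  The words in the letters \<open>0, \<dots>, m - 1\<close> form a \<open>K\<close>-basis of the free unital algebra in
  \<open>m\<close> variables, so its elements are the finitely supported coefficient functions on such words.
  The letter \<open>s\<close> stands for the variable \<open>x\<^sub>s\<^sub>+\<^sub>1\<close>, and the empty word for the unit.
\<close>

type_synonym 'a ncpoly = "nat list \<Rightarrow>\<^sub>0 'a"

definition free_alg :: "nat \<Rightarrow> 'a::zero ncpoly set" where
  "free_alg m = {p. \<forall>w \<in> Poly_Mapping.keys p. set w \<subseteq> {..<m}}"

definition eval_word :: "nat \<Rightarrow> 'a::semiring_1 mat list \<Rightarrow> nat list \<Rightarrow> 'a mat" where
  "eval_word n A w = foldr (\<lambda>s M. A ! s * M) w (1\<^sub>m n)"

definition eval_nc :: "nat \<Rightarrow> 'a::semiring_1 mat list \<Rightarrow> 'a ncpoly \<Rightarrow> 'a mat" where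
  "eval_nc n A p =
     mat n n (\<lambda>(i, j). \<Sum>w\<in>Poly_Mapping.keys p. Poly_Mapping.lookup p w * eval_word n A w $$ (i, j))"

definition eval_nc_mat ::
  "nat \<Rightarrow> 'a::semiring_1 mat list \<Rightarrow> 'a ncpoly mat \<Rightarrow> 'a mat" where
  "eval_nc_mat n A \<phi> =
     mat (dim_row \<phi> * n) (dim_col \<phi> * n)
       (\<lambda>(r, c). eval_nc n A (\<phi> $$ (r div n, c div n)) $$ (r mod n, c mod n))"

definition mat_rank :: "'a::field mat \<Rightarrow> nat" where
  "mat_rank M = vec_space.rank (dim_row M) M"

definition hom_le :: "nat \<Rightarrow> nat \<Rightarrow> 'a::field mat list \<Rightarrow> 'a mat list \<Rightarrow> bool" where
  "hom_le m n A B \<longleftrightarrow>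
     (\<forall>k\<ge>1. \<forall>l\<ge>1. \<forall>\<phi> \<in> carrier_mat k l. elements_mat \<phi> \<subseteq> free_alg m \<longrightarrow>
        mat_rank (eval_nc_mat n A \<phi>) \<ge> mat_rank (eval_nc_mat n B \<phi>))"

definition hom_less :: "nat \<Rightarrow> nat \<Rightarrow> 'a::field mat list \<Rightarrow> 'a mat list \<Rightarrow> bool" where
  "hom_less m n A B \<longleftrightarrow> hom_le m n A B \<and> conj_orbit n A \<noteq> conj_orbit n B"


section \<open>The Zariski topology on the affine space of tuples\<close>

inductive_set poly_funs :: "nat \<Rightarrow> nat \<Rightarrow> ('a::comm_ring_1 mat list \<Rightarrow> 'a) set"
  for m n :: nat where
  const: "(\<lambda>_. c) \<in> poly_funs m n"
| coord: "s < m \<Longrightarrow> i < n \<Longrightarrow> j < n \<Longrightarrow> (\<lambda>A. (A ! s) $$ (i, j)) \<in> poly_funs m n"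
| add: "f \<in> poly_funs m n \<Longrightarrow> g \<in> poly_funs m n \<Longrightarrow> (\<lambda>A. f A + g A) \<in> poly_funs m n"
| mult: "f \<in> poly_funs m n \<Longrightarrow> g \<in> poly_funs m n \<Longrightarrow> (\<lambda>A. f A * g A) \<in> poly_funs m n"

definition zero_locus ::
  "nat \<Rightarrow> nat \<Rightarrow> ('a::comm_ring_1 mat list \<Rightarrow> 'a) set \<Rightarrow> 'a mat list set" where
  "zero_locus m n F = {A \<in> mat_tuples m n. \<forall>f\<in>F. f A = 0}"

definition zariski :: "nat \<Rightarrow> nat \<Rightarrow> 'a::idom mat list topology" where
  "zariski m n =
     topology (\<lambda>U. \<exists>F \<subseteq> poly_funs m n. U = mat_tuples m n - zero_locus m n F)"

lemma istopology_zariski: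
  "istopology (\<lambda>U :: 'a::idom mat list set.
     \<exists>F \<subseteq> poly_funs m n. U = mat_tuples m n - zero_locus m n F)"
  (is "istopology ?L")
  unfolding istopology_def
proof (intro conjI allI impI)
  fix S T :: "'a mat list set"
  assume "?L S" "?L T"
  then obtain F G where F: "F \<subseteq> poly_funs m n" "S = mat_tuples m n - zero_locus m n F"
    and G: "G \<subseteq> poly_funs m n" "T = mat_tuples m n - zero_locus m n G"
    by blast
  let ?H = "{(\<lambda>A. f A * g A) | f g. f \<in> F \<and> g \<in> G}"
  have "?H \<subseteq> poly_funs m n"
    using F(1) G(1) by (auto intro!: poly_funs.mult)
  moreover have "S \<inter> T = mat_tuples m n - zero_locus m n ?H"
  proof (intro equalityI subsetI)
    fix A assume "A \<in> S \<inter> T"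
    then obtain f g where "A \<in> mat_tuples m n" "f \<in> F" "f A \<noteq> 0" "g \<in> G" "g A \<noteq> 0"
      unfolding F(2) G(2) zero_locus_def by blast
    moreover from this have "(\<lambda>A. f A * g A) \<in> ?H"
      by blast
    moreover from \<open>f A \<noteq> 0\<close> \<open>g A \<noteq> 0\<close> have "f A * g A \<noteq> 0"
      by simp
    ultimately show "A \<in> mat_tuples m n - zero_locus m n ?H"
      unfolding zero_locus_def by fast
  next
    fix A assume "A \<in> mat_tuples m n - zero_locus m n ?H"
    then obtain h where "A \<in> mat_tuples m n" "h \<in> ?H" "h A \<noteq> 0"
      unfolding zero_locus_def by blast
    moreover from this(2) obtain f g where "f \<in> F" "g \<in> G" "h = (\<lambda>A. f A * g A)"
      by blast
    ultimately have "A \<in> mat_tuples m n" "f A \<noteq> 0" "g A \<noteq> 0" "f \<in> F" "g \<in> G"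
      by auto
    then show "A \<in> S \<inter> T"
      unfolding F(2) G(2) zero_locus_def by blast
  qed
  ultimately show "?L (S \<inter> T)"
    by blast
next
  fix \<K> :: "'a mat list set set"
  assume *: "\<forall>K\<in>\<K>. ?L K"
  define H where
    "H = {f \<in> poly_funs m n. \<exists>K\<in>\<K>. \<forall>A \<in> mat_tuples m n. f A \<noteq> 0 \<longrightarrow> A \<in> K}"
  have "\<Union>\<K> = mat_tuples m n - zero_locus m n H"
  proof (intro equalityI subsetI)
    fix A assume "A \<in> \<Union>\<K>"
    then obtain K where K: "K \<in> \<K>" "A \<in> K"
      by blast
    with * obtain F where F: "F \<subseteq> poly_funs m n" "K = mat_tuples m n - zero_locus m n F"
      by blast
    from K(2) obtain f where f: "A \<in> mat_tuples m n" "f \<in> F" "f A \<noteq> 0"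
      unfolding F(2) zero_locus_def by blast
    have "\<forall>A \<in> mat_tuples m n. f A \<noteq> 0 \<longrightarrow> A \<in> K"
      unfolding F(2) zero_locus_def using f(2) by blast
    with F(1) f(2) K(1) have "f \<in> H"
      unfolding H_def by blast
    with f show "A \<in> mat_tuples m n - zero_locus m n H"
      unfolding zero_locus_def by blast
  next
    fix A assume "A \<in> mat_tuples m n - zero_locus m n H"
    then show "A \<in> \<Union>\<K>"
      unfolding zero_locus_def H_def by blast
  qed
  moreover have "H \<subseteq> poly_funs m n"
    unfolding H_def by blast
  ultimately show "?L (\<Union>\<K>)"
    by blast
qed

lemma openin_zariski:
  "openin (zariski m n) U \<longleftrightarrow>
     (\<exists>F \<subseteq> poly_funs m n. U = mat_tuples m n - zero_locus m n F)"
  unfolding zariski_def by (simp add: topology_inverse'[OF istopology_zariski])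

lemma topspace_zariski: "topspace (zariski m n :: 'a::idom mat list topology) = mat_tuples m n"
proof -
  have "zero_locus m n {\<lambda>_. 1 :: 'a} = {}"
    by (auto simp: zero_locus_def)
  then have "openin (zariski m n) (mat_tuples m n :: 'a mat list set)"
    unfolding openin_zariski
    by (intro exI[of _ "{\<lambda>_. 1 :: 'a}"]) (auto intro: poly_funs.const)
  then show ?thesis
    by (auto simp: topspace_def openin_zariski)
qed

lemma closedin_zariski:
  fixes Z :: "'a::idom mat list set"
  shows "closedin (zariski m n) Z \<longleftrightarrow> (\<exists>F \<subseteq> poly_funs m n. Z = zero_locus m n F)"
proof -
  have "zero_locus m n F \<subseteq> mat_tuples m n" for F :: "('a mat list \<Rightarrow> 'a) set"
    by (auto simp: zero_locus_def)
  then have "Z \<subseteq> mat_tuples m n \<and> mat_tuples m n - Z = mat_tuples m n - zero_locus m n F \<longleftrightarrow>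
      Z = zero_locus m n F" for F :: "('a mat list \<Rightarrow> 'a) set"
    by blast
  then show ?thesis
    unfolding closedin_def topspace_zariski openin_zariski by blast
qed


section \<open>Dimension\<close>

definition irreducible_in :: "'p topology \<Rightarrow> 'p set \<Rightarrow> bool" where
  "irreducible_in X Z \<longleftrightarrow> Z \<subseteq> topspace X \<and> Z \<noteq> {} \<and>
     (\<forall>C D. closedin X C \<longrightarrow> closedin X D \<longrightarrow> Z \<subseteq> C \<union> D \<longrightarrow> Z \<subseteq> C \<or> Z \<subseteq> D)"

text \<open>
  The Krull dimension of a nonempty topological space: the supremum of the lengths \<open>r\<close> of chains
  \<open>Z\<^sub>0 \<subset> \<dots> \<subset> Z\<^sub>r\<close> of irreducible closed subsets. (The empty space gets dimension \<open>0\<close>.)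
\<close>

definition top_dim :: "'p topology \<Rightarrow> enat" where
  "top_dim X = Sup {enat r | r. \<exists>Z :: nat \<Rightarrow> 'p set.
     (\<forall>i\<le>r. closedin X (Z i) \<and> irreducible_in X (Z i)) \<and> (\<forall>i<r. Z i \<subset> Z (Suc i))}"

text \<open>
  The dimension of a locally closed subvariety of the affine space of tuples is the dimension of
  its underlying space, that is, of the subset with the topology induced by the Zariski topology.
\<close>

definition variety_dim :: "nat \<Rightarrow> nat \<Rightarrow> 'a::idom mat list set \<Rightarrow> enat" where
  "variety_dim m n S = top_dim (subtopology (zariski m n) S)"

end

theory Submission
  imports Defs "HOL-Library.Function_Algebras"
begin

text \<open>
An \<open>m\<close>-tuple \<open>A\<close> of \<open>n \<times> n\<close> matrices makes \<open>K\<^sup>n\<close> a module over the free algebra. Write \<open>Hom(X, Y)\<close>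
for the space of matrices \<open>h\<close> with \<open>h X\<^sub>s = Y\<^sub>s h\<close> for all \<open>s\<close> and \<open>[X, Y]\<close> for its dimension. The
theorem is the conjunction of two facts.

\<^emph>\<open>The hom-order decreases the endomorphism algebra:\<close> \<open>A <\<^sub>h\<^sub>o\<^sub>m B\<close> implies \<open>[A, A] < [B, B]\<close>. If \<open>\<phi>\<close>
presents a module \<open>M\<close>, the kernel of \<open>\<phi>(Y)\<close> is \<open>Hom(M, Y)\<close>, and for another choice of \<open>\<phi>\<close> the left
kernel of \<open>\<phi>(Y)\<close> is \<open>Hom(Y, X)\<close>. So the rank inequalities say \<open>[M, A] \<le> [M, B]\<close> and \<open>[A, X] \<le> [B, X]\<close>
(\<open>hom_le_dim_systems\<close>, \<open>hom_le_dim_homs_into\<close>), whence \<open>[A, A] \<le> [A, B] \<le> [B, B]\<close> and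
\<open>[A, A] \<le> [B, A] \<le> [B, B]\<close>. If the outer terms agree, all four do. A common direct summand of \<open>A\<close>
and \<open>B\<close> is a pair \<open>a \<in> Hom(A, B)\<close>, \<open>b \<in> Hom(B, A)\<close> with \<open>a b a = a\<close> and \<open>b a b = b\<close>; the projections
\<open>e = 1 - b a\<close> and \<open>e' = 1 - a b\<close> belong to the complements. Let \<open>f\<^sub>1, \<dots>, f\<^sub>r\<close> span \<open>e' Hom(A, B)\<close>, and
let \<open>M\<close> be the cokernel of \<open>(f\<^sub>1, \<dots>, f\<^sub>r) : A \<rightarrow> B\<^sup>r\<close>. Then \<open>[M, A] \<le> [M, B]\<close> forces \<open>e\<close> to be a sum of
products \<open>p f\<close> of homomorphisms between the two complements (\<open>corner_decomposition\<close>). If \<open>e \<noteq> 0\<close>, some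
such \<open>p f\<close> is not nilpotent (\<open>nilpotent_sum_ne_corner\<close>), and its Fitting idempotent cuts out a further
common summand (\<open>enlarge_common_summand\<close>). So a maximal common summand is all of \<open>A\<close>, and \<open>A\<close> and \<open>B\<close>
are conjugate.

\<^emph>\<open>The dimension formula:\<close> \<open>dim O(A) = n\<^sup>2 - [A, A]\<close>. Let \<open>L\<close> be a linear complement of \<open>Hom(A, A)\<close> in
the space of matrices. A generic invertible \<open>g\<close> can be moved into the slice \<open>1 + L\<close> by right
multiplication with a unit of \<open>Hom(A, A)\<close>, so the matrices \<open>1 + l\<close> already parametrise a dense part
of the orbit (\<open>slice_dominant\<close>).

For the upper bound, pull functions back to the slice: the polynomial functions of degree at most \<open>N\<close>
become polynomials of degree \<open>O(N)\<close> in \<open>n\<^sup>2 - [A, A]\<close> variables, so only \<open>O(N ^ (n\<^sup>2 - [A, A]))\<close> of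
them are independent on the orbit. On the other hand, a chain of irreducible closed sets of length \<open>r\<close>
yields, up to constants, \<open>N\<^sup>r\<close> independent ones (\<open>chain_functions\<close>). For the lower bound, a flag in
\<open>L\<close> gives irreducible closed sets, namely the closures of the images of \<open>1 + L\<^sub>i\<close>. They are distinct
because \<open>l\<close> can be recovered from \<open>X = (1 + l) A (1 + l)\<^sup>-\<^sup>1\<close> by Cramer's rule (\<open>flag_coordinates\<close>).
\<close>

section \<open>Finite-dimensional subspaces of function spaces\<close>

context vector_space
begin

lemma basis_finite_span:
  assumes "finite T" and "V \<subseteq> span T"
  obtains B where "finite B" "B \<subseteq> V" "independent B" "V \<subseteq> span B" "card B = dim V"
  by (metis assms basis_exists independent_span_bound subset_trans)

lemma dim_mono_finite:
  assumes "finite T" and "W \<subseteq> span T" and "V \<subseteq> span W"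
  shows "dim V \<le> dim W"
proof -
  obtain B where B: "finite B" "B \<subseteq> W" "independent B" "W \<subseteq> span B" "card B = dim W"
    using basis_finite_span[OF assms(1,2)] .
  have "V \<subseteq> span B"
    using assms(3) B(4) by (meson span_minimal subspace_span subset_trans)
  then show ?thesis
    using dim_le_card[OF _ B(1)] B(5) by metis
qed

lemma subspace_eq_finite:
  assumes "finite T" and "W \<subseteq> span T" and "subspace V" and "V \<subseteq> W" and "dim W \<le> dim V"
  shows "V = W"
proof (rule ccontr)
  assume "V \<noteq> W"
  then obtain x where x: "x \<in> W" "x \<notin> V"
    using assms(4) by blast
  obtain B where B: "finite B" "B \<subseteq> V" "independent B" "V \<subseteq> span B" "card B = dim V"
    using basis_finite_span[OF assms(1), of V] assms(2,4) by blast
  have "span B \<subseteq> V"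
    using B(2) assms(3) by (simp add: span_minimal)
  then have xB: "x \<notin> span B"
    using x by blast
  then have ind: "independent (insert x B)"
    using B(3) by (simp add: independent_insertI)
  have "dim (insert x B) \<le> dim W"
    using dim_mono_finite[OF assms(1,2), of "insert x B"] x(1) B(2) assms(4)
    by (meson insert_subset span_superset subset_trans)
  moreover have "dim (insert x B) = Suc (card B)"
    using dim_eq_card_independent[OF ind] card_insert_disjoint[OF B(1), of x] xB span_base[of x B]
    by fastforce
  ultimately show False
    using B(5) assms(5) by linarith
qed

end

context vector_space_pair
begin

text \<open>
The ambient space may have infinite dimension; only \<open>V\<close> is finitely spanned. A basis of the kernel
extends to a basis of \<open>V\<close>, and \<open>f\<close> maps the added vectors to a basis of the image.
\<close>

lemma rank_nullity_finite:
  assumes "finite T" and "V \<subseteq> vs1.span T" and V: "vs1.subspace V"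
    and f: "Vector_Spaces.linear s1 s2 f"
  shows "vs1.dim V = vs1.dim {x\<in>V. f x = 0} + vs2.dim (f ` V)"
proof -
  let ?K = "{x\<in>V. f x = 0}"
  have K: "vs1.subspace ?K"
    using V linear_0[OF f] linear_add[OF f] linear_scale[OF f]
    by (auto simp: vs1.subspace_def)
  obtain B0 where B0: "finite B0" "B0 \<subseteq> ?K" "vs1.independent B0" "?K \<subseteq> vs1.span B0" "card B0 = vs1.dim ?K"
    using vs1.basis_finite_span[OF assms(1), of ?K] assms(2) by blast
  obtain B where B: "B0 \<subseteq> B" "B \<subseteq> V" "vs1.independent B" "V \<subseteq> vs1.span B"
    using vs1.maximal_independent_subset_extend[of B0 V] B0(2,3) by blast
  have finB: "finite B"
    using vs1.independent_span_bound[OF assms(1) B(3)] B(2) assms(2) by blast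
  have spB: "vs1.span B = V"
    using B(2,4) V by (simp add: vs1.span_subspace)
  let ?C = "B - B0"
  have zero: "u = 0" if "u \<in> vs1.span ?C" "f u = 0" for u
  proof -
    have "u \<in> ?K"
      using that spB vs1.span_mono[of ?C B] by blast
    then have "u \<in> vs1.span B0"
      using B0(4) by blast
    then have "vs1.representation B u = vs1.representation B0 u"
      using vs1.representation_extend[OF B(3) _ B(1)] by blast
    moreover have "vs1.representation B u = vs1.representation ?C u"
      using vs1.representation_extend[OF B(3) that(1)] by blast
    ultimately have "vs1.representation B u v = 0" for v
      by (metis DiffD2 vs1.representation_ne_zero)
    moreover have "u \<in> vs1.span B"
      using that(1) vs1.span_mono[of ?C B] by blast
    ultimately show "u = 0"
      using vs1.sum_nonzero_representation_eq[OF B(3), of u] by simp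
  qed
  have inj: "inj_on f (vs1.span ?C)"
    using linear_inj_on_iff_eq_0[OF f vs1.subspace_span] zero by blast
  have indC: "vs1.independent ?C"
    using B(3) vs1.independent_mono by blast
  have ind: "vs2.independent (f ` ?C)"
    using linear_independent_injective_image[OF f indC inj] .
  have "f ` V \<subseteq> vs2.span (f ` ?C)"
  proof -
    have "f ` B \<subseteq> vs2.span (f ` ?C)"
    proof
      fix y assume "y \<in> f ` B"
      then obtain x where x: "x \<in> B" "y = f x" by blast
      show "y \<in> vs2.span (f ` ?C)"
      proof (cases "x \<in> B0")
        case True
        then show ?thesis
          using B0(2) x(2) vs2.span_zero by auto
      next
        case False
        then show ?thesis
          using x by (simp add: vs2.span_base)
      qed
    qed
    then show ?thesis
      by (metis linear_span_image[OF f] spB vs2.span_minimal vs2.subspace_span)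
  qed
  then have "vs2.dim (f ` V) = card (f ` ?C)"
    using vs2.basis_card_eq_dim[of "f ` ?C" "f ` V"] B(2) ind by (metis Diff_subset image_mono subset_trans)
  also have "\<dots> = card ?C"
    using inj by (meson card_image inj_on_subset vs1.span_superset)
  also have "\<dots> = card B - card B0"
    using B(1) B0(1) by (simp add: card_Diff_subset)
  finally show ?thesis
    using B0(5) vs1.basis_card_eq_dim[OF B(2,4,3)] card_mono[OF finB B(1)] by linarith
qed

lemma dim_image_inj_finite:
  assumes "finite T" and "V \<subseteq> vs1.span T" and V: "vs1.subspace V"
    and f: "Vector_Spaces.linear s1 s2 f" and z: "\<And>x. x \<in> V \<Longrightarrow> f x = 0 \<Longrightarrow> x = 0"
  shows "vs2.dim (f ` V) = vs1.dim V"
proof -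
  have "{x\<in>V. f x = 0} = {0}"
    using z linear_0[OF f] vs1.subspace_0[OF V] by blast
  then have "vs1.dim {x\<in>V. f x = 0} = 0"
    using vs1.dim_le_card[of "{0}" "{}"] by simp
  then show ?thesis
    using rank_nullity_finite[OF assms(1-4)] by simp
qed

end

definition fscale :: "'a::field \<Rightarrow> ('b \<Rightarrow> 'a) \<Rightarrow> 'b \<Rightarrow> 'a" where
  "fscale c f = (\<lambda>x. c * f x)"

lemma fscale_apply [simp]: "fscale c f x = c * f x"
  by (simp add: fscale_def)

interpretation fs: vector_space "fscale :: 'a::field \<Rightarrow> ('b \<Rightarrow> 'a) \<Rightarrow> 'b \<Rightarrow> 'a"
  by unfold_locales (auto simp: fun_eq_iff algebra_simps)

interpretation fsp: vector_space_pair "fscale :: 'a::field \<Rightarrow> ('b \<Rightarrow> 'a) \<Rightarrow> 'b \<Rightarrow> 'a"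
  "fscale :: 'a \<Rightarrow> ('c \<Rightarrow> 'a) \<Rightarrow> 'c \<Rightarrow> 'a" ..

lemma linear_fscaleI:
  assumes "\<And>x y. f (x + y) = f x + f y" and "\<And>c x. f (fscale c x) = fscale c (f x)"
  shows "Vector_Spaces.linear fscale fscale f"
  using assms by (simp add: Vector_Spaces.linear_iff fs.vector_space_axioms)

lemma sum_fun_apply: "(\<Sum>i\<in>I. f i) x = (\<Sum>i\<in>I. f i x)"
  for f :: "'i \<Rightarrow> 'b \<Rightarrow> 'c::comm_monoid_add"
  by (induction I rule: infinite_finite_induct) auto

text \<open>
Matrices, families of matrices and polynomial functions are all vectors of the space \<open>'b \<Rightarrow> 'a\<close> for
some \<open>'b\<close>. The finite-dimensional part is cut out by a finite support, which allows sizes such as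
\<open>n\<close> to be ordinary variables.
\<close>

definition supp :: "'b set \<Rightarrow> ('b \<Rightarrow> 'a::zero) set" where
  "supp I = {f. \<forall>x. x \<notin> I \<longrightarrow> f x = 0}"

definition unitf :: "'b \<Rightarrow> 'b \<Rightarrow> 'a::zero_neq_one" where
  "unitf i = (\<lambda>j. if j = i then 1 else 0)"

lemma subspace_supp: "fs.subspace (supp I)"
  by (auto simp: fs.subspace_def supp_def)

lemma supp_expand:
  assumes "finite I" and "f \<in> supp I"
  shows "f = (\<Sum>i\<in>I. fscale (f i) (unitf i))"
proof
  fix x
  have "(\<Sum>i\<in>I. fscale (f i) (unitf i)) x = (\<Sum>i\<in>I. if x = i then f i else 0)"
    unfolding sum_fun_apply by (rule sum.cong) (auto simp: unitf_def)
  also have "\<dots> = f x"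
    using assms by (auto simp: supp_def)
  finally show "f x = (\<Sum>i\<in>I. fscale (f i) (unitf i)) x" ..
qed

lemma supp_subset_span:
  assumes "finite I"
  shows "supp I \<subseteq> fs.span (unitf ` I)"
  using supp_expand[OF assms]
  by (metis (no_types, lifting) fs.span_base fs.span_scale fs.span_sum image_eqI subsetI)

lemma finite_unitf: "finite I \<Longrightarrow> finite (unitf ` I)"
  by simp

lemma subset_span_unitf: "V \<subseteq> supp I \<Longrightarrow> finite I \<Longrightarrow> V \<subseteq> fs.span (unitf ` I)"
  using supp_subset_span by blast

lemmas supp_dim_mono = fs.dim_mono_finite[OF finite_unitf subset_span_unitf]
lemmas supp_subspace_eq = fs.subspace_eq_finite[OF finite_unitf subset_span_unitf]
lemmas supp_basis = fs.basis_finite_span[OF finite_unitf subset_span_unitf]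
lemmas supp_rank_nullity = fsp.rank_nullity_finite[OF finite_unitf subset_span_unitf]
lemmas supp_dim_image_inj = fsp.dim_image_inj_finite[OF finite_unitf subset_span_unitf]

lemma dim_supp:
  assumes "finite I"
  shows "fs.dim (supp I :: ('b \<Rightarrow> 'a::field) set) = card I"
proof -
  have inj: "inj_on (unitf :: 'b \<Rightarrow> 'b \<Rightarrow> 'a) I"
    by (auto simp: inj_on_def unitf_def fun_eq_iff split: if_splits)
  have "fs.independent (unitf ` I :: ('b \<Rightarrow> 'a) set)"
  proof (rule fs.independent_if_scalars_zero)
    fix f :: "('b \<Rightarrow> 'a) \<Rightarrow> 'a" and x :: "'b \<Rightarrow> 'a"
    assume s: "(\<Sum>x\<in>unitf ` I. fscale (f x) x) = 0" and "x \<in> unitf ` I"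
    then obtain i where i: "i \<in> I" "x = unitf i" by blast
    have "0 = (\<Sum>x\<in>unitf ` I. fscale (f x) x) i"
      using s by simp
    also have "\<dots> = (\<Sum>j\<in>I. fscale (f (unitf j)) (unitf j) i)"
      unfolding sum_fun_apply by (subst sum.reindex[OF inj]) simp
    also have "\<dots> = (\<Sum>j\<in>I. if j = i then f (unitf j) else 0)"
      by (rule sum.cong) (auto simp: unitf_def)
    also have "\<dots> = f x"
      using assms i by simp
    finally show "f x = 0" ..
  qed (use assms in simp)
  moreover have "unitf ` I \<subseteq> (supp I :: ('b \<Rightarrow> 'a) set)"
    by (auto simp: supp_def unitf_def)
  ultimately have "card (unitf ` I :: ('b \<Rightarrow> 'a) set) = fs.dim (supp I :: ('b \<Rightarrow> 'a) set)"
    using supp_subset_span[OF assms] by (intro fs.basis_card_eq_dim)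
  then show ?thesis
    using inj by (simp add: card_image)
qed

definition dot :: "'b set \<Rightarrow> ('b \<Rightarrow> 'a) \<Rightarrow> ('b \<Rightarrow> 'a) \<Rightarrow> 'a::comm_semiring_0" where
  "dot I w v = (\<Sum>i\<in>I. w i * v i)"

lemma dot_add_right: "dot I w (u + v) = dot I w u + dot I w v"
  by (simp add: dot_def algebra_simps sum.distrib)

lemma dot_add_left: "dot I (w + w') u = dot I w u + dot I w' u"
  by (simp add: dot_def algebra_simps sum.distrib)

lemma dot_scale_right: "dot I w (fscale c u) = c * dot I w u"
  by (simp add: dot_def sum_distrib_left algebra_simps)

lemma dot_scale_left: "dot I (fscale c w) u = c * dot I w u"
  by (simp add: dot_def sum_distrib_left algebra_simps)

lemma dot_zero [simp]: "dot I w 0 = 0" "dot I 0 w = 0"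
  by (simp_all add: dot_def)

lemma dot_sum_right: "dot I w (\<Sum>j\<in>J. u j) = (\<Sum>j\<in>J. dot I w (u j))"
  unfolding dot_def sum_fun_apply sum_distrib_left by (rule sum.swap)

lemma dot_sum_left: "dot I (\<Sum>j\<in>J. u j) w = (\<Sum>j\<in>J. dot I (u j) w)"
  unfolding dot_def sum_fun_apply sum_distrib_right by (rule sum.swap)

text \<open>
The coordinates with respect to a basis of the whole function space that extends \<open>B\<close> are linear
functionals. On functions supported in the finite set \<open>I\<close>, a linear functional is the dot product with
the function of its values on the unit functions.
\<close>

lemma dual_basis:
  fixes B :: "('b \<Rightarrow> 'a::field) set"
  assumes "finite I" and "B \<subseteq> supp I" and "fs.independent B"
  obtains w where "\<And>u. w u \<in> supp I"
    and "\<And>u v. u \<in> B \<Longrightarrow> v \<in> B \<Longrightarrow> dot I (w u) v = (if u = v then 1 else 0)"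
proof -
  let ?E = "fs.extend_basis B"
  have E: "fs.independent ?E" "fs.span ?E = UNIV" "B \<subseteq> ?E"
    using assms(3) by (simp_all add: fs.independent_extend_basis fs.extend_basis_superset)
  define w where "w u = (\<lambda>i. if i \<in> I then fs.representation ?E (unitf i) u else 0)" for u
  have "dot I (w u) v = fs.representation ?E v u" if "v \<in> supp I" for u v
  proof -
    have "fs.representation ?E v u = fs.representation ?E (\<Sum>i\<in>I. fscale (v i) (unitf i)) u"
      using supp_expand[OF assms(1) that] by simp
    also have "\<dots> = (\<Sum>i\<in>I. v i * fs.representation ?E (unitf i) u)"
      using E by (simp add: fs.representation_sum fs.representation_scale)
    also have "\<dots> = dot I (w u) v"
      by (auto simp: dot_def w_def intro!: sum.cong)
    finally show ?thesis ..
  qed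
  then have "dot I (w u) v = (if u = v then 1 else 0)" if "u \<in> B" "v \<in> B" for u v
    using that E assms(2) fs.representation_basis[OF E(1), of v] by (auto simp: subset_iff)
  moreover have "w u \<in> supp I" for u
    by (simp add: w_def supp_def)
  ultimately show ?thesis
    using that by blast
qed

text \<open>
Pairing with a basis of \<open>V\<close> maps \<open>supp I\<close> onto all functions on that basis, by the existence of a dual
basis, and the kernel of this map is the annihilator.
\<close>

lemma dim_annihilator:
  fixes V :: "('b \<Rightarrow> 'a::field) set"
  assumes I: "finite I" and V: "V \<subseteq> supp I"
  shows "fs.dim V + fs.dim {w \<in> supp I. \<forall>v\<in>V. dot I w v = 0} = card I"
proof -
  obtain B where B: "finite B" "B \<subseteq> V" "fs.independent B" "V \<subseteq> fs.span B" "card B = fs.dim V"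
    using supp_basis[OF I V I] .
  obtain w where w: "\<And>u. w u \<in> supp I"
    "\<And>u v. u \<in> B \<Longrightarrow> v \<in> B \<Longrightarrow> dot I (w u) v = (if u = v then 1 else 0)"
    using dual_basis[OF I _ B(3)] B(2) V by (metis subset_trans)
  define T where "T x = (\<lambda>b. if b \<in> B then dot I x b else 0)" for x :: "'b \<Rightarrow> 'a"
  have T: "Vector_Spaces.linear fscale fscale T"
    by (rule linear_fscaleI) (auto simp: T_def fun_eq_iff dot_add_left dot_scale_left)
  have "dot I x v = 0" if "\<forall>b\<in>B. dot I x b = 0" "v \<in> V" for x v
  proof -
    have "fs.subspace {v. dot I x v = 0}"
      by (auto simp: fs.subspace_def dot_add_right dot_scale_right)
    then show ?thesis
      using fs.span_minimal[of B "{v. dot I x v = 0}"] that B(4) by blast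
  qed
  then have ker: "{x \<in> supp I. T x = 0} = {w \<in> supp I. \<forall>v\<in>V. dot I w v = 0}"
    using B(2) by (auto simp: T_def fun_eq_iff split: if_splits)
  have im: "T ` supp I = supp B"
  proof (intro equalityI subsetI)
    fix y :: "('b \<Rightarrow> 'a) \<Rightarrow> 'a" assume y: "y \<in> supp B"
    let ?x = "\<Sum>b\<in>B. fscale (y b) (w b)"
    have x: "?x \<in> supp I"
      using w(1) by (intro fs.subspace_sum[OF subspace_supp] fs.subspace_scale[OF subspace_supp])
    have "T ?x = y"
    proof
      fix b
      show "T ?x b = y b"
      proof (cases "b \<in> B")
        case True
        have "dot I ?x b = (\<Sum>c\<in>B. y c * dot I (w c) b)"
          by (simp add: dot_sum_left dot_scale_left)
        also have "\<dots> = (\<Sum>c\<in>B. if c = b then y c else 0)"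
          using w(2) True by (intro sum.cong) auto
        finally show ?thesis
          using True B(1) by (simp add: T_def)
      qed (use y in \<open>auto simp: T_def supp_def\<close>)
    qed
    then show "y \<in> T ` supp I"
      by (rule image_eqI[OF sym x])
  qed (auto simp: T_def supp_def)
  show ?thesis
    using supp_rank_nullity[OF I subset_refl I subspace_supp T, unfolded ker im]
    by (simp add: dim_supp I B(1,5))
qed

section \<open>Rank and kernels\<close>

definition vec_fun :: "nat \<Rightarrow> 'a vec \<Rightarrow> nat \<Rightarrow> 'a::zero" where
  "vec_fun n v = (\<lambda>i. if i < n then v $ i else 0)"

lemma vec_fun_inj: "inj_on (vec_fun n) (carrier_vec n)"
  by (rule inj_onI) (metis carrier_vecD eq_vecI vec_fun_def)

context vec_space
begin

lemma lin_indpt_vec_fun: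
  assumes S: "S \<subseteq> carrier_vec n" and fin: "finite S"
  shows "lin_indpt S \<longleftrightarrow> fs.independent (vec_fun n ` S)"
proof -
  have inj: "inj_on (vec_fun n) S"
    using vec_fun_inj S inj_on_subset by blast
  have lc: "lincomb a S = 0\<^sub>v n \<longleftrightarrow> (\<Sum>v\<in>S. fscale (a v) (vec_fun n v)) = 0" for a
  proof -
    have "lincomb a S = 0\<^sub>v n \<longleftrightarrow> (\<forall>i<n. (\<Sum>x\<in>S. a x * x $ i) = 0)"
      using lincomb_index[OF _ S, of _ a] lincomb_closed[OF S, of a]
      by (auto simp: vec_eq_iff)
    also have "\<dots> \<longleftrightarrow> (\<forall>i. (\<Sum>v\<in>S. fscale (a v) (vec_fun n v)) i = 0)"
    proof -
      have "(\<Sum>v\<in>S. fscale (a v) (vec_fun n v)) i = (if i < n then \<Sum>x\<in>S. a x * x $ i else 0)" for i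
        by (simp add: sum_fun_apply vec_fun_def)
      then show ?thesis by auto
    qed
    finally show ?thesis
      by (simp add: fun_eq_iff)
  qed
  have "lin_dep S \<longleftrightarrow> (\<exists>a. (\<exists>v\<in>S. a v \<noteq> 0) \<and> lincomb a S = 0\<^sub>v n)"
  proof
    assume "lin_dep S"
    then show "\<exists>a. (\<exists>v\<in>S. a v \<noteq> 0) \<and> lincomb a S = 0\<^sub>v n"
      using finite_lin_dep[OF fin] S by fastforce
  next
    assume "\<exists>a. (\<exists>v\<in>S. a v \<noteq> 0) \<and> lincomb a S = 0\<^sub>v n"
    then obtain a v where "v \<in> S" "a v \<noteq> 0" "lincomb a S = 0\<^sub>v n"
      by blast
    then show "lin_dep S"
      using lin_dep_crit[OF fin subset_refl] by blast
  qed
  also have "\<dots> \<longleftrightarrow> (\<exists>u. (\<exists>v\<in>vec_fun n ` S. u v \<noteq> 0) \<and> (\<Sum>v\<in>vec_fun n ` S. fscale (u v) v) = 0)"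
    (is "?l \<longleftrightarrow> ?r")
  proof
    assume ?l
    then obtain a v where a: "v \<in> S" "a v \<noteq> 0" "(\<Sum>v\<in>S. fscale (a v) (vec_fun n v)) = 0"
      unfolding lc by blast
    let ?u = "\<lambda>w. a (the_inv_into S (vec_fun n) w)"
    have "(\<Sum>v\<in>vec_fun n ` S. fscale (?u v) v) = (\<Sum>v\<in>S. fscale (a v) (vec_fun n v))"
      by (subst sum.reindex[OF inj]) (auto simp: the_inv_into_f_f[OF inj] intro!: sum.cong)
    with a show ?r
      by (intro exI[of _ ?u]) (auto simp: the_inv_into_f_f[OF inj])
  next
    assume ?r
    then obtain u where "\<exists>v\<in>S. u (vec_fun n v) \<noteq> 0" "(\<Sum>v\<in>S. fscale (u (vec_fun n v)) (vec_fun n v)) = 0"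
      by (auto simp: sum.reindex[OF inj])
    then show ?l
      unfolding lc by (intro exI[of _ "\<lambda>v. u (vec_fun n v)"]) simp
  qed
  also have "\<dots> \<longleftrightarrow> fs.dependent (vec_fun n ` S)"
    using fs.dependent_finite[of "vec_fun n ` S"] fin by simp
  finally show ?thesis
    by simp
qed

lemma rank_eq_dim_cols:
  assumes M: "M \<in> carrier_mat n nc"
  shows "rank M = fs.dim (vec_fun n ` set (cols M))"
proof -
  let ?C = "set (cols M)"
  have C: "?C \<subseteq> carrier_vec n"
    using cols_dim M by blast
  obtain S where S: "finite S" "maximal S (\<lambda>T. T \<subseteq> ?C \<and> lin_indpt T)"
    using maximal_exists_superset[of ?C "\<lambda>T. T \<subseteq> ?C \<and> lin_indpt T" "{}"]
    by (auto simp: lin_dep_def)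
  then have S': "S \<subseteq> ?C" "lin_indpt S"
    by (auto simp: maximal_def)
  have ind: "fs.independent (vec_fun n ` S)"
    using lin_indpt_vec_fun[OF _ S(1)] S' C by blast
  have "vec_fun n v \<in> fs.span (vec_fun n ` S)" if v: "v \<in> ?C" for v
  proof (rule ccontr)
    assume nin: "vec_fun n v \<notin> fs.span (vec_fun n ` S)"
    then have "fs.independent (vec_fun n ` insert v S)"
      using ind by (simp add: fs.independent_insertI)
    then have "lin_indpt (insert v S)"
      using lin_indpt_vec_fun[of "insert v S"] S(1) S'(1) v C by blast
    then have "insert v S = S"
      using S(2) S'(1) v unfolding maximal_def by blast
    then show False
      using nin fs.span_base by blast
  qed
  then have "card (vec_fun n ` S) = fs.dim (vec_fun n ` ?C)"
    using S'(1) ind by (intro fs.basis_card_eq_dim) auto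
  moreover have "card (vec_fun n ` S) = card S"
    using vec_fun_inj S'(1) C by (meson card_image inj_on_subset)
  ultimately show ?thesis
    using rank_card_indpt[OF M S(2)] by simp
qed

end

lemma unitf_image_subset_supp: "unitf ` I \<subseteq> supp I"
  by (auto simp: unitf_def supp_def)

lemma colspan_linear:
  "Vector_Spaces.linear fscale fscale (\<lambda>x r. if r < nr then \<Sum>c<nc. M $$ (r, c) * x c else (0::'a::field))"
  by (rule linear_fscaleI) (auto simp: fun_eq_iff algebra_simps sum.distrib sum_distrib_left)

lemma mat_rank_eq_dim_image:
  fixes M :: "'a::field mat"
  assumes M: "M \<in> carrier_mat nr nc"
  shows "mat_rank M =
    fs.dim ((\<lambda>x r. if r < nr then \<Sum>c<nc. M $$ (r, c) * x c else 0) ` supp {..<nc})"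
    (is "_ = fs.dim (?f ` _)")
proof -
  have "?f (unitf c) = vec_fun nr (col M c)" if "c < nc" for c
    using M that by (auto simp: fun_eq_iff vec_fun_def unitf_def if_distrib cong: if_cong)
  then have "?f ` unitf ` {..<nc} = vec_fun nr ` set (cols M)"
    using M by (auto simp: cols_def image_image)
  moreover have "fs.span (unitf ` {..<nc}) = (supp {..<nc} :: (nat \<Rightarrow> 'a) set)"
    by (rule fs.span_subspace[OF unitf_image_subset_supp supp_subset_span subspace_supp]) simp
  moreover have "?f ` fs.span (unitf ` {..<nc}) = fs.span (?f ` unitf ` {..<nc})"
    by (rule fsp.linear_span_image[OF colspan_linear, symmetric])
  ultimately have "?f ` supp {..<nc} = fs.span (vec_fun nr ` set (cols M))"
    by simp
  then have "fs.dim (?f ` supp {..<nc}) = fs.dim (vec_fun nr ` set (cols M))"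
    by simp
  then show ?thesis
    using vec_space.rank_eq_dim_cols[OF M] M by (simp add: mat_rank_def)
qed

lemma rank_add_dim_kernel:
  fixes M :: "'a::field mat"
  assumes M: "M \<in> carrier_mat nr nc"
  shows "mat_rank M + fs.dim {x \<in> supp {..<nc}. \<forall>r<nr. (\<Sum>c<nc. M $$ (r, c) * x c) = 0} = nc"
proof -
  let ?f = "\<lambda>x r. if r < nr then \<Sum>c<nc. M $$ (r, c) * x c else 0"
  have rn: "fs.dim (supp {..<nc} :: (nat \<Rightarrow> 'a) set) =
      fs.dim {x \<in> supp {..<nc}. ?f x = 0} + fs.dim (?f ` supp {..<nc})"
    by (rule supp_rank_nullity[OF finite_lessThan subset_refl finite_lessThan subspace_supp
          colspan_linear])
  have eq: "{x \<in> supp {..<nc}. (\<lambda>r. if r < nr then \<Sum>c<nc. M $$ (r, c) * x c else 0) = 0} =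
      {x \<in> supp {..<nc}. \<forall>r<nr. (\<Sum>c<nc. M $$ (r, c) * x c) = 0}"
    by (auto simp: fun_eq_iff)
  then show ?thesis
    using rn unfolding mat_rank_eq_dim_image[OF M] dim_supp[OF finite_lessThan] card_lessThan eq
    by linarith
qed

text \<open>
The left kernel is the annihilator of the column space, so its dimension follows from the column rank
without any mention of row rank.
\<close>

lemma rank_add_dim_left_kernel:
  fixes M :: "'a::field mat"
  assumes M: "M \<in> carrier_mat nr nc"
  shows "mat_rank M + fs.dim {y \<in> supp {..<nr}. \<forall>c<nc. (\<Sum>r<nr. y r * M $$ (r, c)) = 0} = nr"
proof -
  let ?f = "\<lambda>x r. if r < nr then \<Sum>c<nc. M $$ (r, c) * x c else 0"
  have sub: "?f ` supp {..<nc} \<subseteq> supp {..<nr}"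
    by (auto simp: supp_def)
  have d: "dot {..<nr} y (?f x) = (\<Sum>c<nc. (\<Sum>r<nr. y r * M $$ (r, c)) * x c)" for y x
    by (simp add: dot_def sum_distrib_left sum_distrib_right mult.assoc) (rule sum.swap)
  have "(\<forall>v\<in>?f ` supp {..<nc}. dot {..<nr} y v = 0) \<longleftrightarrow> (\<forall>c<nc. (\<Sum>r<nr. y r * M $$ (r, c)) = 0)"
    for y :: "nat \<Rightarrow> 'a"
  proof
    assume a: "\<forall>v\<in>?f ` supp {..<nc}. dot {..<nr} y v = 0"
    show "\<forall>c<nc. (\<Sum>r<nr. y r * M $$ (r, c)) = 0"
    proof (intro allI impI)
      fix c assume c: "c < nc"
      have "unitf c \<in> supp {..<nc}"
        using c by (auto simp: supp_def unitf_def)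
      with a have "dot {..<nr} y (?f (unitf c)) = 0" by blast
      then show "(\<Sum>r<nr. y r * M $$ (r, c)) = 0"
        unfolding d using c by (simp add: unitf_def if_distrib cong: if_cong)
    qed
  next
    assume "\<forall>c<nc. (\<Sum>r<nr. y r * M $$ (r, c)) = 0"
    then have "(\<Sum>c<nc. (\<Sum>r<nr. y r * M $$ (r, c)) * x c) = 0" for x
      by simp
    then show "\<forall>v\<in>?f ` supp {..<nc}. dot {..<nr} y v = 0"
      unfolding d[symmetric] by blast
  qed
  then have "{w \<in> supp {..<nr}. \<forall>v\<in>?f ` supp {..<nc}. dot {..<nr} w v = 0} =
      {y \<in> supp {..<nr}. \<forall>c<nc. (\<Sum>r<nr. y r * M $$ (r, c)) = 0}"
    by simp
  then show ?thesis
    using dim_annihilator[OF finite_lessThan sub] unfolding mat_rank_eq_dim_image[OF M]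
    by simp
qed

section \<open>Systems of linear equations with matrix coefficients\<close>

text \<open>
Renaming the unknowns of a linear system along \<open>\<sigma>\<close> does not change the dimension of its solution space.
Systems are written with structured indices, such as triples, while the unknowns of
\<open>eval_nc_mat\<close> are numbered consecutively.
\<close>

lemma dim_reindex:
  assumes \<sigma>: "bij_betw \<sigma> J I" and "finite I" and S: "S \<subseteq> supp J" "fs.subspace S"
  shows "fs.dim {x \<in> supp I. (\<lambda>j. if j \<in> J then x (\<sigma> j) else (0::'a::field)) \<in> S} = fs.dim S"
proof -
  define T where "T x = (\<lambda>j. if j \<in> J then x (\<sigma> j) else (0::'a))" for x
  let ?V = "{x \<in> supp I. T x \<in> S}"
  have T: "Vector_Spaces.linear fscale fscale T"
    by (rule linear_fscaleI) (auto simp: T_def fun_eq_iff)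
  have V: "fs.subspace ?V"
    using subspace_supp[of I] S(2) fsp.linear_0[OF T] fsp.linear_add[OF T] fsp.linear_scale[OF T]
    by (auto simp: fs.subspace_def)
  have inj: "x = 0" if "x \<in> ?V" "T x = 0" for x
  proof
    fix i
    show "x i = 0 i"
    proof (cases "i \<in> I")
      case True
      then obtain j where "j \<in> J" "i = \<sigma> j"
        using \<sigma> unfolding bij_betw_def by blast
      then show ?thesis
        using fun_cong[OF that(2), of j] by (simp add: T_def)
    qed (use that in \<open>simp add: supp_def\<close>)
  qed
  have "T ` ?V = S"
  proof (intro equalityI subsetI)
    fix F assume F: "F \<in> S"
    define x where "x = (\<lambda>i. if i \<in> I then F (the_inv_into J \<sigma> i) else 0)"
    have "T x = F"
    proof
      fix j
      show "T x j = F j"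
        using \<sigma> F S(1) the_inv_into_f_f[of \<sigma> J j]
        by (auto simp: T_def x_def bij_betw_def supp_def)
    qed
    moreover have "x \<in> supp I"
      by (simp add: x_def supp_def)
    ultimately show "F \<in> T ` ?V"
      using F by (metis (mono_tags, lifting) image_eqI mem_Collect_eq)
  qed auto
  then show ?thesis
    using supp_dim_image_inj[OF \<open>finite I\<close> _ \<open>finite I\<close> V T inj] by (auto simp: T_def)
qed

text \<open>
The element \<open>a + b x\<^sub>s\<close> of the free algebra; presentations of modules need no others.
\<close>

definition lin_nc :: "'a::field \<Rightarrow> 'a \<Rightarrow> nat \<Rightarrow> 'a ncpoly" where
  "lin_nc a b s = Poly_Mapping.single [] a + Poly_Mapping.single [s] b"

lemma keys_lin_nc: "Poly_Mapping.keys (lin_nc a b s) \<subseteq> {[], [s]}"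
  unfolding lin_nc_def
  by (rule order_trans[OF Poly_Mapping.keys_add]) (auto split: if_splits)

lemma lin_nc_free_alg: "s < m \<Longrightarrow> lin_nc a b s \<in> free_alg m"
  using keys_lin_nc[of a b s] by (auto simp: free_alg_def)

lemma eval_lin_nc:
  assumes "s < m" and A: "A \<in> mat_tuples m n" and "i < n" and "j < n"
  shows "eval_nc n A (lin_nc a b s) $$ (i, j) = (if i = j then a else 0) + b * A ! s $$ (i, j)"
proof -
  have As: "A ! s \<in> carrier_mat n n"
    using assms by (auto simp: mat_tuples_def)
  have "eval_nc n A (lin_nc a b s) $$ (i, j) =
      (\<Sum>w\<in>{[], [s]}. Poly_Mapping.lookup (lin_nc a b s) w * eval_word n A w $$ (i, j))"
  proof -
    have "eval_nc n A (lin_nc a b s) $$ (i, j) =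
        (\<Sum>w\<in>Poly_Mapping.keys (lin_nc a b s). Poly_Mapping.lookup (lin_nc a b s) w * eval_word n A w $$ (i, j))"
      using assms by (simp add: eval_nc_def)
    also have "\<dots> = (\<Sum>w\<in>{[], [s]}. Poly_Mapping.lookup (lin_nc a b s) w * eval_word n A w $$ (i, j))"
      using keys_lin_nc[of a b s] by (intro sum.mono_neutral_left) (auto simp: in_keys_iff)
    finally show ?thesis .
  qed
  then show ?thesis
    using assms As by (simp add: lin_nc_def lookup_add lookup_single eval_word_def)
qed

lemma sum_blocks: "(\<Sum>c<l * n. f c) = (\<Sum>c<l. \<Sum>i<n. f (c * n + i))"
  for f :: "nat \<Rightarrow> 'b::comm_monoid_add"
proof -
  have "sum f {c * n..<c * n + n} = (\<Sum>i<n. f (c * n + i))" for c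
    using sum.shift_bounds_nat_ivl[of f 0 "c * n" n] by (simp add: add.commute atLeast0LessThan)
  then show ?thesis
    using sum.nat_group[of f n l] by simp
qed

lemma all_blocks: "(\<forall>r<k * n. P r) \<longleftrightarrow> (\<forall>j<k. \<forall>i<n. P (j * n + i))" for n :: nat
proof
  assume "\<forall>j<k. \<forall>i<n. P (j * n + i)"
  then have "P (r div n * n + r mod n)" if "r < k * n" for r
    using that by (metis less_mult_imp_div_less mod_less_divisor mult_0_right gr_zeroI not_less_zero)
  then show "\<forall>r<k * n. P r" by simp
next
  assume a: "\<forall>r<k * n. P r"
  have "j * n + i < k * n" if "j < k" "i < n" for i j
  proof -
    have "j * n + i < Suc j * n" using that by simp
    also have "\<dots> \<le> k * n" using that by (intro mult_le_mono1) simp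
    finally show ?thesis .
  qed
  then show "\<forall>j<k. \<forall>i<n. P (j * n + i)"
    using a by blast
qed

lemma block_bij:
  assumes e: "bij_betw e C {..<l}"
  shows "bij_betw (\<lambda>(c, i). e c * n + i) (C \<times> {..<n}) {..<l * n::nat}"
  unfolding bij_betw_def
proof
  have "e c * n + i = e c' * n + i' \<Longrightarrow> e c = e c' \<and> i = i'" if "i < n" "i' < n" for c c' i i'
    using that by (metis add.commute div_mult_self1 div_less mod_mult_self1 mod_less
        add_cancel_left_left not_less_zero neq0_conv)
  then show "inj_on (\<lambda>(c, i). e c * n + i) (C \<times> {..<n})"
    using e by (auto simp: inj_on_def bij_betw_def)
  show "(\<lambda>(c, i). e c * n + i) ` (C \<times> {..<n}) = {..<l * n}"
  proof (intro equalityI subsetI)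
    fix r assume "r \<in> (\<lambda>(c, i). e c * n + i) ` (C \<times> {..<n})"
    then show "r \<in> {..<l * n}"
      using e all_blocks[of l n "\<lambda>r. r < l * n"] by (auto simp: bij_betw_def)
  next
    fix r assume r: "r \<in> {..<l * n}"
    then have "r div n < l" "r mod n < n"
      using less_mult_imp_div_less by (auto intro!: mod_less_divisor intro: gr_zeroI)
    then obtain c where "c \<in> C" "e c = r div n"
      using e unfolding bij_betw_def by (metis imageE lessThan_iff)
    then show "r \<in> (\<lambda>(c, i). e c * n + i) ` (C \<times> {..<n})"
      using \<open>r mod n < n\<close> by (intro image_eqI[of _ _ "(c, r mod n)"]) auto
  qed
qed

text \<open>
One row of the evaluation of a matrix over the free algebra, applied to a vector \<open>x\<close>: the entries in
this row are \<open>a c + b c x\<^sub>s\<close>, and \<open>Z c\<close> is row \<open>i\<close> of the value of the variable in the entry at \<open>c\<close>.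
\<close>

definition block_form ::
  "'c set \<Rightarrow> nat \<Rightarrow> ('c \<Rightarrow> 'a) \<Rightarrow> ('c \<Rightarrow> 'a) \<Rightarrow> ('c \<Rightarrow> nat \<Rightarrow> 'a) \<Rightarrow> nat \<Rightarrow> ('c \<times> nat \<Rightarrow> 'a::field) \<Rightarrow> 'a"
  where "block_form C n a b Z i x = (\<Sum>c\<in>C. a c * x (c, i) + b c * (\<Sum>i'<n. Z c i' * x (c, i')))"

lemma block_form_add: "block_form C n a b Z i (x + y) = block_form C n a b Z i x + block_form C n a b Z i y"
  by (simp add: block_form_def algebra_simps sum.distrib)

lemma block_form_scale: "block_form C n a b Z i (fscale c x) = c * block_form C n a b Z i x"
  by (simp add: block_form_def algebra_simps sum_distrib_left)

lemma block_form_zero: "block_form C n a b Z i 0 = 0"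
  by (simp add: block_form_def)

lemma block_form_unblock:
  assumes "bij_betw e C {..<l}" and "i < n"
  shows "(\<Sum>r<l * n. (if i = r mod n then a (the_inv_into C e (r div n)) else 0) * x r +
        b (the_inv_into C e (r div n)) * Z (the_inv_into C e (r div n)) (r mod n) * x r) =
    block_form C n a b Z i (\<lambda>j. if j \<in> C \<times> {..<n} then x (case j of (c, i) \<Rightarrow> e c * n + i) else 0)"
    (is "?L = ?R")
proof -
  let ?g = "the_inv_into C e"
  have "?L = (\<Sum>c<l. \<Sum>i'<n. (if i = i' then a (?g c) * x (c * n + i') else 0) +
      b (?g c) * (Z (?g c) i' * x (c * n + i')))"
    unfolding sum_blocks by (intro sum.cong refl) (auto simp: mult.assoc)
  also have "\<dots> = (\<Sum>c<l. a (?g c) * x (c * n + i) + b (?g c) * (\<Sum>i'<n. Z (?g c) i' * x (c * n + i')))"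
    using assms(2) by (simp add: sum.distrib sum_distrib_left)
  also have "\<dots> = (\<Sum>c\<in>C. a (?g (e c)) * x (e c * n + i) + b (?g (e c)) * (\<Sum>i'<n. Z (?g (e c)) i' * x (e c * n + i')))"
    by (rule sum.reindex_bij_betw[OF assms(1), symmetric])
  also have "\<dots> = ?R"
    unfolding block_form_def using assms
    by (intro sum.cong refl) (auto simp: bij_betw_def the_inv_into_f_f)
  finally show ?thesis .
qed

context
  fixes J :: "'j set" and C :: "'c set" and \<alpha> \<beta> :: "'j \<Rightarrow> 'c \<Rightarrow> 'a::field"
    and \<sigma> :: "'j \<Rightarrow> 'c \<Rightarrow> nat" and m n :: nat
begin

definition block_kernel :: "'a mat list \<Rightarrow> ('c \<times> nat \<Rightarrow> 'a) set" where
  "block_kernel Y = {x \<in> supp (C \<times> {..<n}). \<forall>j\<in>J. \<forall>i<n.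
     block_form C n (\<alpha> j) (\<beta> j) (\<lambda>c i'. Y ! \<sigma> j c $$ (i, i')) i x = 0}"

definition block_left_kernel :: "'a mat list \<Rightarrow> ('j \<times> nat \<Rightarrow> 'a) set" where
  "block_left_kernel Y = {y \<in> supp (J \<times> {..<n}). \<forall>c\<in>C. \<forall>i<n.
     block_form J n (\<lambda>j. \<alpha> j c) (\<lambda>j. \<beta> j c) (\<lambda>j i'. Y ! \<sigma> j c $$ (i', i)) i y = 0}"

lemma subspace_block_kernel: "fs.subspace (block_kernel Y)"
  using subspace_supp[of "C \<times> {..<n}"]
  by (auto simp: fs.subspace_def block_kernel_def block_form_add block_form_scale block_form_zero)

lemma subspace_block_left_kernel: "fs.subspace (block_left_kernel Y)"
  using subspace_supp[of "J \<times> {..<n}"]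
  by (auto simp: fs.subspace_def block_left_kernel_def block_form_add block_form_scale block_form_zero)

context
  assumes J: "finite J" "J \<noteq> {}" and C: "finite C" "C \<noteq> {}"
    and \<sigma>: "\<And>j c. j \<in> J \<Longrightarrow> c \<in> C \<Longrightarrow> \<sigma> j c < m"
begin

text \<open>
The matrix with entry \<open>\<alpha> j c + \<beta> j c x\<^sub>s\<close> at \<open>(j, c)\<close>, where \<open>s = \<sigma> j c\<close>, turns the two solution spaces
into the kernel and the left kernel of its evaluation, whose dimensions the rank determines.
\<close>

lemma block_matrix:
  obtains \<phi> where "\<phi> \<in> carrier_mat (card J) (card C)" and "elements_mat \<phi> \<subseteq> free_alg m"
    and "\<And>Y. Y \<in> mat_tuples m n \<Longrightarrow>
      mat_rank (eval_nc_mat n Y \<phi>) + fs.dim (block_kernel Y) = card C * n"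
    and "\<And>Y. Y \<in> mat_tuples m n \<Longrightarrow>
      mat_rank (eval_nc_mat n Y \<phi>) + fs.dim (block_left_kernel Y) = card J * n"
proof -
  let ?k = "card J" and ?l = "card C"
  obtain e where e: "bij_betw e J {..<?k}"
    using ex_bij_betw_finite_nat[OF J(1)] by (auto simp: atLeast0LessThan)
  obtain d where d: "bij_betw d C {..<?l}"
    using ex_bij_betw_finite_nat[OF C(1)] by (auto simp: atLeast0LessThan)
  let ?e = "the_inv_into J e" and ?d = "the_inv_into C d"
  have eJ: "?e j \<in> J" if "j < ?k" for j
    using bij_betw_the_inv_into[OF e] that by (auto simp: bij_betw_def)
  have dC: "?d c \<in> C" if "c < ?l" for c
    using bij_betw_the_inv_into[OF d] that by (auto simp: bij_betw_def)
  define \<phi> where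
    "\<phi> = mat ?k ?l (\<lambda>(j, c). lin_nc (\<alpha> (?e j) (?d c)) (\<beta> (?e j) (?d c)) (\<sigma> (?e j) (?d c)))"
  have \<phi>: "\<phi> \<in> carrier_mat ?k ?l"
    by (simp add: \<phi>_def)
  have el: "elements_mat \<phi> \<subseteq> free_alg m"
    using \<sigma> eJ dC by (auto simp: \<phi>_def elements_mat_def intro!: lin_nc_free_alg)
  have ent: "eval_nc_mat n Y \<phi> $$ (r, c) =
      (if r mod n = c mod n then \<alpha> (?e (r div n)) (?d (c div n)) else 0) +
      \<beta> (?e (r div n)) (?d (c div n)) * Y ! \<sigma> (?e (r div n)) (?d (c div n)) $$ (r mod n, c mod n)"
    if "Y \<in> mat_tuples m n" "r < ?k * n" "c < ?l * n" for Y r c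
  proof -
    have "r div n < ?k" "c div n < ?l" "r mod n < n" "c mod n < n"
      using that less_mult_imp_div_less by (auto intro!: mod_less_divisor intro: gr_zeroI)
    then show ?thesis
      using that eJ dC \<sigma> eval_lin_nc[OF _ that(1)] by (simp add: eval_nc_mat_def \<phi>_def)
  qed
  have M: "eval_nc_mat n Y \<phi> \<in> carrier_mat (?k * n) (?l * n)" for Y
    using \<phi> by (simp add: eval_nc_mat_def)
  have sub: "block_kernel Y \<subseteq> supp (C \<times> {..<n})" for Y
    by (auto simp: block_kernel_def)
  have sub': "block_left_kernel Y \<subseteq> supp (J \<times> {..<n})" for Y
    by (auto simp: block_left_kernel_def)
  have bijd: "bij_betw (\<lambda>(c, i). d c * n + i) (C \<times> {..<n}) {..<?l * n}"
    by (rule block_bij[OF d])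
  have bije: "bij_betw (\<lambda>(c, i). e c * n + i) (J \<times> {..<n}) {..<?k * n}"
    by (rule block_bij[OF e])
  have ballJ: "(\<forall>j<?k. P (?e j)) \<longleftrightarrow> (\<forall>j\<in>J. P j)" for P
    using bij_betw_the_inv_into[OF e] unfolding bij_betw_def by (metis imageE imageI lessThan_iff)
  have ballC: "(\<forall>j<?l. P (?d j)) \<longleftrightarrow> (\<forall>j\<in>C. P j)" for P
    using bij_betw_the_inv_into[OF d] unfolding bij_betw_def by (metis imageE imageI lessThan_iff)
  have "mat_rank (eval_nc_mat n Y \<phi>) + fs.dim (block_kernel Y) = ?l * n"
    if Y: "Y \<in> mat_tuples m n" for Y
  proof -
    let ?T = "\<lambda>x j. if j \<in> C \<times> {..<n} then x (case j of (c, i) \<Rightarrow> d c * n + i) else 0"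
    have row: "(\<Sum>c<?l * n. eval_nc_mat n Y \<phi> $$ (j * n + i, c) * x c) =
        block_form C n (\<alpha> (?e j)) (\<beta> (?e j)) (\<lambda>c i'. Y ! \<sigma> (?e j) c $$ (i, i')) i (?T x)"
      if ji: "j < ?k" "i < n" for j i x
    proof -
      have lt: "j * n + i < ?k * n"
        using all_blocks[of ?k n "\<lambda>r. r < ?k * n"] ji by blast
      have dm: "(j * n + i) div n = j" "(j * n + i) mod n = i"
        using ji by simp_all
      show ?thesis
        unfolding block_form_unblock[OF d ji(2), symmetric]
        by (intro sum.cong refl, unfold lessThan_iff, simp only: ent[OF Y lt] dm)
          (simp only: distrib_right)
    qed
    have equiv: "(\<forall>r<?k * n. (\<Sum>c<?l * n. eval_nc_mat n Y \<phi> $$ (r, c) * x c) = 0) \<longleftrightarrow> ?T x \<in> block_kernel Y"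
      for x
    proof -
      have "(\<forall>r<?k * n. (\<Sum>c<?l * n. eval_nc_mat n Y \<phi> $$ (r, c) * x c) = 0) \<longleftrightarrow>
          (\<forall>j<?k. \<forall>i<n. block_form C n (\<alpha> (?e j)) (\<beta> (?e j)) (\<lambda>c i'. Y ! \<sigma> (?e j) c $$ (i, i')) i (?T x) = 0)"
        unfolding all_blocks by (intro all_cong1 imp_cong refl, simp only: row)
      also have "\<dots> \<longleftrightarrow> (\<forall>j\<in>J. \<forall>i<n. block_form C n (\<alpha> j) (\<beta> j) (\<lambda>c i'. Y ! \<sigma> j c $$ (i, i')) i (?T x) = 0)"
        by (rule ballJ)
      also have "\<dots> \<longleftrightarrow> ?T x \<in> block_kernel Y"
        unfolding block_kernel_def by (simp add: supp_def)
      finally show ?thesis .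
    qed
    have eq: "fs.dim {x \<in> supp {..<?l * n}. \<forall>r<?k * n. (\<Sum>c<?l * n. eval_nc_mat n Y \<phi> $$ (r, c) * x c) = 0}
        = fs.dim (block_kernel Y)"
      unfolding equiv by (rule dim_reindex[OF bijd finite_lessThan sub subspace_block_kernel])
    show ?thesis
      using rank_add_dim_kernel[OF M[of Y]] unfolding eq .
  qed
  moreover have "mat_rank (eval_nc_mat n Y \<phi>) + fs.dim (block_left_kernel Y) = ?k * n"
    if Y: "Y \<in> mat_tuples m n" for Y
  proof -
    let ?T = "\<lambda>x j. if j \<in> J \<times> {..<n} then x (case j of (c, i) \<Rightarrow> e c * n + i) else 0"
    have col: "(\<Sum>r<?k * n. x r * eval_nc_mat n Y \<phi> $$ (r, c * n + i)) =
        block_form J n (\<lambda>j. \<alpha> j (?d c)) (\<lambda>j. \<beta> j (?d c)) (\<lambda>j i'. Y ! \<sigma> j (?d c) $$ (i', i)) i (?T x)"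
      if ji: "c < ?l" "i < n" for c i x
    proof -
      have lt: "c * n + i < ?l * n"
        using all_blocks[of ?l n "\<lambda>r. r < ?l * n"] ji by blast
      have dm: "(c * n + i) div n = c" "(c * n + i) mod n = i"
        using ji by simp_all
      show ?thesis
        unfolding block_form_unblock[OF e ji(2), symmetric]
        by (intro sum.cong refl, unfold lessThan_iff,
            simp only: ent[OF Y _ lt] dm mult.commute[of "x r" for r])
          (auto simp: distrib_right)
    qed
    have equiv: "(\<forall>c<?l * n. (\<Sum>r<?k * n. x r * eval_nc_mat n Y \<phi> $$ (r, c)) = 0) \<longleftrightarrow> ?T x \<in> block_left_kernel Y"
      for x
    proof -
      have "(\<forall>c<?l * n. (\<Sum>r<?k * n. x r * eval_nc_mat n Y \<phi> $$ (r, c)) = 0) \<longleftrightarrow>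
          (\<forall>c<?l. \<forall>i<n. block_form J n (\<lambda>j. \<alpha> j (?d c)) (\<lambda>j. \<beta> j (?d c)) (\<lambda>j i'. Y ! \<sigma> j (?d c) $$ (i', i)) i (?T x) = 0)"
        unfolding all_blocks by (intro all_cong1 imp_cong refl, simp only: col)
      also have "\<dots> \<longleftrightarrow> (\<forall>c\<in>C. \<forall>i<n. block_form J n (\<lambda>j. \<alpha> j c) (\<lambda>j. \<beta> j c) (\<lambda>j i'. Y ! \<sigma> j c $$ (i', i)) i (?T x) = 0)"
        by (rule ballC)
      also have "\<dots> \<longleftrightarrow> ?T x \<in> block_left_kernel Y"
        unfolding block_left_kernel_def by (simp add: supp_def)
      finally show ?thesis .
    qed
    have eq: "fs.dim {x \<in> supp {..<?k * n}. \<forall>c<?l * n. (\<Sum>r<?k * n. x r * eval_nc_mat n Y \<phi> $$ (r, c)) = 0}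
        = fs.dim (block_left_kernel Y)"
      unfolding equiv by (rule dim_reindex[OF bije finite_lessThan sub' subspace_block_left_kernel])
    show ?thesis
      using rank_add_dim_left_kernel[OF M[of Y]] unfolding eq .
  qed
  ultimately show ?thesis
    using that[OF \<phi> el] by blast
qed

lemma hom_le_block_kernels:
  assumes "hom_le m n A B" and "A \<in> mat_tuples m n" and "B \<in> mat_tuples m n"
  shows "fs.dim (block_kernel A) \<le> fs.dim (block_kernel B)"
    and "fs.dim (block_left_kernel A) \<le> fs.dim (block_left_kernel B)"
proof -
  obtain \<phi> where \<phi>: "\<phi> \<in> carrier_mat (card J) (card C)" "elements_mat \<phi> \<subseteq> free_alg m"
    and rk: "\<And>Y. Y \<in> mat_tuples m n \<Longrightarrow>
      mat_rank (eval_nc_mat n Y \<phi>) + fs.dim (block_kernel Y) = card C * n"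
    "\<And>Y. Y \<in> mat_tuples m n \<Longrightarrow>
      mat_rank (eval_nc_mat n Y \<phi>) + fs.dim (block_left_kernel Y) = card J * n"
    using block_matrix by blast
  have "card J \<ge> 1" "card C \<ge> 1"
    using J C by (simp_all add: Suc_leI card_gt_0_iff)
  then have "mat_rank (eval_nc_mat n A \<phi>) \<ge> mat_rank (eval_nc_mat n B \<phi>)"
    using assms(1) \<phi> unfolding hom_le_def by blast
  then show "fs.dim (block_kernel A) \<le> fs.dim (block_kernel B)"
    and "fs.dim (block_left_kernel A) \<le> fs.dim (block_left_kernel B)"
    using rk(1)[OF assms(2)] rk(1)[OF assms(3)] rk(2)[OF assms(2)] rk(2)[OF assms(3)] by linarith+
qed

end
end

section \<open>Matrices as functions, and spaces of homomorphisms\<close>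

text \<open>
Square matrices as functions, extended by \<open>0\<close>, form a vector space of functions in which products are
associative without side conditions.
\<close>

type_synonym 'a fmat = "nat \<times> nat \<Rightarrow> 'a"

definition fmats :: "nat \<Rightarrow> 'a::zero fmat set" where
  "fmats n = supp ({..<n} \<times> {..<n})"

definition fmat :: "nat \<Rightarrow> 'a mat \<Rightarrow> 'a::zero fmat" where
  "fmat n M = (\<lambda>(i, j). if i < n \<and> j < n then M $$ (i, j) else 0)"

definition mm :: "nat \<Rightarrow> 'a fmat \<Rightarrow> 'a fmat \<Rightarrow> 'a::comm_ring_1 fmat" where
  "mm n f g = (\<lambda>(i, j). \<Sum>k<n. f (i, k) * g (k, j))"

definition idf :: "nat \<Rightarrow> 'a::comm_ring_1 fmat" where
  "idf n = (\<lambda>(i, j). if i = j \<and> i < n then 1 else 0)"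

lemma mm_add_left: "mm n (f + f') g = mm n f g + mm n f' g"
  and mm_add_right: "mm n f (g + g') = mm n f g + mm n f g'"
  and mm_diff_left: "mm n (f - f') g = mm n f g - mm n f' g"
  and mm_diff_right: "mm n f (g - g') = mm n f g - mm n f g'"
  by (simp_all add: mm_def fun_eq_iff algebra_simps sum.distrib sum_subtractf)

lemma mm_zero_left [simp]: "mm n 0 g = 0" and mm_zero_right [simp]: "mm n f 0 = 0"
  by (simp_all add: mm_def fun_eq_iff)

lemma mm_scale_left: "mm n (fscale c f) g = fscale c (mm n f g)"
  and mm_scale_right: "mm n f (fscale c g) = fscale c (mm n f g)"
  by (simp_all add: mm_def fun_eq_iff algebra_simps sum_distrib_left)

lemma mm_assoc: "mm n (mm n f g) h = mm n f (mm n g h)"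
proof -
  have "mm n (mm n f g) h (i, j) = mm n f (mm n g h) (i, j)" for i j
    unfolding mm_def by (simp add: sum_distrib_left sum_distrib_right mult.assoc) (rule sum.swap)
  then show ?thesis
    by (auto simp: fun_eq_iff)
qed

lemma mm_sum_left: "mm n (\<Sum>t\<in>T. f t) g = (\<Sum>t\<in>T. mm n (f t) g)"
  by (rule ext) (auto simp: mm_def sum_fun_apply sum_distrib_right intro: sum.swap)

lemma mm_sum_right: "mm n g (\<Sum>t\<in>T. f t) = (\<Sum>t\<in>T. mm n g (f t))"
  by (rule ext) (auto simp: mm_def sum_fun_apply sum_distrib_left intro: sum.swap)

lemma if_one_mult:
  "(if P then 1 else 0) * x = (if P then x else (0::'a::comm_ring_1))"
  "x * (if P then 1 else 0) = (if P then x else (0::'a::comm_ring_1))"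
  by simp_all

lemma neg_add_eq_0_iff: "- a + b = 0 \<longleftrightarrow> a = (b::'a::ab_group_add)"
  by (metis add.commute diff_conv_add_uminus eq_iff_diff_eq_0)

lemma mm_id_left:
  assumes "f \<in> fmats n"
  shows "mm n (idf n) f = f"
proof
  fix x :: "nat \<times> nat"
  obtain i j where x: "x = (i, j)" by force
  show "mm n (idf n) f x = f x"
    using assms by (cases "i < n")
      (simp_all add: x mm_def idf_def fmats_def supp_def if_one_mult)
qed

lemma mm_id_right:
  assumes "f \<in> fmats n"
  shows "mm n f (idf n) = f"
proof
  fix x :: "nat \<times> nat"
  obtain i j where x: "x = (i, j)" by force
  have "mm n f (idf n) (i, j) = (\<Sum>k<n. if k = j then f (i, k) else 0)"
    unfolding mm_def using assms
    by (auto simp: idf_def if_one_mult fmats_def supp_def intro!: sum.cong)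
  then show "mm n f (idf n) x = f x"
    using assms by (simp add: x fmats_def supp_def)
qed

lemma subspace_fmats: "fs.subspace (fmats n)"
  unfolding fmats_def by (rule subspace_supp)

lemma mm_fmats: "f \<in> fmats n \<Longrightarrow> g \<in> fmats n \<Longrightarrow> mm n f g \<in> fmats n"
  by (auto simp: fmats_def supp_def mm_def)

lemma idf_fmats: "idf n \<in> fmats n"
  by (auto simp: fmats_def supp_def idf_def)

lemma fmat_fmats: "fmat n M \<in> fmats n"
  by (auto simp: fmats_def supp_def fmat_def)

lemma linear_mm_left: "Vector_Spaces.linear fscale fscale (\<lambda>h. mm n g h)"
  by (rule linear_fscaleI) (simp_all add: mm_add_right mm_scale_right)

definition homs :: "nat \<Rightarrow> nat \<Rightarrow> 'a mat list \<Rightarrow> 'a mat list \<Rightarrow> 'a::comm_ring_1 fmat set" where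
  "homs m n X Y = {h \<in> fmats n. \<forall>s<m. mm n h (fmat n (X ! s)) = mm n (fmat n (Y ! s)) h}"

lemma homs_fmats: "h \<in> homs m n X Y \<Longrightarrow> h \<in> fmats n"
  by (simp add: homs_def)

lemma subspace_homs: "fs.subspace (homs m n X Y)"
  using subspace_fmats[of n]
  by (auto simp: fs.subspace_def homs_def mm_add_left mm_add_right mm_scale_left mm_scale_right)

lemma mm_homs: "h \<in> homs m n X Y \<Longrightarrow> g \<in> homs m n Y Z \<Longrightarrow> mm n g h \<in> homs m n X Z"
  by (simp add: homs_def mm_fmats mm_assoc) (simp add: mm_assoc[symmetric])

lemma idf_homs: "idf n \<in> homs m n X X"
  by (simp add: homs_def idf_fmats mm_id_left mm_id_right fmat_fmats)

text \<open>
A family of matrices \<open>h\<^sub>t\<close> is stored as the single function \<open>((t, u), i) \<mapsto> h\<^sub>t (i, u)\<close>. This is the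
shape of the unknowns of a block system whose block columns are the columns \<open>(t, u)\<close> of all the \<open>h\<^sub>t\<close>.
\<close>

definition component :: "nat \<Rightarrow> ((nat \<times> nat) \<times> nat \<Rightarrow> 'a) \<Rightarrow> 'a fmat" where
  "component t F = (\<lambda>(i, u). F ((t, u), i))"

definition fams :: "nat \<Rightarrow> nat \<Rightarrow> 'a fmat set \<Rightarrow> ((nat \<times> nat) \<times> nat \<Rightarrow> 'a::zero) set" where
  "fams n r U = {F \<in> supp (({..<r} \<times> {..<n}) \<times> {..<n}). \<forall>t<r. component t F \<in> U}"

definition combine :: "nat \<Rightarrow> nat \<Rightarrow> (nat \<Rightarrow> 'a fmat) \<Rightarrow> ((nat \<times> nat) \<times> nat \<Rightarrow> 'a::field) \<Rightarrow> 'a fmat" where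
  "combine n r f F = (\<Sum>t<r. mm n (component t F) (f t))"

lemma homs_entrywise:
  assumes "h \<in> fmats n"
  shows "mm n h (fmat n M) = mm n (fmat n N) h \<longleftrightarrow>
    (\<forall>i<n. \<forall>u<n. (\<Sum>k<n. h (i, k) * M $$ (k, u)) = (\<Sum>k<n. N $$ (i, k) * h (k, u)))"
proof -
  have "mm n h (fmat n M) = mm n (fmat n N) h \<longleftrightarrow>
    (\<forall>i u. mm n h (fmat n M) (i, u) = mm n (fmat n N) h (i, u))"
    by (auto simp: fun_eq_iff)
  also have "\<dots> \<longleftrightarrow> (\<forall>i<n. \<forall>u<n. mm n h (fmat n M) (i, u) = mm n (fmat n N) h (i, u))"
  proof -
    have "mm n h (fmat n M) (i, u) = mm n (fmat n N) h (i, u)" if "\<not> (i < n \<and> u < n)" for i u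
      using that mm_fmats[OF assms fmat_fmats[of n M]] mm_fmats[OF fmat_fmats[of n N] assms]
      unfolding fmats_def supp_def by auto
    then show ?thesis by blast
  qed
  also have "\<dots> \<longleftrightarrow> (\<forall>i<n. \<forall>u<n. (\<Sum>k<n. h (i, k) * M $$ (k, u)) = (\<Sum>k<n. N $$ (i, k) * h (k, u)))"
    by (intro all_cong1 imp_cong refl) (simp add: mm_def fmat_def)
  finally show ?thesis .
qed

lemma component_fmats:
  assumes "F \<in> supp (({..<r} \<times> {..<n}) \<times> {..<n})"
  shows "component t F \<in> fmats n"
  using assms by (auto simp: component_def fmats_def supp_def)

text \<open>
The families \<open>(h\<^sub>t)\<close> in \<open>Hom(X, Y)\<^sup>r\<close> with \<open>\<Sum>\<^sub>t h\<^sub>t f\<^sub>t = 0\<close> are the homomorphisms to \<open>Y\<close> from a quotient of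
\<open>X\<^sup>r\<close>. They solve a block system whose coefficients involve only \<open>X\<close> and \<open>f\<close>: the equations with index
\<open>Inl\<close> say that each \<open>h\<^sub>t\<close> is a homomorphism, those with index \<open>Inr\<close> that the sum vanishes.
\<close>

lemma hom_le_dim_systems:
  fixes A B X :: "'a::field mat list"
  assumes le: "hom_le m n A B" and A: "A \<in> mat_tuples m n" and B: "B \<in> mat_tuples m n"
    and pos: "m \<ge> 1" "n \<ge> 1" "r \<ge> 1" and f: "\<And>t. t < r \<Longrightarrow> f t \<in> fmats n"
  shows "fs.dim {F \<in> fams n r (homs m n X A). combine n r f F = 0}
    \<le> fs.dim {F \<in> fams n r (homs m n X B). combine n r f F = 0}"
proof -
  define C where "C = {..<r} \<times> {..<n}"
  define J where "J = ({..<m} \<times> C) <+> {..<n}"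
  define \<alpha> where "\<alpha> j = (\<lambda>(t, u). case j of Inl (s, (t0, u0)) \<Rightarrow> if t = t0 then - X ! s $$ (u, u0) else 0
    | Inr u0 \<Rightarrow> f t (u, u0))" for j :: "nat \<times> (nat \<times> nat) + nat"
  define \<beta> where "\<beta> j c = (case j of Inl (s, c0) \<Rightarrow> if c = c0 then 1 else (0::'a) | Inr u0 \<Rightarrow> 0)"
    for j :: "nat \<times> (nat \<times> nat) + nat" and c :: "nat \<times> nat"
  define \<sigma> where "\<sigma> j c = (case j of Inl (s, c0) \<Rightarrow> s | Inr u0 \<Rightarrow> 0)"
    for j :: "nat \<times> (nat \<times> nat) + nat" and c :: "nat \<times> nat"
  have fin: "finite J" "finite C" "J \<noteq> {}" "C \<noteq> {}"
    using pos by (auto simp: J_def C_def lessThan_empty_iff)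
  have \<sigma>m: "\<sigma> j c < m" if "j \<in> J" "c \<in> C" for j c
    using that pos by (auto simp: \<sigma>_def J_def)
  have sys: "{F \<in> fams n r (homs m n X Y). combine n r f F = 0} = block_kernel J C \<alpha> \<beta> \<sigma> n Y" for Y
  proof -
    have b1: "block_form C n (\<alpha> (Inl (s, (t0, u0)))) (\<beta> (Inl (s, (t0, u0)))) (\<lambda>c i'. Y ! s $$ (i, i')) i F = 0
        \<longleftrightarrow> (\<Sum>k<n. component t0 F (i, k) * X ! s $$ (k, u0)) = (\<Sum>k<n. Y ! s $$ (i, k) * component t0 F (k, u0))"
      if "t0 < r" "u0 < n" for s t0 u0 i F
    proof -
      have "block_form C n (\<alpha> (Inl (s, (t0, u0)))) (\<beta> (Inl (s, (t0, u0)))) (\<lambda>c i'. Y ! s $$ (i, i')) i F =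
          (\<Sum>t<r. \<Sum>u<n. if t = t0 then - (X ! s $$ (u, u0) * F ((t, u), i)) else 0) +
          (\<Sum>c\<in>C. if c = (t0, u0) then \<Sum>i'<n. Y ! s $$ (i, i') * F (c, i') else 0)"
        unfolding block_form_def sum.distrib
        by (intro arg_cong2[where f = "(+)"])
          (auto simp: C_def \<alpha>_def \<beta>_def if_one_mult sum.cartesian_product intro!: sum.cong)
      also have "(\<Sum>t<r. \<Sum>u<n. if t = t0 then - (X ! s $$ (u, u0) * F ((t, u), i)) else 0) =
          (\<Sum>t<r. if t = t0 then \<Sum>u<n. - (X ! s $$ (u, u0) * F ((t, u), i)) else 0)"
        by (intro sum.cong) auto
      finally show ?thesis
        using that fin(2) by (auto simp: C_def component_def sum_negf mult.commute neg_add_eq_0_iff)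
    qed
    have b2: "block_form C n (\<alpha> (Inr u0)) (\<beta> (Inr u0)) Z i F = combine n r f F (i, u0)" for Z u0 i F
    proof -
      have "block_form C n (\<alpha> (Inr u0)) (\<beta> (Inr u0)) Z i F = (\<Sum>t<r. \<Sum>u<n. f t (u, u0) * F ((t, u), i))"
        unfolding block_form_def by (auto simp: C_def \<alpha>_def \<beta>_def sum.cartesian_product intro!: sum.cong)
      then show ?thesis
        by (simp add: combine_def sum_fun_apply mm_def component_def mult.commute)
    qed
    have c0: "combine n r f F = 0 \<longleftrightarrow> (\<forall>u<n. \<forall>i<n. combine n r f F (i, u) = 0)"
      if F: "F \<in> supp (C \<times> {..<n})" for F
    proof -
      have "combine n r f F \<in> fmats n"
        unfolding combine_def using f component_fmats F
        by (intro fs.subspace_sum[OF subspace_fmats] mm_fmats) (auto simp: C_def)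
      then show ?thesis
        by (auto simp: fmats_def supp_def fun_eq_iff)
    qed
    have "F \<in> fams n r (homs m n X Y) \<and> combine n r f F = 0 \<longleftrightarrow>
        F \<in> block_kernel J C \<alpha> \<beta> \<sigma> n Y" for F
    proof (cases "F \<in> supp (C \<times> {..<n})")
      case True
      then have cF: "component t F \<in> fmats n" for t
        using component_fmats unfolding C_def by blast
      have "F \<in> fams n r (homs m n X Y) \<longleftrightarrow> (\<forall>s<m. \<forall>t<r. \<forall>u<n. \<forall>i<n.
          (\<Sum>k<n. component t F (i, k) * X ! s $$ (k, u)) = (\<Sum>k<n. Y ! s $$ (i, k) * component t F (k, u)))"
        using True cF unfolding fams_def homs_def C_def by (auto simp: homs_entrywise)
      moreover have "F \<in> block_kernel J C \<alpha> \<beta> \<sigma> n Y \<longleftrightarrow> (\<forall>s<m. \<forall>t<r. \<forall>u<n. \<forall>i<n.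
          block_form C n (\<alpha> (Inl (s, (t, u)))) (\<beta> (Inl (s, (t, u)))) (\<lambda>c i'. Y ! s $$ (i, i')) i F = 0) \<and>
          (\<forall>u<n. \<forall>i<n. block_form C n (\<alpha> (Inr u)) (\<beta> (Inr u)) (\<lambda>c i'. Y ! 0 $$ (i, i')) i F = 0)"
      proof -
        have "(\<forall>j\<in>J. P j) \<longleftrightarrow> (\<forall>s<m. \<forall>t<r. \<forall>u<n. P (Inl (s, (t, u)))) \<and> (\<forall>u<n. P (Inr u))" for P
          by (auto simp: J_def C_def)
        then show ?thesis
          using True unfolding block_kernel_def by (simp add: \<sigma>_def)
      qed
      moreover have "(\<forall>s<m. \<forall>t<r. \<forall>u<n. \<forall>i<n.
          block_form C n (\<alpha> (Inl (s, (t, u)))) (\<beta> (Inl (s, (t, u)))) (\<lambda>c i'. Y ! s $$ (i, i')) i F = 0) \<longleftrightarrow>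
        (\<forall>s<m. \<forall>t<r. \<forall>u<n. \<forall>i<n.
          (\<Sum>k<n. component t F (i, k) * X ! s $$ (k, u)) = (\<Sum>k<n. Y ! s $$ (i, k) * component t F (k, u)))"
        by (intro all_cong1 imp_cong refl, simp only: b1)
      ultimately show ?thesis
        by (simp only: b2 c0[OF True])
    qed (auto simp: fams_def block_kernel_def C_def)
    then show ?thesis by blast
  qed
  show ?thesis
    unfolding sys by (rule hom_le_block_kernels(1)[OF fin(1,3,2,4) \<sigma>m le A B])
qed

text \<open>
Read row by row, a homomorphism into \<open>X\<close> is a row vector, and the intertwining conditions place it in
the left kernel of the evaluation of the matrix with blocks \<open>x\<^sub>s - X\<^sub>s\<close>.
\<close>

lemma hom_le_dim_homs_into:
  fixes A B X :: "'a::field mat list"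
  assumes le: "hom_le m n A B" and A: "A \<in> mat_tuples m n" and B: "B \<in> mat_tuples m n"
    and pos: "m \<ge> 1" "n \<ge> 1"
  shows "fs.dim (homs m n A X) \<le> fs.dim (homs m n B X)"
proof -
  define J where "J = {..<n}"
  define C where "C = {..<m} \<times> {..<n}"
  define \<alpha> where "\<alpha> u = (\<lambda>(s, u'). - X ! s $$ (u', u))" for u :: nat
  define \<beta> where "\<beta> u = (\<lambda>(s :: nat, u'). if u = u' then 1 else (0::'a))" for u :: nat
  define \<sigma> where "\<sigma> u = (fst :: nat \<times> nat \<Rightarrow> nat)" for u :: nat
  have fin: "finite J" "finite C" "J \<noteq> {}" "C \<noteq> {}"
    using pos by (auto simp: J_def C_def lessThan_empty_iff)
  have \<sigma>m: "\<sigma> j c < m" if "j \<in> J" "c \<in> C" for j c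
    using that pos by (auto simp: \<sigma>_def C_def)
  have sys: "homs m n Y X = block_left_kernel J C \<alpha> \<beta> \<sigma> n Y" for Y
  proof -
    have b: "block_form J n (\<lambda>j. \<alpha> j (s, u)) (\<lambda>j. \<beta> j (s, u)) (\<lambda>j i'. Y ! \<sigma> j (s, u) $$ (i', i)) i h = 0 \<longleftrightarrow>
        (\<Sum>k<n. h (u, k) * Y ! s $$ (k, i)) = (\<Sum>k<n. X ! s $$ (u, k) * h (k, i))"
      if "u < n" for s u i h
    proof -
      have "block_form J n (\<lambda>j. \<alpha> j (s, u)) (\<lambda>j. \<beta> j (s, u)) (\<lambda>j i'. Y ! \<sigma> j (s, u) $$ (i', i)) i h =
          (\<Sum>k<n. - (X ! s $$ (u, k) * h (k, i))) +
          (\<Sum>k<n. if k = u then (\<Sum>i'<n. Y ! s $$ (i', i) * h (k, i')) else 0)"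
        unfolding block_form_def sum.distrib
        by (intro arg_cong2[where f = "(+)"] sum.cong) (auto simp: J_def \<alpha>_def \<beta>_def \<sigma>_def)
      then show ?thesis
        using that by (simp add: sum_negf mult.commute neg_add_eq_0_iff eq_commute[of "\<Sum>k<n. h (u, k) * _ k"])
    qed
    have "h \<in> homs m n Y X \<longleftrightarrow> h \<in> block_left_kernel J C \<alpha> \<beta> \<sigma> n Y" for h
    proof (cases "h \<in> fmats n")
      case True
      then have "h \<in> homs m n Y X \<longleftrightarrow> (\<forall>s<m. \<forall>u<n. \<forall>i<n.
          (\<Sum>k<n. h (u, k) * Y ! s $$ (k, i)) = (\<Sum>k<n. X ! s $$ (u, k) * h (k, i)))"
        unfolding homs_def by (simp add: homs_entrywise)
      moreover have "h \<in> block_left_kernel J C \<alpha> \<beta> \<sigma> n Y \<longleftrightarrow> (\<forall>s<m. \<forall>u<n. \<forall>i<n.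
          block_form J n (\<lambda>j. \<alpha> j (s, u)) (\<lambda>j. \<beta> j (s, u)) (\<lambda>j i'. Y ! \<sigma> j (s, u) $$ (i', i)) i h = 0)"
        using True unfolding block_left_kernel_def by (auto simp: J_def C_def fmats_def)
      moreover have "(\<forall>s<m. \<forall>u<n. \<forall>i<n.
          block_form J n (\<lambda>j. \<alpha> j (s, u)) (\<lambda>j. \<beta> j (s, u)) (\<lambda>j i'. Y ! \<sigma> j (s, u) $$ (i', i)) i h = 0) \<longleftrightarrow>
        (\<forall>s<m. \<forall>u<n. \<forall>i<n.
          (\<Sum>k<n. h (u, k) * Y ! s $$ (k, i)) = (\<Sum>k<n. X ! s $$ (u, k) * h (k, i)))"
        by (intro all_cong1 imp_cong refl, simp only: b)
      ultimately show ?thesis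
        by (simp only:)
    qed (auto simp: homs_def block_left_kernel_def J_def fmats_def)
    then show ?thesis by blast
  qed
  show ?thesis
    unfolding sys by (rule hom_le_block_kernels(2)[OF fin(1,3,2,4) \<sigma>m le A B])
qed

section \<open>Strict monotonicity of the dimension of the endomorphism algebra\<close>

lemma finite_square: "finite ({..<n} \<times> {..<n::nat})"
  by simp

lemma subset_fmats_supp: "V \<subseteq> fmats n \<Longrightarrow> V \<subseteq> supp ({..<n} \<times> {..<n})"
  by (simp add: fmats_def)

lemmas fmats_dim_mono = supp_dim_mono[OF finite_square subset_fmats_supp finite_square]
lemmas fmats_subspace_eq = supp_subspace_eq[OF finite_square subset_fmats_supp finite_square]
lemmas fmats_basis = supp_basis[OF finite_square subset_fmats_supp finite_square]
lemmas fmats_rank_nullity = supp_rank_nullity[OF finite_square subset_fmats_supp finite_square]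
lemmas fmats_dim_image_inj = supp_dim_image_inj[OF finite_square subset_fmats_supp finite_square]

lemma homs_subset_fmats: "homs m n X Y \<subseteq> fmats n"
  using homs_fmats by blast

lemma component_add: "component t (F + G) = component t F + component t G"
  and component_scale: "component t (fscale c F) = fscale c (component t F)"
  by (auto simp: component_def fun_eq_iff)

lemma component_zero [simp]: "component t 0 = 0"
  by (auto simp: component_def fun_eq_iff)

lemma finite_fam_index: "finite (({..<r::nat} \<times> {..<n::nat}) \<times> {..<n})"
  by simp

lemma fams_subset_supp: "fams n r U \<subseteq> supp (({..<r} \<times> {..<n}) \<times> {..<n})"
  by (auto simp: fams_def)

lemma subspace_fams: "fs.subspace U \<Longrightarrow> fs.subspace (fams n r U)"
  using subspace_supp[of "({..<r} \<times> {..<n}) \<times> {..<n}"]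
  by (auto simp: fs.subspace_def fams_def component_add component_scale)

lemma linear_component: "Vector_Spaces.linear fscale fscale (component t)"
  by (rule linear_fscaleI) (simp_all add: component_add component_scale)

lemma linear_combine: "Vector_Spaces.linear fscale fscale (combine n r f)"
  by (rule linear_fscaleI)
    (simp_all add: combine_def component_add component_scale mm_add_left mm_scale_left sum.distrib
      fs.scale_sum_right)

definition family :: "nat \<Rightarrow> (nat \<Rightarrow> 'a fmat) \<Rightarrow> (nat \<times> nat) \<times> nat \<Rightarrow> 'a::zero" where
  "family r h = (\<lambda>((t, u), i). if t < r then h t (i, u) else 0)"

lemma component_family: "t < r \<Longrightarrow> component t (family r h) = h t"
  by (auto simp: component_def family_def fun_eq_iff)

lemma family_fams:
  assumes "U \<subseteq> fmats n" and "\<And>t. t < r \<Longrightarrow> h t \<in> U"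
  shows "family r h \<in> fams n r U"
proof -
  have "h t (i, u) = 0" if "t < r" "\<not> (i < n \<and> u < n)" for t i u
    using assms(1) assms(2)[OF that(1)] that(2) by (auto simp: fmats_def supp_def subset_iff)
  then have "family r h \<in> supp (({..<r} \<times> {..<n}) \<times> {..<n})"
    by (auto simp: supp_def family_def)
  then show ?thesis
    using assms(2) by (simp add: fams_def component_family)
qed

lemma combine_family: "combine n r f (family r h) = (\<Sum>t<r. mm n (h t) (f t))"
  by (simp add: combine_def component_family)

lemma combine_image:
  assumes "U \<subseteq> fmats n"
  shows "combine n r f ` fams n r U = {\<Sum>t<r. mm n (h t) (f t) | h. \<forall>t<r. h t \<in> U}"
proof (intro equalityI subsetI)
  fix x assume "x \<in> combine n r f ` fams n r U"
  then show "x \<in> {\<Sum>t<r. mm n (h t) (f t) | h. \<forall>t<r. h t \<in> U}"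
    by (auto simp: combine_def fams_def)
next
  fix x assume "x \<in> {\<Sum>t<r. mm n (h t) (f t) | h. \<forall>t<r. h t \<in> U}"
  then obtain h where "x = (\<Sum>t<r. mm n (h t) (f t))" "\<forall>t<r. h t \<in> U" by blast
  then show "x \<in> combine n r f ` fams n r U"
    using family_fams[OF assms, of r h] combine_family[of n r f h] by (intro image_eqI) auto
qed

lemma dim_fams:
  assumes U: "U \<subseteq> fmats n" "fs.subspace (U :: 'a::field fmat set)"
  shows "fs.dim (fams n r U) = r * fs.dim U"
proof (induction r)
  case 0
  have "fams n 0 U \<subseteq> {0}"
    by (auto simp: fams_def supp_def fun_eq_iff)
  then have "fs.dim (fams n 0 U) = 0"
    using fs.dim_le_card[of "fams n 0 U" "{}"] by auto
  then show "fs.dim (fams n 0 U) = 0 * fs.dim U" by simp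
next
  case (Suc r)
  have ker: "{F \<in> fams n (Suc r) U. component r F = 0} = fams n r U"
  proof (intro equalityI subsetI)
    fix F assume F: "F \<in> {F \<in> fams n (Suc r) U. component r F = 0}"
    then have "component r F (i, u) = 0" for u i
      by simp
    then have zr: "F ((r, u), i) = 0" for u i
      by (simp add: component_def)
    have "F ((t, u), i) = 0" if "\<not> (t < r \<and> u < n \<and> i < n)" for t u i
      using that zr F by (cases "t = r") (auto simp: fams_def supp_def)
    then show "F \<in> fams n r U"
      using F by (auto simp: fams_def supp_def)
  next
    fix F assume F: "F \<in> fams n r U"
    then have "component r F = 0"
      by (auto simp: fams_def supp_def component_def fun_eq_iff)
    then show "F \<in> {F \<in> fams n (Suc r) U. component r F = 0}"
      using F fs.subspace_0[OF U(2)] by (auto simp: fams_def supp_def less_Suc_eq)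
  qed
  have im: "component r ` fams n (Suc r) U = U"
  proof (intro equalityI subsetI)
    fix h assume "h \<in> U"
    then have "family (Suc r) (\<lambda>_. h) \<in> fams n (Suc r) U"
      using family_fams[OF U(1), of "Suc r" "\<lambda>_. h"] by simp
    then show "h \<in> component r ` fams n (Suc r) U"
      using component_family[of r "Suc r" "\<lambda>_. h"] by (metis image_eqI lessI)
  qed (auto simp: fams_def)
  have "fs.dim (fams n r U) = r * fs.dim U"
    by (rule Suc)
  moreover have "fs.dim (fams n (Suc r) U) = fs.dim {F \<in> fams n (Suc r) U. component r F = 0}
      + fs.dim (component r ` fams n (Suc r) U)"
    by (rule supp_rank_nullity[OF finite_fam_index fams_subset_supp finite_fam_index
        subspace_fams[OF U(2)] linear_component])
  ultimately show "fs.dim (fams n (Suc r) U) = Suc r * fs.dim U"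
    unfolding ker im by simp
qed

text \<open>
Both spaces of families have dimension \<open>r [B, A] = r [B, B]\<close>, so the smaller kernel has the larger image.
\<close>

lemma dim_combine_image:
  assumes "fs.dim (homs m n B A) = fs.dim (homs m n B B)"
    and "fs.dim {F \<in> fams n r (homs m n B A). combine n r f F = 0}
      \<le> fs.dim {F \<in> fams n r (homs m n B B). combine n r f F = 0}"
  shows "fs.dim (combine n r f ` fams n r (homs m n B B :: 'a::field fmat set))
    \<le> fs.dim (combine n r f ` fams n r (homs m n B A))"
proof -
  have "fs.dim (fams n r (homs m n B Y)) = fs.dim {F \<in> fams n r (homs m n B Y). combine n r f F = 0}
      + fs.dim (combine n r f ` fams n r (homs m n B Y))" for Y
    by (rule supp_rank_nullity[OF finite_fam_index fams_subset_supp finite_fam_index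
        subspace_fams[OF subspace_homs] linear_combine])
  note this[of A] this[of B]
  moreover have "fs.dim (fams n r (homs m n B Y)) = r * fs.dim (homs m n B Y)" for Y
    by (rule dim_fams[OF homs_subset_fmats subspace_homs])
  note this[of A] this[of B]
  ultimately show ?thesis
    using assms by simp
qed

context
  fixes n :: nat
begin

abbreviation star :: "'a::comm_ring_1 fmat \<Rightarrow> 'a fmat \<Rightarrow> 'a fmat" (infixl "\<star>" 70) where
  "f \<star> g \<equiv> mm n f g"

abbreviation one :: "'a::comm_ring_1 fmat" ("\<I>") where "\<I> \<equiv> idf n"

text \<open>
Left multiplications by \<open>a\<close> and \<open>b\<close> are inverse isomorphisms between \<open>b a U\<close> and \<open>a b V\<close>, which are the
kernels of the two projections. So \<open>U\<close> and \<open>V\<close> differ in dimension exactly as their complementary parts.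
\<close>

lemma dim_corner_transfer:
  fixes a b :: "'a::field fmat"
  assumes aba: "a \<star> b \<star> a = a" and bab: "b \<star> a \<star> b = b"
    and U: "U \<subseteq> fmats n" "fs.subspace U" and V: "V \<subseteq> fmats n" "fs.subspace V"
    and aU: "\<And>x. x \<in> U \<Longrightarrow> a \<star> x \<in> V" and bV: "\<And>x. x \<in> V \<Longrightarrow> b \<star> x \<in> U"
  shows "fs.dim U + fs.dim (mm n (\<I> - a \<star> b) ` V) = fs.dim V + fs.dim (mm n (\<I> - b \<star> a) ` U)"
proof -
  let ?KU = "{x \<in> U. (\<I> - b \<star> a) \<star> x = 0}" and ?KV = "{x \<in> V. (\<I> - a \<star> b) \<star> x = 0}"
  have idU: "\<I> \<star> x = x" if "x \<in> U" for x
    using U(1) that by (intro mm_id_left) blast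
  have idV: "\<I> \<star> x = x" if "x \<in> V" for x
    using V(1) that by (intro mm_id_left) blast
  have KU: "?KU = {x \<in> U. b \<star> a \<star> x = x}"
    by (auto simp: mm_diff_left idU)
  have KV: "?KV = {x \<in> V. a \<star> b \<star> x = x}"
    by (auto simp: mm_diff_left idV)
  have rU: "fs.dim U = fs.dim ?KU + fs.dim (mm n (\<I> - b \<star> a) ` U)"
    by (rule fmats_rank_nullity[OF U linear_mm_left])
  have rV: "fs.dim V = fs.dim ?KV + fs.dim (mm n (\<I> - a \<star> b) ` V)"
    by (rule fmats_rank_nullity[OF V linear_mm_left])
  have sub: "fs.subspace ?KU"
    using U(2) by (auto simp: fs.subspace_def mm_add_right mm_scale_right)
  have "mm n a ` ?KU = ?KV"
  proof (intro equalityI subsetI)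
    fix y assume "y \<in> mm n a ` ?KU"
    then obtain x where "x \<in> U" "y = a \<star> x"
      by blast
    then show "y \<in> ?KV"
      unfolding KV using aU aba by (simp add: mm_assoc[symmetric])
  next
    fix y assume y: "y \<in> ?KV"
    then have "y \<in> V" "y = a \<star> (b \<star> y)"
      unfolding KV by (auto simp: mm_assoc)
    moreover have "b \<star> y \<in> ?KU"
      unfolding KU using bV \<open>y \<in> V\<close> bab by (simp add: mm_assoc[symmetric])
    ultimately show "y \<in> mm n a ` ?KU" by blast
  qed
  moreover have "fs.dim (mm n a ` ?KU) = fs.dim ?KU"
  proof (rule fmats_dim_image_inj[OF _ sub linear_mm_left])
    show "?KU \<subseteq> fmats n"
      using U(1) by blast
    fix x assume "x \<in> ?KU" "a \<star> x = 0"
    then show "x = 0"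
      unfolding KU by (auto simp: mm_assoc)
  qed
  ultimately show ?thesis
    using rU rV by simp
qed

primrec fpow :: "'a::comm_ring_1 fmat \<Rightarrow> nat \<Rightarrow> 'a fmat" where
  "fpow u 0 = \<I>"
| "fpow u (Suc k) = u \<star> fpow u k"

lemma fpow_fmats: "u \<in> fmats n \<Longrightarrow> fpow u k \<in> fmats n"
  by (induction k) (auto simp: idf_fmats mm_fmats)

lemma fpow_add: "u \<in> fmats n \<Longrightarrow> fpow u (i + j) = fpow u i \<star> fpow u j"
  by (induction i) (simp_all add: fpow_fmats mm_id_left mm_assoc)

lemma fpow_commute:
  assumes "u \<in> fmats n" and "v \<in> fmats n" and "u \<star> v = v \<star> u"
  shows "fpow u k \<star> v = v \<star> fpow u k"
proof (induction k)
  case (Suc k)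
  have "fpow u (Suc k) \<star> v = u \<star> (fpow u k \<star> v)"
    by (simp add: mm_assoc)
  also have "\<dots> = u \<star> v \<star> fpow u k"
    by (simp add: Suc mm_assoc)
  finally show ?case
    by (simp add: assms(3) mm_assoc)
qed (simp add: assms mm_id_left mm_id_right)

text \<open>
The spans of the powers \<open>u\<^sup>j\<close> with \<open>j \<ge> k\<close> decrease with \<open>k\<close> and therefore become stationary, which gives
\<open>u\<^sup>k = u\<^sup>k\<^sup>+\<^sup>1 q\<close> for a polynomial \<open>q\<close> in \<open>u\<close>. Iterating, \<open>u\<^sup>k = u\<^sup>2\<^sup>k q\<^sup>k\<close>, so \<open>u\<^sup>k q\<^sup>k\<close> is idempotent, and it
vanishes only if \<open>u\<^sup>k\<close> does. It is written as \<open>u z\<close> so that a factor of \<open>u\<close> can be split off.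
\<close>

lemma fitting_idempotent:
  fixes u :: "'a::field fmat"
  assumes u: "u \<in> fmats n" and nonnil: "\<And>k. fpow u k \<noteq> 0"
    and H: "fs.subspace H" "\<And>k. fpow u k \<in> H" "\<And>x y. x \<in> H \<Longrightarrow> y \<in> H \<Longrightarrow> x \<star> y \<in> H"
  obtains z where "z \<in> H" "u \<star> z = z \<star> u" "u \<star> z \<star> (u \<star> z) = u \<star> z" "u \<star> z \<noteq> 0"
proof -
  define W where "W k = fs.span {fpow u j | j. j \<ge> k}" for k
  have Wsub: "W k \<subseteq> fmats n" for k
    unfolding W_def using fpow_fmats[OF u] subspace_fmats by (intro fs.span_minimal) auto
  have Wdec: "W (Suc k) \<subseteq> W k" for k
    unfolding W_def by (intro fs.span_mono) (use Suc_leD in blast)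
  obtain k0 where k0: "\<And>k. fs.dim (W k0) \<le> fs.dim (W k)"
    using ex_has_least_nat[of "\<lambda>_. True" 0 "\<lambda>k. fs.dim (W k)"] by auto
  have "W (Suc k0) = W k0"
    by (rule fmats_subspace_eq[OF Wsub _ Wdec k0]) (simp add: W_def)
  moreover have "fpow u k0 \<in> W k0"
    unfolding W_def by (rule fs.span_base) blast
  moreover have "W (Suc k0) = mm n (fpow u (Suc k0)) ` W 0"
  proof -
    have "mm n (fpow u (Suc k0)) ` {fpow u j | j. j \<ge> 0} = {fpow u j | j. j \<ge> Suc k0}"
    proof (intro equalityI subsetI)
      fix x assume "x \<in> {fpow u j | j. j \<ge> Suc k0}"
      then obtain j where "j \<ge> Suc k0" "x = fpow u j" by blast
      then have "x = fpow u (Suc k0) \<star> fpow u (j - Suc k0)"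
        using fpow_add[OF u, of "Suc k0" "j - Suc k0"] by simp
      then show "x \<in> mm n (fpow u (Suc k0)) ` {fpow u j | j. j \<ge> 0}" by blast
    next
      fix x assume "x \<in> mm n (fpow u (Suc k0)) ` {fpow u j | j. j \<ge> 0}"
      then obtain j where "x = fpow u (Suc k0) \<star> fpow u j" by blast
      then have "x = fpow u (Suc k0 + j)"
        using fpow_add[OF u, of "Suc k0" j] by simp
      then show "x \<in> {fpow u j | j. j \<ge> Suc k0}"
        using le_add1 by blast
    qed
    moreover have "mm n (fpow u (Suc k0)) ` fs.span {fpow u j | j. j \<ge> 0} =
        fs.span (mm n (fpow u (Suc k0)) ` {fpow u j | j. j \<ge> 0})"
      by (rule fsp.linear_span_image[OF linear_mm_left, symmetric])
    ultimately show ?thesis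
      unfolding W_def by (simp only:)
  qed
  ultimately obtain q where q: "q \<in> W 0" "fpow u k0 = fpow u (Suc k0) \<star> q"
    by blast
  have qf: "q \<in> fmats n"
    using q(1) Wsub by blast
  have qH: "q \<in> H"
    using q(1) H(1,2) fs.span_minimal[of "{fpow u j | j. j \<ge> 0}" H] unfolding W_def by blast
  have uq: "u \<star> q = q \<star> u"
  proof -
    have "fs.subspace {x. u \<star> x = x \<star> u}"
      by (auto simp: fs.subspace_def mm_add_right mm_add_left mm_scale_left mm_scale_right)
    moreover have "u \<star> fpow u j = fpow u j \<star> u" for j
      using fpow_commute[OF u u refl] by simp
    ultimately show ?thesis
      using q(1) fs.span_minimal[of "{fpow u j | j. j \<ge> 0}" "{x. u \<star> x = x \<star> u}"] unfolding W_def by blast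
  qed
  \<comment> \<open>a positive exponent, so that \<open>u\<close> divides \<open>u\<^sup>k q\<^sup>k\<close>\<close>
  define k where "k = Suc k0"
  have step: "fpow u k = fpow u (Suc k) \<star> q"
  proof -
    have "u \<star> fpow u k0 = u \<star> (fpow u (Suc k0) \<star> q)"
      by (rule arg_cong[OF q(2)])
    also have "\<dots> = u \<star> fpow u (Suc k0) \<star> q"
      by (simp only: mm_assoc)
    finally show ?thesis
      by (simp only: k_def fpow.simps)
  qed
  have pw: "fpow u k = fpow u (k + j) \<star> fpow q j" for j
  proof (induction j)
    case 0
    then show ?case by (simp add: mm_id_right fpow_fmats u)
  next
    case (Suc j)
    have "fpow u (k + j) = fpow u j \<star> fpow u k"
      using fpow_add[OF u, of j k] by (simp add: add.commute)
    also have "\<dots> = fpow u j \<star> (fpow u (Suc k) \<star> q)"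
      by (rule arg_cong[OF step])
    also have "\<dots> = fpow u j \<star> fpow u (Suc k) \<star> q"
      by (simp only: mm_assoc)
    also have "\<dots> = fpow u (k + Suc j) \<star> q"
      using fpow_add[OF u, of j "Suc k"] by (simp only: add.commute[of j] add_Suc_right add_Suc)
    finally have "fpow u (k + j) = fpow u (k + Suc j) \<star> q" .
    then have "fpow u k = fpow u (k + Suc j) \<star> q \<star> fpow q j"
      using Suc.IH by (rule back_subst[where P = "\<lambda>x. fpow u k = x \<star> fpow q j", rotated])
    then show "fpow u k = fpow u (k + Suc j) \<star> fpow q (Suc j)"
      by (simp only: mm_assoc fpow.simps)
  qed
  let ?uk = "fpow u k" and ?qk = "fpow q k"
  have "fpow q k \<star> u = u \<star> fpow q k"
    using fpow_commute[OF qf u] uq by simp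
  then have uqk: "fpow u j \<star> ?qk = ?qk \<star> fpow u j" for j
    using fpow_commute[OF u fpow_fmats[OF qf]] by simp
  have double: "?uk = ?uk \<star> (?uk \<star> ?qk)"
    using pw[of k] unfolding fpow_add[OF u] mm_assoc .
  define z where "z = fpow u k0 \<star> ?qk"
  have uz: "u \<star> z = ?uk \<star> ?qk"
    by (simp add: z_def k_def mm_assoc)
  show ?thesis
  proof
    have "fpow q j \<in> H" for j
      using H(2)[of 0] H(3)[OF qH] by (induction j) auto
    then show "z \<in> H"
      unfolding z_def using H(2,3) by blast
    show "u \<star> z = z \<star> u"
    proof -
      have "z \<star> u = fpow u k0 \<star> (?qk \<star> fpow u (Suc 0))"
        using u by (simp add: z_def mm_assoc mm_id_right)
      also have "\<dots> = fpow u (k0 + Suc 0) \<star> ?qk"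
        by (simp only: uqk[symmetric] mm_assoc[symmetric] fpow_add[OF u])
      finally show ?thesis
        by (simp add: uz k_def)
    qed
    show "u \<star> z \<star> (u \<star> z) = u \<star> z"
    proof -
      have "?uk \<star> ?qk \<star> (?uk \<star> ?qk) = ?uk \<star> (?qk \<star> ?uk) \<star> ?qk"
        by (simp only: mm_assoc)
      also have "\<dots> = ?uk \<star> (?uk \<star> ?qk) \<star> ?qk"
        by (simp only: uqk)
      also have "\<dots> = ?uk \<star> ?qk"
        by (simp only: double[symmetric])
      finally show ?thesis
        unfolding uz .
    qed
    show "u \<star> z \<noteq> 0"
      unfolding uz
    proof
      assume "?uk \<star> ?qk = 0"
      then have "?uk = ?uk \<star> 0"
        using arg_cong[of "?uk \<star> ?qk" 0 "mm n ?uk"] double by (simp only:)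
      then show False
        using nonnil[of k] by (simp only: mm_zero_right)
    qed
  qed
qed

text \<open>
In the corner algebra with unit \<open>e\<close>, a nilpotent \<open>u = p\<^sub>r q\<^sub>r\<close> makes \<open>e - u\<close> invertible. Multiplying
\<open>e - u = \<Sum>\<^sub>t\<^sub><\<^sub>r p\<^sub>t q\<^sub>t\<close> by the inverse gives a representation of \<open>e\<close> with one term fewer, and
eventually \<open>e = 0\<close>.
\<close>

lemma nilpotent_sum_ne_corner:
  fixes e :: "'a::field fmat" and p q :: "nat \<Rightarrow> 'a fmat"
  assumes e: "e \<in> fmats n" "e \<star> e = e" "e \<noteq> 0"
    and P: "\<And>p. p \<in> P \<Longrightarrow> p \<in> fmats n \<and> e \<star> p = p"
    and Q: "\<And>q. q \<in> Q \<Longrightarrow> q \<in> fmats n \<and> q \<star> e = q"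
    and PQ: "\<And>p q p'. p \<in> P \<Longrightarrow> q \<in> Q \<Longrightarrow> p' \<in> P \<Longrightarrow> p \<star> q \<star> p' \<in> P"
    and P0: "0 \<in> P" and Padd: "\<And>p p'. p \<in> P \<Longrightarrow> p' \<in> P \<Longrightarrow> p + p' \<in> P"
    and nil: "\<And>p q. p \<in> P \<Longrightarrow> q \<in> Q \<Longrightarrow> \<exists>k. fpow (p \<star> q) k = 0"
    and pq: "\<And>t. t < r \<Longrightarrow> p t \<in> P" "\<And>t. t < r \<Longrightarrow> q t \<in> Q"
  shows "(\<Sum>t<r. p t \<star> q t) \<noteq> e"
  using pq
proof (induction r arbitrary: p)
  case 0
  show "(\<Sum>t<0. p t \<star> q t) \<noteq> e" using e(3) by simp
next
  case (Suc r)
  show ?case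
  proof
    assume s: "(\<Sum>t<Suc r. p t \<star> q t) = e"
    define u where "u = p r \<star> q r"
    have pr: "p r \<in> P" "q r \<in> Q"
      using Suc.prems by simp_all
    have u: "u \<in> fmats n" "e \<star> u = u" "u \<star> e = u"
      using P[OF pr(1)] Q[OF pr(2)] by (simp_all add: u_def mm_fmats mm_assoc) (simp add: mm_assoc[symmetric])
    obtain N where N: "fpow u N = 0"
      using nil[OF pr] u_def by blast
    define w where "w k = (\<Sum>j<k. fpow u j)" for k
    have geo: "w k \<star> (\<I> - u) = \<I> - fpow u k" for k
    proof (induction k)
      case 0
      show "w 0 \<star> (\<I> - u) = \<I> - fpow u 0" by (simp add: w_def)
    next
      case (Suc k)
      have IH: "w k \<star> (\<I> - u) = \<I> - fpow u k"
        by (rule Suc)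
      have "w (Suc k) \<star> (\<I> - u) = w k \<star> (\<I> - u) + fpow u k \<star> (\<I> - u)"
        by (simp add: w_def mm_add_left)
      also have "\<dots> = \<I> - fpow u k + (fpow u k - fpow u k \<star> u)"
        unfolding IH by (simp only: mm_diff_right mm_id_right[OF fpow_fmats[OF u(1)]])
      also have "fpow u k \<star> u = fpow u (Suc k)"
        using fpow_commute[OF u(1) u(1)] by simp
      finally show "w (Suc k) \<star> (\<I> - u) = \<I> - fpow u (Suc k)"
        by (simp only: add_diff_eq diff_add_cancel)
    qed
    have wP: "w k \<star> x \<in> P" if "x \<in> P" for k x
    proof -
      have up: "fpow u j \<star> x \<in> P" for j
      proof (induction j)
        case 0
        then show ?case using that P by (simp add: mm_id_left)
      next
        case (Suc j)
        then show ?case using PQ[OF pr] by (simp add: u_def mm_assoc)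
      qed
      show ?thesis
      proof (induction k)
        case 0
        show "w 0 \<star> x \<in> P" using P0 by (simp add: w_def)
      next
        case (Suc k)
        have "w (Suc k) \<star> x = w k \<star> x + fpow u k \<star> x"
          by (simp add: w_def mm_add_left)
        then show "w (Suc k) \<star> x \<in> P"
          using Padd[OF Suc up] by (simp only:)
      qed
    qed
    have "(\<Sum>t<r. p t \<star> q t) = e - u"
      using s by (simp add: u_def algebra_simps)
    also have "\<dots> = (\<I> - u) \<star> e"
      using e u by (simp add: mm_diff_left mm_id_left)
    finally have "w N \<star> (\<Sum>t<r. p t \<star> q t) = w N \<star> (\<I> - u) \<star> e"
      by (simp add: mm_assoc)
    also have "\<dots> = e"
      using e geo[of N] N by (simp add: mm_id_left)
    finally have "(\<Sum>t<r. (w N \<star> p t) \<star> q t) = e"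
      by (simp add: mm_sum_right mm_assoc)
    moreover have "(\<Sum>t<r. (w N \<star> p t) \<star> q t) \<noteq> e"
      using Suc.IH[of "\<lambda>t. w N \<star> p t"] Suc.prems wP by simp
    ultimately show False by blast
  qed
qed


lemma idem_compl: "x \<in> fmats n \<Longrightarrow> x \<star> x = x \<Longrightarrow> (\<I> - x) \<star> (\<I> - x) = \<I> - x"
  by (simp add: mm_diff_left mm_diff_right mm_id_left mm_id_right idf_fmats)

text \<open>
The extreme case in which \<open>[A, A] = [A, B]\<close> and \<open>[B, A] = [B, B]\<close>. The third hypothesis is
\<open>[M, A] \<le> [M, B]\<close> for quotients \<open>M\<close> of powers of \<open>B\<close>.
\<close>

context
  fixes m :: nat and A B :: "'a::field mat list"
  assumes dA: "fs.dim (homs m n A A) = fs.dim (homs m n A B)"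
    and dB: "fs.dim (homs m n B A) = fs.dim (homs m n B B)"
    and sys: "\<forall>r\<ge>1. \<forall>f. (\<forall>t<r. f t \<in> fmats n) \<longrightarrow>
      fs.dim {F \<in> fams n r (homs m n B A). combine n r f F = 0}
      \<le> fs.dim {F \<in> fams n r (homs m n B B). combine n r f F = 0}"
begin

text \<open>
Let \<open>f\<^sub>1, \<dots>, f\<^sub>r\<close> span \<open>e' Hom(A, B)\<close> and let \<open>I Y\<close> consist of the \<open>\<Sum>\<^sub>t h\<^sub>t f\<^sub>t\<close> with \<open>h\<^sub>t \<in> Hom(B, Y)\<close>.
The hypotheses give \<open>dim (I B) \<le> dim (I A)\<close>. Removing the common summand from both sides,
\<open>dim (e' I B) \<le> dim (e I A)\<close>. But \<open>e' I B\<close> contains \<open>e' Hom(A, B)\<close>, which has the dimension of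
\<open>e Hom(A, A)\<close> because \<open>[A, A] = [A, B]\<close>. So \<open>e I A\<close> is all of \<open>e Hom(A, A)\<close> and contains \<open>e\<close>.
\<close>

lemma corner_decomposition:
  fixes a b :: "'a fmat"
  assumes a: "a \<in> homs m n A B" and b: "b \<in> homs m n B A"
    and aba: "a \<star> b \<star> a = a" and bab: "b \<star> a \<star> b = b"
  obtains r h f where "\<And>t. t < r \<Longrightarrow> h t \<in> homs m n B A" "\<And>t. t < r \<Longrightarrow> f t \<in> homs m n A B"
    and "(\<Sum>t<r::nat. ((\<I> - b \<star> a) \<star> h t \<star> (\<I> - a \<star> b)) \<star> ((\<I> - a \<star> b) \<star> f t \<star> (\<I> - b \<star> a))) = \<I> - b \<star> a"
proof -
  let ?e = "\<I> - b \<star> a" and ?e' = "\<I> - a \<star> b"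
  have ba: "b \<star> a \<in> homs m n A A" and ab: "a \<star> b \<in> homs m n B B"
    using mm_homs a b by blast+
  have e: "?e \<in> homs m n A A" and e': "?e' \<in> homs m n B B"
    using fs.subspace_diff[OF subspace_homs idf_homs ba] fs.subspace_diff[OF subspace_homs idf_homs ab]
    by auto
  have baf: "b \<star> a \<in> fmats n" "a \<star> b \<in> fmats n"
    using ba ab homs_fmats by blast+
  have ee: "?e \<star> ?e = ?e" "?e' \<star> ?e' = ?e'"
    using idem_compl[OF baf(1)] idem_compl[OF baf(2)] arg_cong[OF bab, of "\<lambda>x. x \<star> a"]
      arg_cong[OF aba, of "\<lambda>x. x \<star> b"] by (simp_all only: mm_assoc)
  let ?EA = "mm n ?e ` homs m n A A" and ?EB = "mm n ?e' ` homs m n A B"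
  have EB: "?EB \<subseteq> homs m n A B" and EA: "?EA \<subseteq> homs m n A A"
    using mm_homs e e' by blast+
  have dimE: "fs.dim ?EA = fs.dim ?EB"
  proof -
    have "fs.dim (homs m n A A) + fs.dim ?EB = fs.dim (homs m n A B) + fs.dim ?EA"
      by (rule dim_corner_transfer[OF aba bab homs_subset_fmats subspace_homs homs_subset_fmats
            subspace_homs mm_homs[OF _ a] mm_homs[OF _ b]])
    then show ?thesis
      using dA by linarith
  qed
  \<comment> \<open>a finite spanning family of the homomorphisms into the complement of the common summand,
    padded by \<open>0\<close> to make it nonempty\<close>
  obtain Bs where Bs: "finite Bs" "Bs \<subseteq> ?EB" "fs.independent Bs" "?EB \<subseteq> fs.span Bs"
    "card Bs = fs.dim ?EB"
    using fmats_basis[OF subset_trans[OF EB homs_subset_fmats]] .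
  have EBsub: "fs.subspace ?EB"
    by (rule fsp.linear_subspace_image[OF linear_mm_left subspace_homs])
  have "finite (insert 0 Bs)"
    using Bs(1) by simp
  from finite_imp_nat_seg_image_inj_on[OF this]
  obtain f and r :: nat where "insert 0 Bs = f ` {i. i < r}" by blast
  then have f: "f ` {..<r} = insert 0 Bs"
    by (simp only: lessThan_def)
  have r: "r \<ge> 1"
  proof (rule ccontr)
    assume "\<not> r \<ge> 1"
    then have "{..<r} = {}" by auto
    then have "f ` {..<r} = {}" by (simp only: image_empty)
    then show False using f by (metis insert_not_empty)
  qed
  have fEB: "f t \<in> ?EB" if "t < r" for t
  proof -
    have "f t \<in> insert 0 Bs"
      using f that by blast
    then show ?thesis
      by (metis insertE subsetD[OF Bs(2)] fs.subspace_0[OF EBsub])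
  qed
  have fAB: "f t \<in> homs m n A B" if "t < r" for t
    using fEB[OF that] EB by blast
  have ff: "f t \<in> fmats n" if "t < r" for t
    using fAB[OF that] homs_fmats by blast
  have e'f: "?e' \<star> f t = f t" if "t < r" for t
    using fEB[OF that] ee(2) by (auto simp: mm_assoc[symmetric])
  define I where "I Y = combine n r f ` fams n r (homs m n B Y)" for Y
  have I: "I Y = {\<Sum>t<r. h t \<star> f t | h. \<forall>t<r. h t \<in> homs m n B Y}" for Y
    unfolding I_def by (rule combine_image[OF homs_subset_fmats])
  have dI: "fs.dim (I B) \<le> fs.dim (I A)"
  proof -
    have "fs.dim {F \<in> fams n r (homs m n B A). combine n r f F = 0}
      \<le> fs.dim {F \<in> fams n r (homs m n B B). combine n r f F = 0}"
      using sys[THEN spec, THEN mp, OF r, THEN spec, THEN mp, of f] ff by simp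
    then show ?thesis
      unfolding I_def by (rule dim_combine_image[OF dB])
  qed
  have Isub: "fs.subspace (I Y)" for Y
    unfolding I_def by (rule fsp.linear_subspace_image[OF linear_combine subspace_fams[OF subspace_homs]])
  have Ihom: "I Y \<subseteq> homs m n A Y" for Y
    unfolding I using mm_homs[OF fAB] by (auto intro!: fs.subspace_sum[OF subspace_homs])
  have Icomp: "g \<star> x \<in> I Z" if g: "g \<in> homs m n Y Z" and x: "x \<in> I Y" for g x Y Z
  proof -
    obtain h where h: "x = (\<Sum>t<r. h t \<star> f t)" "\<forall>t<r. h t \<in> homs m n B Y"
      using x unfolding I by blast
    then have "g \<star> x = (\<Sum>t<r. (g \<star> h t) \<star> f t)"
      by (simp add: mm_sum_right mm_assoc)
    moreover have "\<forall>t<r. g \<star> h t \<in> homs m n B Z"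
      using h(2) g mm_homs by blast
    ultimately show ?thesis
      unfolding I by (intro CollectI exI[of _ "\<lambda>t. g \<star> h t"]) simp
  qed
  have "fs.dim (I A) + fs.dim (mm n ?e' ` I B) = fs.dim (I B) + fs.dim (mm n ?e ` I A)"
    by (rule dim_corner_transfer[OF aba bab subset_trans[OF Ihom homs_subset_fmats] Isub
          subset_trans[OF Ihom homs_subset_fmats] Isub Icomp[OF a] Icomp[OF b]])
  then have d1: "fs.dim (mm n ?e' ` I B) \<le> fs.dim (mm n ?e ` I A)"
    using dI by linarith
  have "?EB \<subseteq> mm n ?e' ` I B"
  proof -
    have "f t \<in> mm n ?e' ` I B" if t: "t < r" for t
    proof -
      have "(\<Sum>s<r. (if s = t then \<I> else 0) \<star> f s) = (\<Sum>s<r. if s = t then f s else 0)"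
        using ff by (intro sum.cong) (auto simp: mm_id_left)
      also have "\<dots> = f t"
        using t by simp
      finally have "f t \<in> I B"
        unfolding I using idf_homs[of n m B] fs.subspace_0[OF subspace_homs[of m n B B]]
        by (intro CollectI exI[of _ "\<lambda>s. if s = t then \<I> else 0"]) auto
      then show ?thesis
        using imageI[of "f t" "I B" "mm n ?e'"] by (simp only: e'f[OF t])
    qed
    then have "insert 0 Bs \<subseteq> mm n ?e' ` I B"
      unfolding f[symmetric] by blast
    then have "fs.span Bs \<subseteq> mm n ?e' ` I B"
      by (intro fs.span_minimal fsp.linear_subspace_image[OF linear_mm_left Isub]) blast
    then show ?thesis
      using Bs(4) by blast
  qed
  moreover have "mm n ?e' ` I B \<subseteq> fmats n"
    using Ihom[of B] homs_subset_fmats mm_homs[OF _ e'] by blast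
  ultimately have "fs.dim ?EB \<le> fs.dim (mm n ?e' ` I B)"
    by (intro fmats_dim_mono[of "mm n ?e' ` I B" n] subset_trans[OF _ fs.span_superset])
  then have d2: "fs.dim ?EA \<le> fs.dim (mm n ?e ` I A)"
    using d1 dimE by linarith
  have "mm n ?e ` I A = ?EA"
    by (rule fmats_subspace_eq[OF subset_trans[OF EA homs_subset_fmats]
          fsp.linear_subspace_image[OF linear_mm_left Isub] image_mono[OF Ihom] d2])
  moreover have "?e \<in> ?EA"
    using imageI[OF idf_homs[of n m A], of "mm n ?e"] by (simp only: mm_id_right[OF homs_fmats[OF e]])
  ultimately obtain x where x: "x \<in> I A" "?e = ?e \<star> x"
    by blast
  obtain h where h: "x = (\<Sum>t<r. h t \<star> f t)" "\<forall>t<r. h t \<in> homs m n B A"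
    using x(1) unfolding I by blast
  have "(\<Sum>t<r. (?e \<star> h t \<star> ?e') \<star> (?e' \<star> f t \<star> ?e)) = (\<Sum>t<r. ?e \<star> (h t \<star> f t) \<star> ?e)"
  proof (rule sum.cong)
    fix t assume "t \<in> {..<r}"
    then have t: "t < r" by simp
    have "(?e \<star> h t \<star> ?e') \<star> (?e' \<star> f t \<star> ?e) = ?e \<star> (h t \<star> (?e' \<star> (?e' \<star> f t))) \<star> ?e"
      by (simp only: mm_assoc)
    then show "(?e \<star> h t \<star> ?e') \<star> (?e' \<star> f t \<star> ?e) = ?e \<star> (h t \<star> f t) \<star> ?e"
      by (simp only: e'f[OF t])
  qed simp
  also have "\<dots> = ?e \<star> x \<star> ?e"
    by (simp only: h(1) mm_sum_left mm_sum_right)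
  also have "\<dots> = ?e"
    using x(2) ee(1) by (simp only:)
  finally show ?thesis
    using that[of r h f] h(2) fAB by blast
qed

text \<open>
Some product \<open>u = p q\<close> of homomorphisms between the complements is not nilpotent. Its Fitting idempotent
\<open>\<epsilon> = u w\<close> factors as \<open>p\<^sub>1 q\<^sub>1\<close> through the complement in \<open>B\<close>, so \<open>a + q\<^sub>1\<close> and \<open>b + p\<^sub>1\<close> describe a
larger common summand, with complementary projection \<open>e - \<epsilon>\<close>.
\<close>

lemma enlarge_common_summand:
  fixes a b :: "'a fmat"
  assumes a: "a \<in> homs m n A B" and b: "b \<in> homs m n B A"
    and aba: "a \<star> b \<star> a = a" and bab: "b \<star> a \<star> b = b"
    and ne: "\<I> - b \<star> a \<noteq> 0"
  obtains a1 b1 where "a1 \<in> homs m n A B" and "b1 \<in> homs m n B A"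
    and "a1 \<star> b1 \<star> a1 = a1" and "b1 \<star> a1 \<star> b1 = b1"
    and "fs.dim (mm n (\<I> - b1 \<star> a1) ` homs m n A A) < fs.dim (mm n (\<I> - b \<star> a) ` homs m n A A)"
proof -
  define e where "e = \<I> - b \<star> a"
  define e' where "e' = \<I> - a \<star> b"
  have ba: "b \<star> a \<in> homs m n A A" and ab: "a \<star> b \<in> homs m n B B"
    using mm_homs a b by blast+
  have e: "e \<in> homs m n A A" and e': "e' \<in> homs m n B B"
    unfolding e_def e'_def
    by (intro fs.subspace_diff[OF subspace_homs idf_homs] ba ab)+
  have fm: "a \<in> fmats n" "b \<in> fmats n" "e \<in> fmats n" "e' \<in> fmats n" "b \<star> a \<in> fmats n" "a \<star> b \<in> fmats n"
    using a b e e' ba ab homs_fmats by blast+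
  have "b \<star> a \<star> (b \<star> a) = b \<star> a" "a \<star> b \<star> (a \<star> b) = a \<star> b"
    using arg_cong[OF bab, of "\<lambda>x. x \<star> a"] arg_cong[OF aba, of "\<lambda>x. x \<star> b"]
    by (simp_all only: mm_assoc)
  then have ee: "e \<star> e = e" "e' \<star> e' = e'"
    unfolding e_def e'_def by (simp_all only: idem_compl[OF fm(5)] idem_compl[OF fm(6)])
  have ae: "a \<star> e = 0" and eb: "e \<star> b = 0" and be': "b \<star> e' = 0" and e'a: "e' \<star> a = 0"
    using aba bab fm by (simp_all add: e_def e'_def mm_diff_left mm_diff_right mm_id_left mm_id_right mm_assoc)
  have "\<exists>r h f. (\<forall>t<r. h t \<in> homs m n B A) \<and> (\<forall>t<r. f t \<in> homs m n A B) \<and>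
    (\<Sum>t<r::nat. ((\<I> - b \<star> a) \<star> h t \<star> (\<I> - a \<star> b)) \<star> ((\<I> - a \<star> b) \<star> f t \<star> (\<I> - b \<star> a))) = \<I> - b \<star> a"
  proof (rule corner_decomposition[OF a b aba bab])
    fix r :: nat and h f
    assume "\<And>t. t < r \<Longrightarrow> h t \<in> homs m n B A" "\<And>t. t < r \<Longrightarrow> f t \<in> homs m n A B"
      and "(\<Sum>t<r::nat. ((\<I> - b \<star> a) \<star> h t \<star> (\<I> - a \<star> b)) \<star> ((\<I> - a \<star> b) \<star> f t \<star> (\<I> - b \<star> a))) = \<I> - b \<star> a"
    then show ?thesis
      by (intro exI[of _ r] exI[of _ h] exI[of _ f] conjI allI impI)
  qed
  then obtain r h f where hf': "\<forall>t<r. h t \<in> homs m n B A" "\<forall>t<r. f t \<in> homs m n A B"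
    and sum': "(\<Sum>t<r::nat. ((\<I> - b \<star> a) \<star> h t \<star> (\<I> - a \<star> b)) \<star> ((\<I> - a \<star> b) \<star> f t \<star> (\<I> - b \<star> a))) = \<I> - b \<star> a"
    by (elim exE conjE)
  have hf: "\<And>t. t < r \<Longrightarrow> h t \<in> homs m n B A" "\<And>t. t < r \<Longrightarrow> f t \<in> homs m n A B"
    using hf' by blast+
  note sum = sum'[folded e_def e'_def]
  define P where "P = {p \<in> homs m n B A. e \<star> p = p \<and> p \<star> e' = p}"
  define Q where "Q = {q \<in> homs m n A B. e' \<star> q = q \<and> q \<star> e = q}"
  have hom: "y \<star> x \<in> homs m n X Z" if "x \<in> homs m n X Y" "y \<in> homs m n Y Z" for x y X Y Z
    using mm_homs[OF that] .
  have "\<exists>p\<in>P. \<exists>q\<in>Q. \<forall>k. fpow (p \<star> q) k \<noteq> 0"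
  proof (rule ccontr)
    assume c: "\<not> (\<exists>p\<in>P. \<exists>q\<in>Q. \<forall>k. fpow (p \<star> q) k \<noteq> 0)"
    have "(\<Sum>t<r. (e \<star> h t \<star> e') \<star> (e' \<star> f t \<star> e)) \<noteq> e"
    proof (rule nilpotent_sum_ne_corner[where P = P and Q = Q])
      show "e \<in> fmats n" "e \<star> e = e" "e \<noteq> 0"
        using fm ee ne by (simp_all only: e_def not_False_eq_True)
      show "p \<in> fmats n \<and> e \<star> p = p" if "p \<in> P" for p
        using that homs_fmats unfolding P_def by blast
      show "q \<in> fmats n \<and> q \<star> e = q" if "q \<in> Q" for q
        using that homs_fmats unfolding Q_def by blast
      show "p \<star> q \<star> p' \<in> P" if pq: "p \<in> P" "q \<in> Q" "p' \<in> P" for p q p'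
      proof -
        have "(p \<star> q) \<star> p' \<in> homs m n B A"
          using pq hom unfolding P_def Q_def by blast
        moreover have "e \<star> ((p \<star> q) \<star> p') = ((e \<star> p) \<star> q) \<star> p'" "((p \<star> q) \<star> p') \<star> e' = (p \<star> q) \<star> (p' \<star> e')"
          by (simp_all only: mm_assoc)
        ultimately show ?thesis
          using pq unfolding P_def by simp
      qed
      show "0 \<in> P"
        using fs.subspace_0[OF subspace_homs] by (simp add: P_def mm_zero_left mm_zero_right)
      show "p + p' \<in> P" if "p \<in> P" "p' \<in> P" for p p'
      proof -
        have "p + p' \<in> homs m n B A"
          using that unfolding P_def by (intro fs.subspace_add[OF subspace_homs]) simp_all
        then show ?thesis
          using that by (simp add: P_def mm_add_left mm_add_right)
      qed
      show "\<exists>k. fpow (p \<star> q) k = 0" if "p \<in> P" "q \<in> Q" for p q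
        using that c by blast
      show "e \<star> h t \<star> e' \<in> P" if "t < r" for t
        using hom[OF hom[OF e' hf(1)[OF that]] e] ee by (simp add: P_def mm_assoc) (simp add: mm_assoc[symmetric] ee)
      show "e' \<star> f t \<star> e \<in> Q" if "t < r" for t
        using hom[OF e hom[OF hf(2)[OF that] e']] ee by (simp add: Q_def mm_assoc) (simp add: mm_assoc[symmetric] ee)
    qed
    then show False
      using sum by blast
  qed
  then obtain p q where p: "p \<in> homs m n B A" "e \<star> p = p" "p \<star> e' = p"
    and q: "q \<in> homs m n A B" "e' \<star> q = q" "q \<star> e = q" and nn: "\<And>k. fpow (p \<star> q) k \<noteq> 0"
    unfolding P_def Q_def by blast
  define u where "u = p \<star> q"
  have uH: "u \<in> homs m n A A"
    unfolding u_def by (rule hom[OF q(1) p(1)])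
  have pow: "fpow u k \<in> homs m n A A" for k
    by (induction k) (simp_all add: idf_homs mm_homs[OF _ uH])
  obtain w where w: "w \<in> homs m n A A" "u \<star> w = w \<star> u" "u \<star> w \<star> (u \<star> w) = u \<star> w" "u \<star> w \<noteq> 0"
    using fitting_idempotent[OF homs_fmats[OF uH] nn[folded u_def] subspace_homs pow mm_homs] .
  define \<epsilon> where "\<epsilon> = u \<star> w"
  have \<epsilon>H: "\<epsilon> \<in> homs m n A A"
    unfolding \<epsilon>_def by (rule hom[OF w(1) uH])
  have eu: "e \<star> u = u" and ue: "u \<star> e = u"
    unfolding u_def using p q by (simp_all add: mm_assoc) (simp add: mm_assoc[symmetric])
  have e\<epsilon>: "e \<star> \<epsilon> = \<epsilon>"
    unfolding \<epsilon>_def using eu by (simp only: mm_assoc[symmetric])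
  have \<epsilon>e: "\<epsilon> \<star> e = \<epsilon>"
    unfolding \<epsilon>_def w(2) using ue by (simp only: mm_assoc)
  have \<epsilon>\<epsilon>: "\<epsilon> \<star> \<epsilon> = \<epsilon>" and \<epsilon>0: "\<epsilon> \<noteq> 0"
    using w by (simp_all only: \<epsilon>_def not_False_eq_True)
  define q1 where "q1 = q \<star> \<epsilon>"
  define p1 where "p1 = \<epsilon> \<star> (w \<star> p)"
  have p1q1: "p1 \<star> q1 = \<epsilon>"
  proof -
    have "p1 \<star> q1 = \<epsilon> \<star> ((w \<star> u) \<star> \<epsilon>)"
      by (simp only: p1_def q1_def u_def mm_assoc)
    then show ?thesis
      by (simp only: w(2)[symmetric] \<epsilon>_def[symmetric] \<epsilon>\<epsilon>)
  qed
  have bq1: "b \<star> q1 = 0"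
  proof -
    have "b \<star> q1 = (b \<star> e') \<star> (q \<star> \<epsilon>)"
      unfolding q1_def by (simp only: mm_assoc) (simp only: mm_assoc[symmetric] q(2))
    then show ?thesis by (simp only: be' mm_zero_left mm_zero_right)
  qed
  have p1a: "p1 \<star> a = 0"
  proof -
    have "p1 \<star> a = \<epsilon> \<star> (w \<star> ((p \<star> e') \<star> a))"
      unfolding p1_def p(3) by (simp only: mm_assoc)
    also have "\<dots> = \<epsilon> \<star> (w \<star> (p \<star> (e' \<star> a)))"
      by (simp only: mm_assoc)
    finally show ?thesis by (simp only: e'a mm_zero_left mm_zero_right)
  qed
  have a\<epsilon>: "a \<star> \<epsilon> = 0"
  proof -
    have "a \<star> \<epsilon> = (a \<star> e) \<star> \<epsilon>"
      by (simp only: mm_assoc e\<epsilon>)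
    then show ?thesis by (simp only: ae mm_zero_left mm_zero_right)
  qed
  have \<epsilon>b: "\<epsilon> \<star> b = 0"
  proof -
    have "\<epsilon> \<star> b = \<epsilon> \<star> (e \<star> b)"
      by (simp only: mm_assoc[symmetric] \<epsilon>e)
    then show ?thesis by (simp only: eb mm_zero_left mm_zero_right)
  qed
  have q1\<epsilon>: "q1 \<star> \<epsilon> = q1" and \<epsilon>p1: "\<epsilon> \<star> p1 = p1"
    unfolding q1_def p1_def by (simp only: mm_assoc \<epsilon>\<epsilon>) (simp only: mm_assoc[symmetric] \<epsilon>\<epsilon>)
  define a1 where "a1 = a + q1"
  define b1 where "b1 = b + p1"
  have b1a1: "b1 \<star> a1 = b \<star> a + \<epsilon>"
    by (simp add: a1_def b1_def mm_add_left mm_add_right bq1 p1a p1q1)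
  show ?thesis
  proof
    have "q1 \<in> homs m n A B"
      unfolding q1_def by (rule hom[OF \<epsilon>H q(1)])
    then show "a1 \<in> homs m n A B"
      unfolding a1_def by (rule fs.subspace_add[OF subspace_homs a])
    have "p1 \<in> homs m n B A"
      unfolding p1_def by (rule hom[OF hom[OF p(1) w(1)] \<epsilon>H])
    then show "b1 \<in> homs m n B A"
      unfolding b1_def by (rule fs.subspace_add[OF subspace_homs b])
    have "q1 \<star> (b \<star> a) = q \<star> (\<epsilon> \<star> b \<star> a)"
      by (simp only: q1_def mm_assoc)
    then have q1ba: "q1 \<star> (b \<star> a) = 0"
      by (simp only: \<epsilon>b mm_zero_left mm_zero_right)
    have "a \<star> p1 = a \<star> \<epsilon> \<star> (w \<star> p)"
      by (simp only: p1_def mm_assoc)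
    then have ap1: "a \<star> p1 = 0"
      by (simp only: a\<epsilon> mm_zero_left)
    have "a1 \<star> b1 \<star> a1 = a1 \<star> (b \<star> a + \<epsilon>)"
      by (simp only: mm_assoc b1a1)
    also have "\<dots> = a \<star> b \<star> a + q1 \<star> (b \<star> a) + (a \<star> \<epsilon> + q1 \<star> \<epsilon>)"
      by (simp only: a1_def mm_add_left mm_add_right mm_assoc)
    finally show "a1 \<star> b1 \<star> a1 = a1"
      by (simp only: aba q1ba a\<epsilon> q1\<epsilon> a1_def add_0_left add_0_right)
    have "b1 \<star> a1 \<star> b1 = b \<star> a \<star> b + \<epsilon> \<star> b + (b \<star> (a \<star> p1) + \<epsilon> \<star> p1)"
      unfolding b1a1 by (simp only: b1_def mm_add_left mm_add_right mm_assoc)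
    then show "b1 \<star> a1 \<star> b1 = b1"
      by (simp only: bab \<epsilon>b ap1 mm_zero_right \<epsilon>p1 b1_def add_0_left add_0_right)
    define e1 where "e1 = \<I> - b1 \<star> a1"
    have e1: "e1 = e - \<epsilon>"
      by (simp add: e1_def e_def b1a1 algebra_simps)
    have e1H: "e1 \<in> homs m n A A"
      unfolding e1 by (rule fs.subspace_diff[OF subspace_homs e \<epsilon>H])
    have ee1: "e \<star> e1 = e1" and e1e1: "e1 \<star> e1 = e1" and e1\<epsilon>: "e1 \<star> \<epsilon> = 0"
      by (simp_all only: e1 mm_diff_left mm_diff_right ee e\<epsilon> \<epsilon>e \<epsilon>\<epsilon> diff_self diff_zero)
    have sub: "mm n e1 ` homs m n A A \<subseteq> mm n e ` homs m n A A"
    proof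
      fix x assume "x \<in> mm n e1 ` homs m n A A"
      then obtain g where g: "g \<in> homs m n A A" "x = e1 \<star> g" by blast
      have "x = e \<star> (e1 \<star> g)"
        unfolding g(2) by (simp only: mm_assoc[symmetric] ee1)
      then show "x \<in> mm n e ` homs m n A A"
        using hom[OF g(1) e1H] by blast
    qed
    have "e1 \<star> g \<noteq> \<epsilon>" for g
    proof
      assume g: "e1 \<star> g = \<epsilon>"
      have "\<epsilon> = e1 \<star> (e1 \<star> g)"
        unfolding g[symmetric] by (simp only: mm_assoc[symmetric] e1e1)
      then have "\<epsilon> = 0"
        unfolding g e1\<epsilon> .
      with \<epsilon>0 show False by blast
    qed
    then have "\<epsilon> \<notin> mm n e1 ` homs m n A A"
      by blast
    moreover have "\<epsilon> \<in> mm n e ` homs m n A A"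
      using imageI[OF \<epsilon>H, of "mm n e"] by (simp only: e\<epsilon>)
    ultimately have "mm n e1 ` homs m n A A \<noteq> mm n e ` homs m n A A"
      by blast
    moreover have "mm n e ` homs m n A A \<subseteq> fmats n"
      using mm_homs[OF _ e] homs_fmats by blast
    ultimately have "\<not> fs.dim (mm n e ` homs m n A A) \<le> fs.dim (mm n e1 ` homs m n A A)"
      using fmats_subspace_eq[of "mm n e ` homs m n A A" n "mm n e1 ` homs m n A A"] sub
        fsp.linear_subspace_image[OF linear_mm_left subspace_homs] by blast
    then show "fs.dim (mm n (\<I> - b1 \<star> a1) ` homs m n A A) < fs.dim (mm n (\<I> - b \<star> a) ` homs m n A A)"
      unfolding e1_def e_def by linarith
  qed
qed

text \<open>
For a common summand with \<open>e Hom(A, A)\<close> of least dimension, \<open>e = 0\<close>.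
\<close>

lemma split_of_equal_dims:
  obtains a b where "a \<in> homs m n A B" and "b \<in> homs m n B A" and "b \<star> a = \<I>"
proof -
  define S where "S = {(a, b). a \<in> homs m n A B \<and> b \<in> homs m n B A \<and> a \<star> b \<star> a = a \<and> b \<star> a \<star> b = b}"
  have "(0, 0) \<in> S"
    unfolding S_def using fs.subspace_0[OF subspace_homs[of m n A B]]
      fs.subspace_0[OF subspace_homs[of m n B A]] by simp
  then obtain x where x: "x \<in> S"
    and min: "\<And>y. y \<in> S \<Longrightarrow> fs.dim (mm n (\<I> - snd x \<star> fst x) ` homs m n A A)
      \<le> fs.dim (mm n (\<I> - snd y \<star> fst y) ` homs m n A A)"
    using ex_has_least_nat[of "\<lambda>x. x \<in> S" "(0, 0)"
        "\<lambda>y. fs.dim (mm n (\<I> - snd y \<star> fst y) ` homs m n A A)"] by blast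
  obtain a b where ab: "x = (a, b)" by force
  then have h: "a \<in> homs m n A B" "b \<in> homs m n B A" "a \<star> b \<star> a = a" "b \<star> a \<star> b = b"
    using x by (auto simp: S_def)
  have "\<I> - b \<star> a = 0"
  proof (rule ccontr)
    assume ne: "\<I> - b \<star> a \<noteq> 0"
    obtain a1 b1 where "a1 \<in> homs m n A B" "b1 \<in> homs m n B A"
      "a1 \<star> b1 \<star> a1 = a1" "b1 \<star> a1 \<star> b1 = b1"
      and lt: "fs.dim (mm n (\<I> - b1 \<star> a1) ` homs m n A A) < fs.dim (mm n (\<I> - b \<star> a) ` homs m n A A)"
      using enlarge_common_summand[OF h ne] .
    then have "(a1, b1) \<in> S"
      by (simp add: S_def)
    from min[OF this] lt show False
      unfolding ab fst_conv snd_conv by linarith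
  qed
  then show ?thesis
    using that[OF h(1,2)] by (simp only: right_minus_eq)
qed

end

end

section \<open>Orbits\<close>

lemma fmat_mult:
  assumes "M \<in> carrier_mat n n" and "N \<in> carrier_mat n n"
  shows "fmat n (M * N) = mm n (fmat n M) (fmat n N)"
  using assms by (auto simp: fun_eq_iff fmat_def mm_def scalar_prod_def atLeast0LessThan intro!: sum.cong)

lemma fmat_inj:
  assumes "M \<in> carrier_mat n n" and "N \<in> carrier_mat n n" and "fmat n M = fmat n N"
  shows "M = N"
proof (rule eq_matI)
  fix i j assume "i < dim_row N" "j < dim_col N"
  then show "M $$ (i, j) = N $$ (i, j)"
  proof -
    have "fmat n M (i, j) = fmat n N (i, j)"
      using assms(3) by (rule fun_cong)
    then show ?thesis
      using assms(1,2) \<open>i < dim_row N\<close> \<open>j < dim_col N\<close> by (simp add: fmat_def)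
  qed
qed (use assms in auto)

definition matf :: "nat \<Rightarrow> 'a fmat \<Rightarrow> 'a mat" where
  "matf n f = mat n n f"

lemma matf_carrier [simp]: "matf n f \<in> carrier_mat n n"
  by (simp add: matf_def)

lemma fmat_matf: "f \<in> fmats n \<Longrightarrow> fmat n (matf n f) = f"
  by (auto simp: fun_eq_iff fmat_def matf_def fmats_def supp_def)

lemma matf_fmat: "M \<in> carrier_mat n n \<Longrightarrow> matf n (fmat n M) = M"
  by (rule eq_matI) (auto simp: fmat_def matf_def)

lemma fmat_one: "fmat n (1\<^sub>m n) = idf n"
  by (auto simp: fun_eq_iff fmat_def idf_def)

lemma nth_mat_tuples: "A \<in> mat_tuples m n \<Longrightarrow> s < m \<Longrightarrow> A ! s \<in> carrier_mat n n"
  by (auto simp: mat_tuples_def)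

lemma homs_mat_iff:
  assumes "g \<in> carrier_mat n n" and "A \<in> mat_tuples m n" and "B \<in> mat_tuples m n"
  shows "fmat n g \<in> homs m n A B \<longleftrightarrow> (\<forall>s<m. g * A ! s = B ! s * g)"
proof -
  have "mm n (fmat n g) (fmat n (A ! s)) = mm n (fmat n (B ! s)) (fmat n g) \<longleftrightarrow> g * A ! s = B ! s * g"
    if "s < m" for s
    using assms nth_mat_tuples[OF assms(2) that] nth_mat_tuples[OF assms(3) that]
      fmat_inj[of "g * A ! s" n "B ! s * g"]
    by (auto simp: fmat_mult[symmetric])
  then show ?thesis
    using assms by (auto simp: homs_def fmat_fmats)
qed

lemma det_nonzero_inverse:
  fixes g :: "'a::field mat"
  assumes g: "g \<in> carrier_mat n n" and "det g \<noteq> 0"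
  obtains h where "h \<in> carrier_mat n n" "g * h = 1\<^sub>m n" "h * g = 1\<^sub>m n"
proof
  show "(1 / det g) \<cdot>\<^sub>m adj_mat g \<in> carrier_mat n n"
    using adj_mat(1)[OF g] by simp
  show "g * ((1 / det g) \<cdot>\<^sub>m adj_mat g) = 1\<^sub>m n" "((1 / det g) \<cdot>\<^sub>m adj_mat g) * g = 1\<^sub>m n"
    using adj_mat[OF g] assms by (auto simp: mult_smult_distrib mult_smult_assoc_mat intro!: eq_matI)
qed

text \<open>
Membership in the orbit as solvability of linear equations for \<open>g\<close>, without the inverse of \<open>g\<close>.
\<close>

lemma conj_orbit_iff:
  fixes A X :: "'a::field mat list"
  assumes A: "A \<in> mat_tuples m n"
  shows "X \<in> conj_orbit n A \<longleftrightarrow> X \<in> mat_tuples m n \<and>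
    (\<exists>g \<in> carrier_mat n n. det g \<noteq> 0 \<and> (\<forall>s<m. g * A ! s = X ! s * g))"
proof
  assume "X \<in> conj_orbit n A"
  then obtain g h where gh: "g \<in> carrier_mat n n" "h \<in> carrier_mat n n" "g * h = 1\<^sub>m n" "h * g = 1\<^sub>m n"
    and X: "X = map (\<lambda>Y. g * Y * h) A"
    unfolding conj_orbit_def by blast
  have "det g * det h = 1"
    using det_mult[OF gh(1,2)] gh(3) by simp
  then have "det g \<noteq> 0" by auto
  moreover have "X \<in> mat_tuples m n"
    using A gh(1,2) by (auto simp: mat_tuples_def X)
  moreover have "g * A ! s = X ! s * g" if s: "s < m" for s
  proof -
    have As: "A ! s \<in> carrier_mat n n"
      by (rule nth_mat_tuples[OF A s])
    have "X ! s * g = g * A ! s * h * g"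
      using A s by (simp add: X mat_tuples_def)
    also have "\<dots> = g * A ! s * (h * g)"
      using As gh(1,2) by (intro assoc_mult_mat[of _ n n _ n _ n]) auto
    finally show ?thesis
      using As gh(1,4) by simp
  qed
  ultimately show "X \<in> mat_tuples m n \<and> (\<exists>g \<in> carrier_mat n n. det g \<noteq> 0 \<and> (\<forall>s<m. g * A ! s = X ! s * g))"
    using gh(1) by blast
next
  assume "X \<in> mat_tuples m n \<and> (\<exists>g \<in> carrier_mat n n. det g \<noteq> 0 \<and> (\<forall>s<m. g * A ! s = X ! s * g))"
  then obtain g where X: "X \<in> mat_tuples m n" and g: "g \<in> carrier_mat n n" "det g \<noteq> 0"
    and eq: "\<And>s. s < m \<Longrightarrow> g * A ! s = X ! s * g"
    by blast
  obtain h where h: "h \<in> carrier_mat n n" "g * h = 1\<^sub>m n" "h * g = 1\<^sub>m n"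
    using det_nonzero_inverse[OF g] .
  have "X = map (\<lambda>Y. g * Y * h) A"
  proof (rule nth_equalityI)
    show "length X = length (map (\<lambda>Y. g * Y * h) A)"
      using A X by (simp add: mat_tuples_def)
    fix s assume "s < length X"
    then have s: "s < m"
      using X by (simp add: mat_tuples_def)
    have Xs: "X ! s \<in> carrier_mat n n"
      by (rule nth_mat_tuples[OF X s])
    have "g * A ! s * h = X ! s * g * h"
      using eq[OF s] by simp
    also have "\<dots> = X ! s * (g * h)"
      using Xs g h by (intro assoc_mult_mat) auto
    finally show "X ! s = map (\<lambda>Y. g * Y * h) A ! s"
      using Xs h s A by (simp add: mat_tuples_def)
  qed
  then show "X \<in> conj_orbit n A"
    unfolding conj_orbit_def using g h by blast
qed

lemma conj_orbit_trans:
  fixes A B :: "'a::field mat list"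
  assumes A: "A \<in> mat_tuples m n" and B: "B \<in> conj_orbit n A" and X: "X \<in> conj_orbit n B"
  shows "X \<in> conj_orbit n A"
proof -
  have Bt: "B \<in> mat_tuples m n"
    using B conj_orbit_iff[OF A] by blast
  obtain g where g: "g \<in> carrier_mat n n" "det g \<noteq> 0" "\<forall>s<m. g * A ! s = B ! s * g"
    using B conj_orbit_iff[OF A] by blast
  obtain h where Xt: "X \<in> mat_tuples m n"
    and h: "h \<in> carrier_mat n n" "det h \<noteq> 0" "\<forall>s<m. h * B ! s = X ! s * h"
    using X conj_orbit_iff[OF Bt] by blast
  have "h * g * A ! s = X ! s * (h * g)" if s: "s < m" for s
  proof -
    note c = nth_mat_tuples[OF A s] nth_mat_tuples[OF Bt s] nth_mat_tuples[OF Xt s]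
    have "h * g * A ! s = h * (g * A ! s)"
      using c g h by (intro assoc_mult_mat) auto
    also have "\<dots> = h * (B ! s * g)"
      using g s by simp
    also have "\<dots> = h * B ! s * g"
      using c g h by (intro assoc_mult_mat[symmetric]) auto
    also have "\<dots> = X ! s * h * g"
      using h s by simp
    also have "\<dots> = X ! s * (h * g)"
      using c g h by (intro assoc_mult_mat) auto
    finally show ?thesis .
  qed
  moreover have "det (h * g) \<noteq> 0"
    using g h det_mult[of h n g] by simp
  ultimately show ?thesis
    unfolding conj_orbit_iff[OF A] using Xt g h by (intro conjI bexI[of _ "h * g"]) auto
qed

lemma conj_orbit_sym:
  fixes A B :: "'a::field mat list"
  assumes A: "A \<in> mat_tuples m n" and B: "B \<in> conj_orbit n A"
  shows "A \<in> conj_orbit n B"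
proof -
  have Bt: "B \<in> mat_tuples m n"
    using B conj_orbit_iff[OF A] by blast
  obtain g where g: "g \<in> carrier_mat n n" "det g \<noteq> 0" "\<forall>s<m. g * A ! s = B ! s * g"
    using B conj_orbit_iff[OF A] by blast
  obtain h where h: "h \<in> carrier_mat n n" "g * h = 1\<^sub>m n" "h * g = 1\<^sub>m n"
    using det_nonzero_inverse[OF g(1,2)] .
  have "h * B ! s = A ! s * h" if s: "s < m" for s
  proof -
    note c = nth_mat_tuples[OF A s] nth_mat_tuples[OF Bt s]
    have "h * B ! s = h * (B ! s * (g * h))"
      using c h by simp
    also have "\<dots> = h * (B ! s * g) * h"
      using c g h by (simp add: assoc_mult_mat[of _ n n _ n _ n])
    also have "\<dots> = h * (g * A ! s) * h"
      using g s by simp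
    also have "\<dots> = (h * g) * A ! s * h"
      using c g(1) h(1) by (simp add: assoc_mult_mat[of _ n n _ n _ n])
    finally show ?thesis
      using c h by simp
  qed
  moreover have "det h * det g = 1"
    using det_mult[OF h(1) g(1)] h by simp
  ultimately show ?thesis
    unfolding conj_orbit_iff[OF Bt] using A h by (intro conjI bexI[of _ h]) auto
qed

lemma conj_orbit_eqI:
  fixes A B :: "'a::field mat list"
  assumes "A \<in> mat_tuples m n" and "B \<in> conj_orbit n A"
  shows "conj_orbit n A = conj_orbit n B"
  using conj_orbit_trans conj_orbit_sym assms conj_orbit_iff by (metis subsetI subset_antisym)

text \<open>
Equality would make all four of \<open>[A, A]\<close>, \<open>[A, B]\<close>, \<open>[B, A]\<close> and \<open>[B, B]\<close> equal, and then a common summand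
exhausts \<open>A\<close>, which has the same size as \<open>B\<close>.
\<close>

theorem hom_less_dim_endomorphisms:
  fixes A B :: "'a::field mat list"
  assumes less: "hom_less m n A B" and A: "A \<in> mat_tuples m n" and B: "B \<in> mat_tuples m n"
    and pos: "m \<ge> 1" "n \<ge> 1"
  shows "fs.dim (homs m n A A) < fs.dim (homs m n B B)"
proof -
  have le: "hom_le m n A B" and ne: "conj_orbit n A \<noteq> conj_orbit n B"
    using less by (simp_all add: hom_less_def)
  have into: "fs.dim (homs m n A X) \<le> fs.dim (homs m n B X)" for X
    by (rule hom_le_dim_homs_into[OF le A B pos])
  have sys: "fs.dim {F \<in> fams n r (homs m n X A). combine n r f F = 0}
      \<le> fs.dim {F \<in> fams n r (homs m n X B). combine n r f F = 0}"
    if "r \<ge> 1" "\<And>t. t < r \<Longrightarrow> f t \<in> fmats n" for r f X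
    by (rule hom_le_dim_systems[OF le A B pos that])
  have out: "fs.dim (homs m n X A) \<le> fs.dim (homs m n X B)" for X
  proof -
    have "combine n 1 (\<lambda>_. 0) F = 0" for F :: "(nat \<times> nat) \<times> nat \<Rightarrow> 'a"
      by (simp add: combine_def)
    moreover have "fs.dim (fams n 1 (homs m n X Y)) = fs.dim (homs m n X Y)" for Y
      using dim_fams[OF homs_subset_fmats subspace_homs, of n 1 m X Y] by simp
    ultimately show ?thesis
      using sys[of 1 "\<lambda>_. 0" X] fs.subspace_0[OF subspace_fmats[of n]] by simp
  qed
  show ?thesis
  proof (rule ccontr)
    assume nl: "\<not> fs.dim (homs m n A A) < fs.dim (homs m n B B)"
    have dA: "fs.dim (homs m n A A) = fs.dim (homs m n A B)"
      and dB: "fs.dim (homs m n B A) = fs.dim (homs m n B B)"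
      using nl into[of A] into[of B] out[of A] out[of B] by linarith+
    have sysB: "\<forall>r\<ge>1. \<forall>f. (\<forall>t<r. f t \<in> fmats n) \<longrightarrow>
      fs.dim {F \<in> fams n r (homs m n B A). combine n r f F = 0}
      \<le> fs.dim {F \<in> fams n r (homs m n B B). combine n r f F = 0}"
      using sys by blast
    obtain a b where ab: "a \<in> homs m n A B" "b \<in> homs m n B A" "mm n b a = idf n"
      by (rule split_of_equal_dims[OF dA dB sysB]) (rule that)
    define g where "g = matf n a"
    define h where "h = matf n b"
    have gh: "g \<in> carrier_mat n n" "h \<in> carrier_mat n n" "fmat n g = a" "fmat n h = b"
      using homs_fmats[OF ab(1)] homs_fmats[OF ab(2)] by (simp_all add: g_def h_def fmat_matf)
    have "fmat n (h * g) = fmat n (1\<^sub>m n)"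
      using gh ab(3) by (simp add: fmat_mult fmat_one)
    then have "h * g = 1\<^sub>m n"
      using gh by (intro fmat_inj[of _ n]) auto
    then have "det h * det g = 1"
      using det_mult[OF gh(2,1)] by simp
    then have "det g \<noteq> 0" by auto
    moreover have "\<forall>s<m. g * A ! s = B ! s * g"
      using homs_mat_iff[OF gh(1) A B] ab(1) gh(3) by simp
    ultimately have "B \<in> conj_orbit n A"
      unfolding conj_orbit_iff[OF A] using gh(1) B by blast
    then show False
      using conj_orbit_eqI[OF A] ne by blast
  qed
qed

section \<open>Polynomial functions\<close>

text \<open>
\<open>pol C N f\<close>: the function \<open>f\<close> is a polynomial expression of degree at most \<open>N\<close> in the functions from
\<open>C\<close>. With \<open>C\<close> the matrix entries, the parameters of the slice, or the identity \<open>\<lambda>t. t\<close> alone, this one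
notion covers all the polynomial functions that occur.
\<close>

inductive pol :: "('p \<Rightarrow> 'a::comm_ring_1) set \<Rightarrow> nat \<Rightarrow> ('p \<Rightarrow> 'a) \<Rightarrow> bool"
  for C :: "('p \<Rightarrow> 'a) set" where
  const: "pol C N (\<lambda>_. c)"
| coord: "f \<in> C \<Longrightarrow> 1 \<le> N \<Longrightarrow> pol C N f"
| add: "pol C N f \<Longrightarrow> pol C N g \<Longrightarrow> pol C N (\<lambda>x. f x + g x)"
| mult: "pol C a f \<Longrightarrow> pol C b g \<Longrightarrow> a + b \<le> N \<Longrightarrow> pol C N (\<lambda>x. f x * g x)"

definition polyfun :: "('p \<Rightarrow> 'a::comm_ring_1) set \<Rightarrow> ('p \<Rightarrow> 'a) \<Rightarrow> bool" where
  "polyfun C f \<longleftrightarrow> (\<exists>N. pol C N f)"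

lemma pol_mono: "pol C N f \<Longrightarrow> N \<le> N' \<Longrightarrow> pol C N' f"
proof (induction arbitrary: N' rule: pol.induct)
  case (mult a f b g N)
  then show ?case
    by (intro pol.mult[OF mult.hyps(1,2)]) simp
qed (auto intro: pol.intros)

lemma pol_scale: "pol C N f \<Longrightarrow> pol C N (\<lambda>x. c * f x)"
  using pol.mult[OF pol.const[of C 0 c], of N f N] by simp

lemma pol_power: "pol C k f \<Longrightarrow> pol C (k * N) (\<lambda>x. f x ^ N)"
proof (induction N)
  case 0
  then show ?case using pol.const[of C 0 1] by simp
next
  case (Suc N)
  then show ?case by (auto intro: pol.mult)
qed

lemma polyfun_const: "polyfun C (\<lambda>_. c)"
  unfolding polyfun_def by (blast intro: pol.const)

lemma polyfun_coord: "f \<in> C \<Longrightarrow> polyfun C f"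
  unfolding polyfun_def by (blast intro: pol.coord)

lemma polyfun_add: "polyfun C f \<Longrightarrow> polyfun C g \<Longrightarrow> polyfun C (\<lambda>x. f x + g x)"
  unfolding polyfun_def by (metis pol.add pol_mono nat_le_linear)

lemma polyfun_mult: "polyfun C f \<Longrightarrow> polyfun C g \<Longrightarrow> polyfun C (\<lambda>x. f x * g x)"
  unfolding polyfun_def by (blast intro: pol.mult)

lemma polyfun_uminus: "polyfun C f \<Longrightarrow> polyfun C (\<lambda>x. - f x)"
  using polyfun_mult[OF polyfun_const[of C "- 1"], of f] by simp

lemma polyfun_diff: "polyfun C f \<Longrightarrow> polyfun C g \<Longrightarrow> polyfun C (\<lambda>x. f x - g x)"
  using polyfun_add[OF _ polyfun_uminus, of C f g] by simp

lemma polyfun_sum: "(\<And>i. i \<in> I \<Longrightarrow> polyfun C (f i)) \<Longrightarrow> polyfun C (\<lambda>x. \<Sum>i\<in>I. f i x)"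
  by (induction I rule: infinite_finite_induct) (auto intro: polyfun_const polyfun_add)

lemma polyfun_prod: "(\<And>i. i \<in> I \<Longrightarrow> polyfun C (f i)) \<Longrightarrow> polyfun C (\<lambda>x. \<Prod>i\<in>I. f i x)"
  by (induction I rule: infinite_finite_induct) (auto intro: polyfun_const polyfun_mult)

definition coordf :: "nat \<Rightarrow> nat \<Rightarrow> ('a mat list \<Rightarrow> 'a) set" where
  "coordf m n = (\<lambda>(s, i, j) A. A ! s $$ (i, j)) ` ({..<m} \<times> {..<n} \<times> {..<n})"

lemma finite_coordf: "finite (coordf m n)"
  by (simp add: coordf_def)

lemma poly_funs_iff_polx: "f \<in> poly_funs m n \<longleftrightarrow> polyfun (coordf m n) f"
proof
  assume "f \<in> poly_funs m n"
  then show "polyfun (coordf m n) f"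
  proof (induction rule: poly_funs.induct)
    case (coord s i j)
    then show ?case
      unfolding coordf_def by (intro polyfun_coord image_eqI[of _ _ "(s, i, j)"]) auto
  qed (auto intro: polyfun_const polyfun_add polyfun_mult)
next
  assume "polyfun (coordf m n) f"
  then obtain N where "pol (coordf m n) N f"
    unfolding polyfun_def by blast
  then show "f \<in> poly_funs m n"
    by (induction rule: pol.induct) (auto simp: coordf_def intro: poly_funs.intros)
qed

subsection \<open>Matrices with polynomial entries\<close>

definition polmat :: "('p \<Rightarrow> 'a::comm_ring_1) set \<Rightarrow> nat \<Rightarrow> ('p \<Rightarrow> 'a mat) \<Rightarrow> bool" where
  "polmat C n M \<longleftrightarrow> (\<forall>x. M x \<in> carrier_mat n n) \<and> (\<forall>i<n. \<forall>j<n. polyfun C (\<lambda>x. M x $$ (i, j)))"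

lemma polmat_entry: "polmat C n M \<Longrightarrow> i < n \<Longrightarrow> j < n \<Longrightarrow> polyfun C (\<lambda>x. M x $$ (i, j))"
  and polmat_carrier: "polmat C n M \<Longrightarrow> M x \<in> carrier_mat n n"
  by (simp_all add: polmat_def)

lemma polmat_const: "M \<in> carrier_mat n n \<Longrightarrow> polmat C n (\<lambda>_. M)"
  by (simp add: polmat_def polyfun_const)

lemma polmat_mult:
  assumes "polmat C n M" and "polmat C n N"
  shows "polmat C n (\<lambda>x. M x * N x)"
proof -
  have "(M x * N x) $$ (i, j) = (\<Sum>k<n. M x $$ (i, k) * N x $$ (k, j))" if "i < n" "j < n" for i j x
    using that polmat_carrier[OF assms(1), of x] polmat_carrier[OF assms(2), of x]
    by (simp add: scalar_prod_def atLeast0LessThan)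
  then have "polyfun C (\<lambda>x. (M x * N x) $$ (i, j))" if "i < n" "j < n" for i j
    using that assms by (auto intro!: polyfun_sum polyfun_mult polmat_entry)
  moreover have "M x * N x \<in> carrier_mat n n" for x
    using polmat_carrier[OF assms(1)] polmat_carrier[OF assms(2)] by (rule mult_carrier_mat)
  ultimately show ?thesis
    by (simp add: polmat_def)
qed

lemma polyfun_det:
  assumes "polmat C n M"
  shows "polyfun C (\<lambda>x. det (M x))"
proof -
  have "det (M x) = (\<Sum>p \<in> {p. p permutes {0..<n}}. signof p * (\<Prod>i = 0..<n. M x $$ (i, p i)))" for x
    by (rule det_def'[OF polmat_carrier[OF assms]])
  moreover have "polyfun C (\<lambda>x. \<Sum>p \<in> {p. p permutes {0..<n}}. signof p * (\<Prod>i = 0..<n. M x $$ (i, p i)))"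
  proof (intro polyfun_sum polyfun_mult polyfun_const polyfun_prod polmat_entry[OF assms])
    fix p i assume "p \<in> {p. p permutes {0..<n}}" "i \<in> {0..<n}"
    then show "i < n" "p i < n"
      using permutes_in_image[of p "{0..<n}" i] by auto
  qed
  ultimately show ?thesis
    by (simp only:)
qed

lemma polmat_delete:
  assumes "polmat C n M" and "i < n" and "j < n"
  shows "polmat C (n - 1) (\<lambda>x. mat_delete (M x) i j)"
  unfolding polmat_def
proof (intro conjI allI impI)
  show "mat_delete (M x) i j \<in> carrier_mat (n - 1) (n - 1)" for x
    by (rule mat_delete_carrier[OF polmat_carrier[OF assms(1)]])
  fix k l assume kl: "k < n - 1" "l < n - 1"
  have "mat_delete (M x) i j $$ (k, l) = M x $$ (if k < i then k else Suc k, if l < j then l else Suc l)" for x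
    using kl polmat_carrier[OF assms(1), of x] by (simp add: mat_delete_def)
  then show "polyfun C (\<lambda>x. mat_delete (M x) i j $$ (k, l))"
    using kl by (simp only:) (intro polmat_entry[OF assms(1)]; auto)
qed

lemma polmat_adj:
  assumes "polmat C n M"
  shows "polmat C n (\<lambda>x. adj_mat (M x))"
  unfolding polmat_def
proof (intro conjI allI impI)
  show "adj_mat (M x) \<in> carrier_mat n n" for x
    by (rule adj_mat(1)[OF polmat_carrier[OF assms]])
  fix i j assume ij: "i < n" "j < n"
  have "adj_mat (M x) $$ (i, j) = (- 1) ^ (j + i) * det (mat_delete (M x) j i)" for x
    using ij polmat_carrier[OF assms, of x] by (simp add: adj_mat_def cofactor_def)
  then show "polyfun C (\<lambda>x. adj_mat (M x) $$ (i, j))"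
    using ij by (simp only:) (intro polyfun_mult polyfun_const polyfun_det[of _ "n - 1"] polmat_delete[OF assms])
qed

subsection \<open>Polynomial functions of one variable\<close>

lemma polyfun_id_poly:
  assumes "polyfun {\<lambda>t. t} f"
  shows "\<exists>p. \<forall>t. f t = poly p t"
proof -
  obtain N where "pol {\<lambda>t. t} N f"
    using assms unfolding polyfun_def by blast
  then show ?thesis
  proof (induction rule: pol.induct)
    case (const N c)
    show ?case by (rule exI[of _ "[:c:]"]) simp
  next
    case (coord f N)
    then show ?case by (intro exI[of _ "[:0, 1:]"]) simp
  next
    case (add N f g)
    then obtain p q where "\<forall>t. f t = poly p t" "\<forall>t. g t = poly q t" by blast
    then show ?case by (intro exI[of _ "p + q"]) simp
  next
    case (mult a f b g N)
    then obtain p q where "\<forall>t. f t = poly p t" "\<forall>t. g t = poly q t" by blast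
    then show ?case by (intro exI[of _ "p * q"]) simp
  qed
qed

lemma polyfun_id_finite_zeros:
  fixes f :: "'a::idom \<Rightarrow> 'a"
  assumes "polyfun {\<lambda>t. t} f" and "f t0 \<noteq> 0"
  shows "finite {t. f t = 0}"
proof -
  obtain p where p: "\<forall>t. f t = poly p t"
    using polyfun_id_poly[OF assms(1)] by blast
  then have "p \<noteq> 0"
    using assms(2) by auto
  then show ?thesis
    using poly_roots_finite[of p] p by simp
qed

lemma infinite_alg_closed: "infinite (UNIV :: 'a::alg_closed_field set)"
proof
  assume fin: "finite (UNIV :: 'a set)"
  let ?q = "\<Prod>a\<in>UNIV. [:- a, 1:] :: 'a poly"
  have "degree ?q = card (UNIV :: 'a set)"
    by (subst degree_prod_eq_sum_degree) auto
  moreover have "card (UNIV :: 'a set) > 0"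
    using fin by (simp add: card_gt_0_iff)
  ultimately have "degree (1 + ?q) > 0"
    by (subst degree_add_eq_right) auto
  then obtain x where "poly (1 + ?q) x = 0"
    using alg_closed_imp_poly_has_root by blast
  moreover have "poly ?q x = 0"
    using fin by (auto simp: poly_prod)
  ultimately show False
    by simp
qed

text \<open>
The form in which density of nonempty open sets is used: conditions that hold somewhere on a line hold
simultaneously at some point of it.
\<close>

lemma ex_common_nonzero:
  fixes fs :: "('a::alg_closed_field \<Rightarrow> 'a) set"
  assumes "finite fs" and "\<And>f. f \<in> fs \<Longrightarrow> polyfun {\<lambda>t. t} f" and "\<And>f. f \<in> fs \<Longrightarrow> \<exists>t. f t \<noteq> 0"
  shows "\<exists>t. \<forall>f\<in>fs. f t \<noteq> 0"
proof -
  have "finite (\<Union>f\<in>fs. {t. f t = 0})"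
    using assms polyfun_id_finite_zeros by (intro finite_UN_I) blast+
  then obtain t where "t \<notin> (\<Union>f\<in>fs. {t. f t = 0})"
    using ex_new_if_finite[OF infinite_alg_closed] by blast
  then show ?thesis by blast
qed

subsection \<open>Bounded degree\<close>

definition monomials :: "('p \<Rightarrow> 'a::comm_ring_1) set \<Rightarrow> nat \<Rightarrow> ('p \<Rightarrow> 'a) set" where
  "monomials C N = (\<lambda>e x. \<Prod>c\<in>C. c x ^ e c) ` (C \<rightarrow>\<^sub>E {..N})"

lemma finite_monomials: "finite C \<Longrightarrow> finite (monomials C N)"
  unfolding monomials_def by (intro finite_imageI finite_PiE) auto

lemma card_monomials:
  assumes "finite C"
  shows "card (monomials C N) \<le> (N + 1) ^ card C"
proof -
  have "card (monomials C N) \<le> card (C \<rightarrow>\<^sub>E {..N})"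
    unfolding monomials_def using assms by (intro card_image_le finite_PiE) auto
  also have "\<dots> = (N + 1) ^ card C"
    using assms by (simp add: card_PiE)
  finally show ?thesis .
qed

lemma monomials_mult:
  assumes "finite C" and "f \<in> monomials C a" and "g \<in> monomials C b" and "a + b \<le> N"
  shows "(\<lambda>x. f x * g x) \<in> monomials C N"
proof -
  obtain d e where d: "d \<in> C \<rightarrow>\<^sub>E {..a}" "f = (\<lambda>x. \<Prod>c\<in>C. c x ^ d c)"
    and e: "e \<in> C \<rightarrow>\<^sub>E {..b}" "g = (\<lambda>x. \<Prod>c\<in>C. c x ^ e c)"
    using assms unfolding monomials_def by blast
  have "d c + e c \<le> N" if "c \<in> C" for c
    using PiE_mem[OF d(1) that] PiE_mem[OF e(1) that] assms(4) by simp
  then have "restrict (\<lambda>c. d c + e c) C \<in> C \<rightarrow>\<^sub>E {..N}"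
    by auto
  moreover have "(\<lambda>x. f x * g x) = (\<lambda>x. \<Prod>c\<in>C. c x ^ restrict (\<lambda>c. d c + e c) C c)"
    by (auto simp: d(2) e(2) power_add prod.distrib fun_eq_iff intro!: prod.cong)
  ultimately show ?thesis
    unfolding monomials_def by blast
qed

text \<open>
Each exponent, rather than the total degree, is bounded by \<open>N\<close> in \<open>monomials C N\<close>; the count
\<open>(N + 1) ^ card C\<close> has the right order of growth all the same.
\<close>

lemma pol_in_span_monomials:
  fixes f :: "'p \<Rightarrow> 'a::field"
  assumes "finite C" and "pol C N f"
  shows "f \<in> fs.span (monomials C N)"
  using assms(2)
proof (induction rule: pol.induct)
  case (const N c)
  have "(\<lambda>x::'p. 1::'a) = (\<lambda>x. \<Prod>c\<in>C. c x ^ restrict (\<lambda>_. 0) C c)"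
    by (auto simp: fun_eq_iff)
  then have "(\<lambda>x. 1) \<in> monomials C N"
    unfolding monomials_def by (intro image_eqI[of _ _ "restrict (\<lambda>_. 0) C"]) auto
  then have "fscale c (\<lambda>x. 1) \<in> fs.span (monomials C N)"
    by (intro fs.span_scale fs.span_base)
  then show "(\<lambda>_. c) \<in> fs.span (monomials C N)"
    by (simp add: fscale_def)
next
  case (coord f N)
  let ?e = "restrict (\<lambda>c. if c = f then 1 else 0) C"
  have "f x = (\<Prod>c\<in>C. c x ^ ?e c)" for x
  proof -
    have "(\<Prod>c\<in>C. c x ^ ?e c) = (\<Prod>c\<in>C. if c = f then f x else 1)"
      by (intro prod.cong) auto
    then show ?thesis
      using coord assms(1) by simp
  qed
  then have "f \<in> monomials C N"
    unfolding monomials_def using coord by (intro image_eqI[of _ _ ?e]) auto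
  then show "f \<in> fs.span (monomials C N)"
    by (rule fs.span_base)
next
  case (add N f g)
  have "f + g \<in> fs.span (monomials C N)"
    by (rule fs.span_add[OF add.IH])
  then show "(\<lambda>x. f x + g x) \<in> fs.span (monomials C N)"
    by (simp add: plus_fun_def)
next
  case (mult a f b g N)
  have step: "(\<lambda>x. u x * g x) \<in> fs.span (monomials C N)" if u: "u \<in> monomials C a" for u
  proof -
    have "fs.subspace {g. (\<lambda>x. u x * g x) \<in> fs.span (monomials C N)}"
      unfolding fs.subspace_def
    proof (intro conjI ballI allI CollectI)
      show "(\<lambda>x. u x * 0 x) \<in> fs.span (monomials C N)"
        using fs.span_zero by (simp add: zero_fun_def)
      fix g h and c :: 'a
      assume "g \<in> {g. (\<lambda>x. u x * g x) \<in> fs.span (monomials C N)}"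
        and "h \<in> {g. (\<lambda>x. u x * g x) \<in> fs.span (monomials C N)}"
      then have "(\<lambda>x. u x * g x) + (\<lambda>x. u x * h x) \<in> fs.span (monomials C N)"
        by (intro fs.span_add) auto
      then show "(\<lambda>x. u x * (g + h) x) \<in> fs.span (monomials C N)"
        by (simp add: plus_fun_def algebra_simps)
    next
      fix g and c :: 'a
      assume "g \<in> {g. (\<lambda>x. u x * g x) \<in> fs.span (monomials C N)}"
      then have "fscale c (\<lambda>x. u x * g x) \<in> fs.span (monomials C N)"
        by (intro fs.span_scale) auto
      then show "(\<lambda>x. u x * fscale c g x) \<in> fs.span (monomials C N)"
        by (simp add: fscale_def algebra_simps)
    qed
    moreover have "monomials C b \<subseteq> {g. (\<lambda>x. u x * g x) \<in> fs.span (monomials C N)}"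
      using monomials_mult[OF assms(1) u _ mult.hyps(3)] fs.span_base by blast
    ultimately show ?thesis
      using fs.span_minimal mult.IH(2) by blast
  qed
  have "fs.subspace {f. (\<lambda>x. f x * g x) \<in> fs.span (monomials C N)}"
    unfolding fs.subspace_def
  proof (intro conjI ballI allI CollectI)
    show "(\<lambda>x. 0 x * g x) \<in> fs.span (monomials C N)"
      using fs.span_zero by (simp add: zero_fun_def)
    fix u h and c :: 'a
    assume "u \<in> {f. (\<lambda>x. f x * g x) \<in> fs.span (monomials C N)}"
      and "h \<in> {f. (\<lambda>x. f x * g x) \<in> fs.span (monomials C N)}"
    then have "(\<lambda>x. u x * g x) + (\<lambda>x. h x * g x) \<in> fs.span (monomials C N)"
      by (intro fs.span_add) auto
    then show "(\<lambda>x. (u + h) x * g x) \<in> fs.span (monomials C N)"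
      by (simp add: plus_fun_def algebra_simps)
  next
    fix u and c :: 'a
    assume "u \<in> {f. (\<lambda>x. f x * g x) \<in> fs.span (monomials C N)}"
    then have "fscale c (\<lambda>x. u x * g x) \<in> fs.span (monomials C N)"
      by (intro fs.span_scale) auto
    then show "(\<lambda>x. fscale c u x * g x) \<in> fs.span (monomials C N)"
      by (simp add: fscale_def algebra_simps)
  qed
  then show "(\<lambda>x. f x * g x) \<in> fs.span (monomials C N)"
    using fs.span_minimal[of "monomials C a" "{f. (\<lambda>x. f x * g x) \<in> fs.span (monomials C N)}"] step mult.IH(1)
    by blast
qed

text \<open>
If the functions \<open>c \<circ> \<psi>\<close> are polynomial after multiplication by a common denominator \<open>\<delta>\<close>, then
\<open>f \<circ> \<psi>\<close> is polynomial after multiplication by \<open>\<delta>\<^sup>N\<close>, where \<open>N\<close> bounds the degree of \<open>f\<close>. The new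
degree is linear in \<open>N\<close> with a factor \<open>k\<close> that is the same for all \<open>f\<close>, which the growth estimate needs.
\<close>

lemma pol_substitute:
  fixes \<psi> :: "'q \<Rightarrow> 'p" and \<delta> :: "'q \<Rightarrow> 'a::comm_ring_1"
  assumes fin: "finite C" and \<delta>: "polyfun D \<delta>"
    and C: "\<And>c. c \<in> C \<Longrightarrow> \<exists>g. polyfun D g \<and> (\<forall>q\<in>V. c (\<psi> q) * \<delta> q = g q)"
  shows "\<exists>k. \<forall>N f. pol C N f \<longrightarrow> (\<exists>g. pol D (k * N) g \<and> (\<forall>q\<in>V. f (\<psi> q) * \<delta> q ^ N = g q))"
proof -
  have "\<exists>k. (\<forall>c\<in>C. \<exists>g. pol D k g \<and> (\<forall>q\<in>V. c (\<psi> q) * \<delta> q = g q))"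
    using fin C
  proof (induction rule: finite_induct)
    case (insert c C)
    then obtain k where k: "\<forall>c\<in>C. \<exists>g. pol D k g \<and> (\<forall>q\<in>V. c (\<psi> q) * \<delta> q = g q)" by blast
    obtain g l where g: "pol D l g" "\<forall>q\<in>V. c (\<psi> q) * \<delta> q = g q"
      using insert.prems[of c] unfolding polyfun_def by blast
    show ?case
    proof (intro exI[of _ "max k l"] ballI)
      fix c' assume "c' \<in> insert c C"
      then consider "c' = c" | "c' \<in> C" by blast
      then show "\<exists>g. pol D (max k l) g \<and> (\<forall>q\<in>V. c' (\<psi> q) * \<delta> q = g q)"
      proof cases
        case 1
        then show ?thesis
          using g pol_mono[OF g(1), of "max k l"] by auto
      next
        case 2
        then obtain g' where "pol D k g'" "\<forall>q\<in>V. c' (\<psi> q) * \<delta> q = g' q"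
          using k by blast
        then show ?thesis
          using pol_mono[of D k g' "max k l"] by auto
      qed
    qed
  qed simp
  then obtain k1 where k1: "\<forall>c\<in>C. \<exists>g. pol D k1 g \<and> (\<forall>q\<in>V. c (\<psi> q) * \<delta> q = g q)" ..
  obtain k2 where k2: "pol D k2 \<delta>"
    using \<delta> unfolding polyfun_def by blast
  define k where "k = max k1 k2"
  have kC: "\<exists>g. pol D k g \<and> (\<forall>q\<in>V. c (\<psi> q) * \<delta> q = g q)" if "c \<in> C" for c
  proof -
    obtain g where g: "pol D k1 g" "\<forall>q\<in>V. c (\<psi> q) * \<delta> q = g q"
      using k1 \<open>c \<in> C\<close> by blast
    have "pol D k g"
      by (rule pol_mono[OF g(1)]) (simp add: k_def)
    then show ?thesis
      using g(2) by blast
  qed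
  have k\<delta>: "pol D (k * N) (\<lambda>q. \<delta> q ^ N)" for N
    using pol_power[OF pol_mono[OF k2, of k]] by (simp add: k_def)
  have "\<exists>g. pol D (k * N) g \<and> (\<forall>q\<in>V. f (\<psi> q) * \<delta> q ^ N = g q)" if "pol C N f" for N f
    using that
  proof (induction rule: pol.induct)
    case (const N c)
    show ?case
      using pol_scale[OF k\<delta>[of N], of c] by auto
  next
    case (coord f N)
    obtain g where g: "pol D k g" "\<forall>q\<in>V. f (\<psi> q) * \<delta> q = g q"
      using kC[OF coord(1)] by blast
    obtain N' where N': "N = Suc N'"
      using coord(2) by (cases N) auto
    have "pol D (k * N) (\<lambda>q. g q * \<delta> q ^ N')"
      by (rule pol.mult[OF g(1) k\<delta>[of N']]) (simp add: N')
    moreover have "\<forall>q\<in>V. f (\<psi> q) * \<delta> q ^ N = g q * \<delta> q ^ N'"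
      using g(2) by (simp add: N' mult.assoc[symmetric])
    ultimately show ?case by blast
  next
    case (add N f g)
    then obtain f' g' where "pol D (k * N) f'" "\<forall>q\<in>V. f (\<psi> q) * \<delta> q ^ N = f' q"
      and "pol D (k * N) g'" "\<forall>q\<in>V. g (\<psi> q) * \<delta> q ^ N = g' q"
      by blast
    then show ?case
      by (intro exI[of _ "\<lambda>q. f' q + g' q"]) (auto intro: pol.add simp: distrib_right)
  next
    case (mult a f b g N)
    then obtain f' g' where f': "pol D (k * a) f'" "\<forall>q\<in>V. f (\<psi> q) * \<delta> q ^ a = f' q"
      and g': "pol D (k * b) g'" "\<forall>q\<in>V. g (\<psi> q) * \<delta> q ^ b = g' q"
      by blast
    have "pol D (k * (a + b)) (\<lambda>q. f' q * g' q)"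
      by (rule pol.mult[OF f'(1) g'(1)]) (simp add: algebra_simps)
    then have "pol D (k * N) (\<lambda>q. f' q * g' q * \<delta> q ^ (N - (a + b)))"
      by (rule pol.mult[OF _ k\<delta>]) (use mult.hyps(3) in \<open>simp flip: add_mult_distrib2\<close>)
    moreover have "f (\<psi> q) * g (\<psi> q) * \<delta> q ^ N = f' q * g' q * \<delta> q ^ (N - (a + b))" if "q \<in> V" for q
    proof -
      have "\<delta> q ^ N = \<delta> q ^ a * \<delta> q ^ b * \<delta> q ^ (N - (a + b))"
        using mult.hyps(3) by (simp flip: power_add)
      then have "f (\<psi> q) * g (\<psi> q) * \<delta> q ^ N =
          (f (\<psi> q) * \<delta> q ^ a) * (g (\<psi> q) * \<delta> q ^ b) * \<delta> q ^ (N - (a + b))"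
        by (simp only: mult_ac)
      moreover have "f (\<psi> q) * \<delta> q ^ a = f' q" "g (\<psi> q) * \<delta> q ^ b = g' q"
        using f'(2) g'(2) that by blast+
      ultimately show ?thesis
        by (simp only:)
    qed
    ultimately show ?case by blast
  qed
  then show ?thesis by blast
qed

subsection \<open>The orbit map\<close>

text \<open>
The inverse is expressed by the adjugate, so that only the denominator \<open>det g\<close> appears.
\<close>

definition conj_by :: "'a::field mat \<Rightarrow> 'a mat list \<Rightarrow> 'a mat list" where
  "conj_by g A = map (\<lambda>X. (1 / det g) \<cdot>\<^sub>m (g * X * adj_mat g)) A"

lemma conj_by_intertwines:
  assumes g: "g \<in> carrier_mat n n" "det g \<noteq> 0" and A: "A \<in> mat_tuples m n" and s: "s < m"
  shows "g * A ! s = conj_by g A ! s * g"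
proof -
  note c = nth_mat_tuples[OF A s] adj_mat[OF g(1)]
  have "conj_by g A ! s * g = (1 / det g) \<cdot>\<^sub>m (g * A ! s * adj_mat g * g)"
    using A s c g by (simp add: conj_by_def mat_tuples_def mult_smult_assoc_mat[of _ n n _ n])
  also have "g * A ! s * adj_mat g * g = g * A ! s * (adj_mat g * g)"
    using c g by (intro assoc_mult_mat[of _ n n _ n _ n]) auto
  also have "\<dots> = det g \<cdot>\<^sub>m (g * A ! s)"
    using c g by (simp add: mult_smult_distrib[of _ n n _ n])
  finally show ?thesis
    using g(2) c g by (auto intro!: eq_matI)
qed

lemma conj_by_tuples: "g \<in> carrier_mat n n \<Longrightarrow> A \<in> mat_tuples m n \<Longrightarrow> conj_by g A \<in> mat_tuples m n"
  using adj_mat(1)[of g n] by (auto simp: mat_tuples_def conj_by_def)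

lemma conj_by_orbit:
  assumes "g \<in> carrier_mat n n" "det g \<noteq> 0" and "A \<in> mat_tuples m n"
  shows "conj_by g A \<in> conj_orbit n A"
  unfolding conj_orbit_iff[OF assms(3)]
  using conj_by_tuples conj_by_intertwines[OF assms] assms by blast

lemma conj_by_unique:
  assumes g: "g \<in> carrier_mat n n" "det g \<noteq> 0" and A: "A \<in> mat_tuples m n" and X: "X \<in> mat_tuples m n"
    and eq: "\<And>s. s < m \<Longrightarrow> g * A ! s = X ! s * g"
  shows "X = conj_by g A"
proof (rule nth_equalityI)
  show "length X = length (conj_by g A)"
    using A X by (simp add: mat_tuples_def conj_by_def)
  fix s assume "s < length X"
  then have s: "s < m"
    using X by (simp add: mat_tuples_def)
  obtain h where h: "h \<in> carrier_mat n n" "g * h = 1\<^sub>m n" "h * g = 1\<^sub>m n"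
    using det_nonzero_inverse[OF g] .
  have *: "Y = Y * g * h" if "Y \<in> carrier_mat n n" for Y
    using that g h by (simp add: assoc_mult_mat[of _ n n _ n _ n])
  have "X ! s * g = conj_by g A ! s * g"
    using eq[OF s] conj_by_intertwines[OF g A s] by simp
  then show "X ! s = conj_by g A ! s"
    using *[OF nth_mat_tuples[OF X s]] *[OF nth_mat_tuples[OF conj_by_tuples[OF g(1) A] s]] by simp
qed

lemma orbit_conj_by:
  assumes "A \<in> mat_tuples m n" and "X \<in> conj_orbit n A"
  obtains g where "g \<in> carrier_mat n n" "det g \<noteq> 0" "X = conj_by g A"
proof -
  obtain g where g: "g \<in> carrier_mat n n" "det g \<noteq> 0" "\<forall>s<m. g * A ! s = X ! s * g"
    and X: "X \<in> mat_tuples m n"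
    using assms(2) unfolding conj_orbit_iff[OF assms(1)] by blast
  have "X = conj_by g A"
    by (rule conj_by_unique[OF g(1,2) assms(1) X]) (use g(3) in blast)
  then show ?thesis
    using that[OF g(1,2)] by blast
qed

lemma conj_by_one: "A \<in> mat_tuples m n \<Longrightarrow> conj_by (1\<^sub>m n) A = A"
  by (rule sym, rule conj_by_unique[of _ n _ m]) (auto dest: nth_mat_tuples)

lemma orbit_pullback:
  fixes A :: "'a::field mat list" and G :: "'q \<Rightarrow> 'a mat"
  assumes A: "A \<in> mat_tuples m n" and G: "polmat D n G"
  shows "\<exists>k. \<forall>N f. pol (coordf m n) N f \<longrightarrow> (\<exists>h. pol D (k * N) h \<and>
    (\<forall>q. det (G q) \<noteq> 0 \<longrightarrow> f (conj_by (G q) A) * det (G q) ^ N = h q))"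
proof -
  let ?V = "{q. det (G q) \<noteq> 0}"
  have sub: "\<exists>g. polyfun D g \<and> (\<forall>q\<in>?V. c (conj_by (G q) A) * det (G q) = g q)" if c: "c \<in> coordf m n" for c
  proof -
    obtain s i j where sij: "s < m" "i < n" "j < n" "c = (\<lambda>A. A ! s $$ (i, j))"
      using c by (auto simp: coordf_def)
    have "polmat D n (\<lambda>q. G q * A ! s * adj_mat (G q))"
      by (intro polmat_mult polmat_adj G polmat_const nth_mat_tuples[OF A sij(1)])
    then have "polyfun D (\<lambda>q. (G q * A ! s * adj_mat (G q)) $$ (i, j))"
      using sij by (intro polmat_entry)
    moreover have "c (conj_by (G q) A) * det (G q) = (G q * A ! s * adj_mat (G q)) $$ (i, j)"
      if "q \<in> ?V" for q
      using that sij A polmat_carrier[OF G, of q] adj_mat(1)[OF polmat_carrier[OF G, of q]]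
      by (simp add: conj_by_def mat_tuples_def)
    ultimately show ?thesis by blast
  qed
  have "\<exists>k. \<forall>N f. pol (coordf m n) N f \<longrightarrow> (\<exists>g. pol D (k * N) g \<and>
    (\<forall>q\<in>?V. f (conj_by (G q) A) * det (G q) ^ N = g q))"
    by (rule pol_substitute[OF finite_coordf polyfun_det[OF G] sub])
  then show ?thesis
    by (simp only: mem_Collect_eq Ball_def)
qed

text \<open>
Where \<open>f\<close> does not vanish is, along a polynomial family \<open>G\<close> of matrices, again the nonvanishing of a
polynomial function of the parameter.
\<close>

lemma pullback_nonzero:
  fixes A :: "'a::field mat list"
  assumes A: "A \<in> mat_tuples m n" and G: "polmat C n G" and f: "polyfun (coordf m n) f"
    and t0: "det (G t0) \<noteq> 0" "f (conj_by (G t0) A) \<noteq> 0"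
  obtains h where "polyfun C h" "h t0 \<noteq> 0"
    "\<And>t. det (G t) \<noteq> 0 \<Longrightarrow> h t \<noteq> 0 \<Longrightarrow> f (conj_by (G t) A) \<noteq> 0"
proof -
  obtain N where N: "pol (coordf m n) N f"
    using f unfolding polyfun_def by blast
  obtain h where h: "polyfun C h"
    "\<forall>q. det (G q) \<noteq> 0 \<longrightarrow> f (conj_by (G q) A) * det (G q) ^ N = h q"
    using orbit_pullback[OF A G] N unfolding polyfun_def by blast
  have h': "f (conj_by (G q) A) * det (G q) ^ N = h q" if "det (G q) \<noteq> 0" for q
    using h(2) that by blast
  show ?thesis
  proof (rule that[OF h(1)])
    show "h t0 \<noteq> 0"
      unfolding h'[OF t0(1), symmetric] using t0 by simp
    show "f (conj_by (G t) A) \<noteq> 0" if "det (G t) \<noteq> 0" "h t \<noteq> 0" for t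
      using that(2) unfolding h'[OF that(1), symmetric] by auto
  qed
qed

section \<open>Dimension of orbits: the upper bound\<close>

lemma matf_scale: "matf n (fscale c f) = c \<cdot>\<^sub>m matf n f"
  by (rule eq_matI) (auto simp: matf_def)

lemma sum_lessThan_add: "(\<Sum>k<d + e. f k) = (\<Sum>k<d. f k) + (\<Sum>k<e. f (d + k))"
  for f :: "nat \<Rightarrow> 'b::comm_monoid_add"
  by (induction e) (simp_all add: add.assoc)

text \<open>
A basis \<open>b\<close> of \<open>supp I\<close> whose first members form a basis of \<open>H\<close>, together with its dual basis \<open>w\<close>. The
remaining members span a complement of \<open>H\<close>.
\<close>

lemma adapted_basis:
  fixes H :: "('b \<Rightarrow> 'a::field) set"
  assumes I: "finite I" and H: "H \<subseteq> supp I" "fs.subspace H"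
  obtains b w where "fs.dim H \<le> card I"
    and "\<And>k. k < card I \<Longrightarrow> b k \<in> supp I"
    and "\<And>k. k < fs.dim H \<Longrightarrow> b k \<in> H"
    and "\<And>j k. j < card I \<Longrightarrow> k < card I \<Longrightarrow> dot I (w j) (b k) = (if j = k then 1 else 0)"
    and "\<And>x. x \<in> supp I \<Longrightarrow> x = (\<Sum>k<card I. fscale (dot I (w k) x) (b k))"
    and "\<And>x k. x \<in> H \<Longrightarrow> fs.dim H \<le> k \<Longrightarrow> k < card I \<Longrightarrow> dot I (w k) x = 0"
proof -
  let ?d = "fs.dim H" and ?N = "card I"
  obtain B0 where B0: "finite B0" "B0 \<subseteq> H" "fs.independent B0" "H \<subseteq> fs.span B0" "card B0 = ?d"
    using supp_basis[OF I H(1) I] .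
  obtain B where B: "B0 \<subseteq> B" "B \<subseteq> supp I" "fs.independent B" "supp I \<subseteq> fs.span B"
    using fs.maximal_independent_subset_extend[of B0 "supp I"] B0 H by blast
  have cB: "card B = ?N"
    by (rule trans[OF fs.basis_card_eq_dim[OF B(2,4,3)] dim_supp[OF I]])
  have finB: "finite B"
    using fs.independent_span_bound[OF finite_unitf[OF I] B(3)] subset_span_unitf[OF B(2) I] by blast
  have dN: "?d \<le> ?N"
    using card_mono[OF finB B(1)] B0(5) cB by simp
  obtain h0 where h0: "bij_betw h0 {0..<?d} B0"
    using ex_bij_betw_nat_finite[OF B0(1)] B0(5) by auto
  have "card (B - B0) = ?N - ?d"
    using card_Diff_subset[OF B0(1) B(1)] cB B0(5) by simp
  then obtain h1 where h1: "bij_betw h1 {0..<?N - ?d} (B - B0)"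
    using ex_bij_betw_nat_finite[of "B - B0"] finB by auto
  define b where "b k = (if k < ?d then h0 k else h1 (k - ?d))" for k
  have b0: "b k \<in> B0" if "k < ?d" for k
    using that bij_betwE[OF h0] by (simp add: b_def)
  have b1: "b k \<in> B - B0" if "?d \<le> k" "k < ?N" for k
    using that bij_betwE[OF h1] by (simp add: b_def)
  have bB: "b k \<in> B" if "k < ?N" for k
    using that b0[of k] b1[of k] B(1) by (cases "k < ?d") auto
  have inj: "inj_on b {..<?N}"
  proof (rule inj_onI)
    fix j k assume jk: "j \<in> {..<?N}" "k \<in> {..<?N}" "b j = b k"
    show "j = k"
    proof (cases "j < ?d")
      case j: True
      show ?thesis
      proof (cases "k < ?d")
        case True
        then have "h0 j = h0 k"
          using jk(3) j by (simp add: b_def)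
        then show ?thesis
          by (rule inj_onD[OF bij_betw_imp_inj_on[OF h0]]) (use j True in simp_all)
      next
        case False
        then have "b k \<notin> B0"
          using b1[of k] jk(2) by simp
        then show ?thesis
          using b0[OF j] jk(3) by simp
      qed
    next
      case j: False
      show ?thesis
      proof (cases "k < ?d")
        case True
        have "b j \<notin> B0"
          using b1[of j] j jk(1) by simp
        then show ?thesis
          using b0[OF True] jk(3) by simp
      next
        case False
        then have "h1 (j - ?d) = h1 (k - ?d)"
          using jk(3) j by (simp add: b_def)
        then have "j - ?d = k - ?d"
          by (rule inj_onD[OF bij_betw_imp_inj_on[OF h1]]) (use jk j False in auto)
        then show ?thesis
          using j False by linarith
      qed
    qed
  qed
  have img: "b ` {..<?N} = B"
    using bB inj cB finB by (intro card_subset_eq) (auto simp: card_image)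
  obtain w0 where w0: "\<And>u v. u \<in> B \<Longrightarrow> v \<in> B \<Longrightarrow> dot I (w0 u) v = (if u = v then 1 else 0)"
    by (rule dual_basis[OF I B(2,3)]) (rule that)
  define w where "w k = w0 (b k)" for k
  have dual: "dot I (w j) (b k) = (if j = k then 1 else 0)" if "j < ?N" "k < ?N" for j k
    unfolding w_def using that w0[OF bB[OF that(1)] bB[OF that(2)]] inj_on_eq_iff[OF inj, of j k] by simp
  define pr where "pr x = (\<Sum>k<?N. fscale (dot I (w k) x) (b k))" for x
  have pr_add: "pr (x + y) = pr x + pr y" for x y
    by (simp add: pr_def dot_add_right fs.scale_left_distrib sum.distrib)
  have pr_scale: "pr (fscale c x) = fscale c (pr x)" for c x
    by (simp add: pr_def dot_scale_right fs.scale_sum_right)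
  have lin: "Vector_Spaces.linear fscale fscale (\<lambda>x. x - (\<Sum>k<?N. fscale (dot I (w k) x) (b k)))"
    unfolding pr_def[symmetric]
    by (rule linear_fscaleI)
      (simp_all only: pr_add pr_scale fs.scale_right_diff_distrib add_diff_add)
  have "b j - (\<Sum>k<?N. fscale (dot I (w k) (b j)) (b k)) = 0" if j: "j < ?N" for j
  proof -
    have "(\<Sum>k<?N. fscale (dot I (w k) (b j)) (b k)) = (\<Sum>k<?N. if k = j then b k else 0)"
      using j by (intro sum.cong) (auto simp: dual)
    then show ?thesis
      using j by simp
  qed
  then have z: "v - (\<Sum>k<?N. fscale (dot I (w k) v) (b k)) = 0" if "v \<in> B" for v
  proof -
    have "v \<in> b ` {..<?N}"
      using that by (simp only: img)
    then obtain j where "j < ?N" "v = b j"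
      by (auto elim: imageE)
    then show ?thesis
      using \<open>\<And>j. j < ?N \<Longrightarrow> b j - (\<Sum>k<?N. fscale (dot I (w k) (b j)) (b k)) = 0\<close> by (simp only:)
  qed
  have expand: "x = (\<Sum>k<?N. fscale (dot I (w k) x) (b k))" if "x \<in> supp I" for x
  proof -
    have "x - (\<Sum>k<?N. fscale (dot I (w k) x) (b k)) = 0"
      by (rule fsp.linear_eq_0_on_span[OF lin z]) (use that B(4) in blast)+
    then show ?thesis
      by (simp only: right_minus_eq)
  qed
  have kill: "dot I (w k) x = 0" if x: "x \<in> H" and k: "?d \<le> k" "k < ?N" for x k
  proof -
    have "B0 \<subseteq> {x. dot I (w k) x = 0}"
    proof
      fix v assume v: "v \<in> B0"
      then have "b k \<noteq> v" "v \<in> B"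
        using b1[OF k] B(1) by blast+
      then show "v \<in> {x. dot I (w k) x = 0}"
        using w0[OF bB[OF k(2)], of v] by (simp add: w_def)
    qed
    moreover have "fs.subspace {x. dot I (w k) x = 0}"
      by (auto simp: fs.subspace_def dot_add_right dot_scale_right)
    ultimately show ?thesis
      using subsetD[OF fs.span_minimal[of B0 "{x. dot I (w k) x = 0}"] subsetD[OF B0(4) x]] by simp
  qed
  show ?thesis
  proof (rule that[of b w])
    show "b k \<in> supp I" if "k < ?N" for k
      using bB[OF that] B(2) by blast
    show "b k \<in> H" if "k < ?d" for k
      using b0[OF that] B0(2) by blast
    show "?d \<le> ?N" by (rule dN)
    show "dot I (w j) (b k) = (if j = k then 1 else 0)" if "j < ?N" "k < ?N" for j k
      by (rule dual[OF that])
    show "x = (\<Sum>k<?N. fscale (dot I (w k) x) (b k))" if "x \<in> supp I" for x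
      by (rule expand[OF that])
    show "dot I (w k) x = 0" if "x \<in> H" "?d \<le> k" "k < ?N" for x k
      by (rule kill[OF that])
  qed
qed

lemma family_dependent:
  fixes h :: "nat \<Rightarrow> 'p \<Rightarrow> 'a::field"
  assumes S: "finite S" and h: "\<And>t. t < k \<Longrightarrow> h t \<in> fs.span S" and k: "card S < k"
  obtains a t0 where "t0 < k" "a t0 \<noteq> 0" "(\<Sum>t<k. fscale (a t) (h t)) = 0"
proof (cases "inj_on h {..<k}")
  case True
  have "fs.dependent (h ` {..<k})"
  proof (rule ccontr)
    assume "fs.independent (h ` {..<k})"
    from fs.independent_span_bound[OF S this] h have "card (h ` {..<k}) \<le> card S" by blast
    then show False
      using k True by (simp add: card_image)
  qed
  then obtain u v where u: "v \<in> h ` {..<k}" "u v \<noteq> 0" "(\<Sum>v\<in>h ` {..<k}. fscale (u v) v) = 0"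
    using fs.dependent_finite[of "h ` {..<k}"] by auto
  obtain t0 where "t0 < k" "v = h t0"
    using u(1) by blast
  moreover have "(\<Sum>t<k. fscale (u (h t)) (h t)) = 0"
    using u(3) by (simp add: sum.reindex[OF True])
  ultimately show ?thesis
    using that[of t0 "\<lambda>t. u (h t)"] u(2) by blast
next
  case False
  then obtain i j where ij: "i < k" "j < k" "i \<noteq> j" "h i = h j"
    by (auto simp: inj_on_def)
  let ?a = "\<lambda>t. if t = i then 1 else if t = j then - 1 else 0"
  have "(\<Sum>t<k. fscale (?a t) (h t)) = (\<Sum>t\<in>{i, j}. fscale (?a t) (h t))"
    using ij by (intro sum.mono_neutral_right) auto
  also have "\<dots> = 0"
    using ij by simp
  finally show ?thesis
    using that[of i ?a] ij(1) by simp
qed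

text \<open>
Linear independence of \<open>F 0, \<dots>, F (k - 1)\<close> modulo the functions that vanish on \<open>Z\<close>.
\<close>

definition indep_on :: "'p set \<Rightarrow> (nat \<Rightarrow> 'p \<Rightarrow> 'a::field) \<Rightarrow> nat \<Rightarrow> bool" where
  "indep_on Z F k \<longleftrightarrow> (\<forall>a. (\<forall>x\<in>Z. (\<Sum>t<k. a t * F t x) = 0) \<longrightarrow> (\<forall>t<k. a t = 0))"

subsection \<open>A slice that parametrises the orbit\<close>

definition slice :: "nat \<Rightarrow> nat \<Rightarrow> (nat \<Rightarrow> 'a fmat) \<Rightarrow> (nat \<Rightarrow> 'a) \<Rightarrow> 'a::field mat" where
  "slice n D l y = matf n (idf n + (\<Sum>k<D. fscale (y k) (l k)))"

lemma slice_entry: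
  assumes "i < n" "j < n"
  shows "slice n D l y $$ (i, j) = (if i = j then 1 else 0) + (\<Sum>k<D. y k * l k (i, j))"
  using assms by (simp add: slice_def matf_def idf_def sum_fun_apply)

lemma polmat_slice: "polmat ((\<lambda>k y. y k) ` {..<D}) n (slice n D l)"
  unfolding polmat_def
proof (intro conjI allI impI)
  show "slice n D l y \<in> carrier_mat n n" for y
    by (simp add: slice_def)
  fix i j assume ij: "i < n" "j < n"
  show "polyfun ((\<lambda>k y. y k) ` {..<D}) (\<lambda>y. slice n D l y $$ (i, j))"
    unfolding slice_entry[OF ij]
    by (intro polyfun_add polyfun_const polyfun_sum polyfun_mult polyfun_coord) auto
qed

definition line :: "nat \<Rightarrow> 'a mat \<Rightarrow> 'a mat \<Rightarrow> 'a \<Rightarrow> 'a::comm_ring_1 mat" where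
  "line n P Q t = mat n n (\<lambda>(i, j). P $$ (i, j) + t * (Q $$ (i, j) - P $$ (i, j)))"

lemma line_ends:
  assumes "P \<in> carrier_mat n n" and "Q \<in> carrier_mat n n"
  shows "line n P Q 0 = P" and "line n P Q 1 = Q"
  using assms by (auto simp: line_def intro!: eq_matI)

lemma polmat_line: "polmat {\<lambda>t. t} n (line n P Q)"
  unfolding polmat_def
proof (intro conjI allI impI)
  fix i j assume ij: "i < n" "j < n"
  have "polyfun {\<lambda>t. t} (\<lambda>t. P $$ (i, j) + t * (Q $$ (i, j) - P $$ (i, j)))"
    by (intro polyfun_add polyfun_const polyfun_mult polyfun_coord) auto
  then show "polyfun {\<lambda>t. t} (\<lambda>t. line n P Q t $$ (i, j))"
    using ij by (simp add: line_def)
qed (simp add: line_def)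

text \<open>
Suppose that \<open>f\<close> vanishes on the image of the slice but not at \<open>X = g\<^sub>0 A g\<^sub>0\<^sup>-\<^sup>1\<close>, and join \<open>1\<close> to \<open>g\<^sub>0\<close> by
a line \<open>g t\<close>. To move \<open>g t\<close> into the slice one needs \<open>S\<close> in \<open>Hom(A, A)\<close> such that \<open>g t S\<close> and \<open>1\<close> have
the same component in \<open>Hom(A, A)\<close>. That is a square linear system for \<open>S\<close> with matrix \<open>T t\<close>, and
\<open>T 0 = 1\<close>. Clearing the denominator by the adjugate of \<open>T t\<close> makes \<open>S\<close> polynomial in \<open>t\<close> with \<open>S 0 = 1\<close>.
So for some \<open>t\<close> all of \<open>g t\<close>, \<open>T t\<close>, \<open>S t\<close> are invertible and \<open>f\<close> does not vanish at the conjugate of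
\<open>A\<close> by \<open>g t\<close>. Since \<open>S t\<close> commutes with \<open>A\<close>, that conjugate also comes from the slice, a contradiction.
\<close>

lemma slice_dominant:
  fixes A :: "'a::alg_closed_field mat list" and n :: nat
  defines "I \<equiv> {..<n} \<times> {..<n}"
  assumes A: "A \<in> mat_tuples m n"
    and d: "d \<le> card I" "\<And>k. k < d \<Longrightarrow> b k \<in> homs m n A A"
    and dual: "\<And>j k. j < card I \<Longrightarrow> k < card I \<Longrightarrow> dot I (w j) (b k) = (if j = k then 1 else 0)"
    and expand: "\<And>x. x \<in> supp I \<Longrightarrow> x = (\<Sum>k<card I. fscale (dot I (w k) x) (b k))"
    and kill: "\<And>x k. x \<in> homs m n A A \<Longrightarrow> d \<le> k \<Longrightarrow> k < card I \<Longrightarrow> dot I (w k) x = 0"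
    and f: "polyfun (coordf m n) f"
    and van: "\<And>y. det (slice n (card I - d) (\<lambda>k. b (d + k)) y) \<noteq> 0 \<Longrightarrow>
      f (conj_by (slice n (card I - d) (\<lambda>k. b (d + k)) y) A) = 0"
    and X: "X \<in> conj_orbit n A"
  shows "f X = 0"
proof (rule ccontr)
  assume fX: "f X \<noteq> 0"
  let ?N = "card I"
  have sI: "supp I = fmats n"
    by (simp add: fmats_def I_def)
  obtain g0 where g0: "g0 \<in> carrier_mat n n" "det g0 \<noteq> 0" "X = conj_by g0 A"
    using orbit_conj_by[OF A X] .
  define g where "g = line n (1\<^sub>m n) g0"
  have g: "polmat {\<lambda>t. t} n g"
    unfolding g_def by (rule polmat_line)
  have gc: "g t \<in> carrier_mat n n" for t
    by (rule polmat_carrier[OF g])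
  have g01: "g 0 = 1\<^sub>m n" "g 1 = g0"
    unfolding g_def by (rule line_ends; use g0 in simp)+
  \<comment> \<open>split a matrix \<open>x\<close> into its part commuting with \<open>A\<close> and its part in the slice directions\<close>
  have split: "x = (\<Sum>k<d. fscale (dot I (w k) x) (b k)) + (\<Sum>k<?N - d. fscale (dot I (w (d + k)) x) (b (d + k)))"
    if "x \<in> fmats n" for x
  proof -
    have "x = (\<Sum>k<?N. fscale (dot I (w k) x) (b k))"
      by (rule expand) (use that sI in blast)
    also have "\<dots> = (\<Sum>k<d + (?N - d). fscale (dot I (w k) x) (b k))"
      using d(1) by simp
    also have "\<dots> = (\<Sum>k<d. fscale (dot I (w k) x) (b k)) + (\<Sum>k<?N - d. fscale (dot I (w (d + k)) x) (b (d + k)))"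
      by (rule sum_lessThan_add)
    finally show ?thesis .
  qed
  have one: "(\<Sum>k<d. fscale (dot I (w k) (idf n)) (b k)) = idf n"
  proof -
    have "(\<Sum>k<?N - d. fscale (dot I (w (d + k)) (idf n)) (b (d + k))) = 0"
      using kill[OF idf_homs] by (intro sum.neutral ballI) simp
    then have "(\<Sum>k<d. fscale (dot I (w k) (idf n)) (b k)) = (\<Sum>k<d. fscale (dot I (w k) (idf n)) (b k)) +
        (\<Sum>k<?N - d. fscale (dot I (w (d + k)) (idf n)) (b (d + k)))"
      by (simp only: add_0_right)
    also have "\<dots> = idf n"
      by (rule split[OF idf_fmats, symmetric])
    finally show ?thesis .
  qed
  define T where "T t = mat d d (\<lambda>(j, k). dot I (w j) (mm n (fmat n (g t)) (b k)))" for t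
  have T: "polmat {\<lambda>t. t} d T"
    unfolding polmat_def
  proof (intro conjI allI impI)
    fix j k assume jk: "j < d" "k < d"
    have "polyfun {\<lambda>t. t} (\<lambda>t. \<Sum>ij\<in>I. w j ij * (\<Sum>x<n. g t $$ (fst ij, x) * b k (x, snd ij)))"
      by (intro polyfun_sum polyfun_mult polyfun_const polmat_entry[OF g]) (auto simp: I_def)
    moreover have "T t $$ (j, k) = (\<Sum>ij\<in>I. w j ij * (\<Sum>x<n. g t $$ (fst ij, x) * b k (x, snd ij)))" for t
      using jk by (auto simp: T_def dot_def mm_def fmat_def I_def intro!: sum.cong)
    ultimately show "polyfun {\<lambda>t. t} (\<lambda>t. T t $$ (j, k))"
      by (simp only:)
  qed (simp add: T_def)
  have Tc: "T t \<in> carrier_mat d d" for t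
    by (rule polmat_carrier[OF T])
  define c where "c t k = (\<Sum>j<d. adj_mat (T t) $$ (k, j) * dot I (w j) (idf n))" for t k
  define S where "S t = (\<Sum>k<d. fscale (c t k) (b k))" for t
  have S: "S t \<in> homs m n A A" for t
    unfolding S_def by (intro fs.subspace_sum[OF subspace_homs] fs.subspace_scale[OF subspace_homs] d(2)) simp
  have Sm: "polmat {\<lambda>t. t} n (\<lambda>t. matf n (S t))"
    unfolding polmat_def
  proof (intro conjI allI impI)
    fix i j assume ij: "i < n" "j < n"
    have "polyfun {\<lambda>t. t} (\<lambda>t. \<Sum>k<d. c t k * b k (i, j))"
      unfolding c_def
      by (intro polyfun_sum polyfun_mult polyfun_const polmat_entry[OF polmat_adj[OF T]]) auto
    then show "polyfun {\<lambda>t. t} (\<lambda>t. matf n (S t) $$ (i, j))"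
      using ij by (simp add: matf_def S_def sum_fun_apply)
  qed simp
  have T0: "T 0 = 1\<^sub>m d"
  proof (rule eq_matI)
    fix j k assume "j < dim_row (1\<^sub>m d)" "k < dim_col (1\<^sub>m d)"
    then have jk: "j < d" "k < d" by simp_all
    have "mm n (fmat n (g 0)) (b k) = b k"
      unfolding g01 fmat_one by (rule mm_id_left[OF homs_fmats[OF d(2)[OF jk(2)]]])
    then show "T 0 $$ (j, k) = 1\<^sub>m d $$ (j, k)"
      using jk dual[of j k] d(1) by (simp add: T_def)
  qed (simp_all add: T_def)
  have "1\<^sub>m d * adj_mat (1\<^sub>m d) = det (1\<^sub>m d) \<cdot>\<^sub>m (1\<^sub>m d :: 'a mat)"
    by (rule adj_mat(2)) simp
  then have "adj_mat (1\<^sub>m d) = (1\<^sub>m d :: 'a mat)"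
    using adj_mat(1)[of "1\<^sub>m d :: 'a mat" d] by (auto intro!: eq_matI)
  then have "c 0 k = dot I (w k) (idf n)" if "k < d" for k
    using that by (simp add: c_def T0 if_one_mult)
  then have S0: "S 0 = idf n"
  proof -
    have "S 0 = (\<Sum>k<d. fscale (dot I (w k) (idf n)) (b k))"
      unfolding S_def using \<open>\<And>k. k < d \<Longrightarrow> c 0 k = dot I (w k) (idf n)\<close> by (intro sum.cong refl) simp
    then show ?thesis
      by (simp only: one)
  qed
  have "det (g 1) \<noteq> 0" "f (conj_by (g 1) A) \<noteq> 0"
    unfolding g01 using g0 fX by simp_all
  then obtain h where h: "polyfun {\<lambda>t. t} h" "h 1 \<noteq> 0"
    "\<And>t. det (g t) \<noteq> 0 \<Longrightarrow> h t \<noteq> 0 \<Longrightarrow> f (conj_by (g t) A) \<noteq> 0"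
    by (rule pullback_nonzero[OF A g f]) (rule that)
  let ?fs = "{\<lambda>t. det (g t), \<lambda>t. det (T t), \<lambda>t. det (matf n (S t)), h}"
  have "det (g 0) \<noteq> 0" "det (T 0) \<noteq> 0"
    by (simp_all add: g01 T0)
  moreover have "det (matf n (S 0)) \<noteq> 0"
    using matf_fmat[of "1\<^sub>m n :: 'a mat" n] by (simp add: S0 fmat_one)
  ultimately have "\<exists>t. \<forall>f\<in>?fs. f t \<noteq> 0"
    using polyfun_det[OF g] polyfun_det[OF T] polyfun_det[OF Sm] h(1,2)
    by (intro ex_common_nonzero) auto
  then obtain t where t: "det (g t) \<noteq> 0" "det (T t) \<noteq> 0" "det (matf n (S t)) \<noteq> 0" "h t \<noteq> 0"
    by auto
  let ?X = "conj_by (g t) A"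
  have Xt: "?X \<in> mat_tuples m n"
    by (rule conj_by_tuples[OF gc A])
  have "f ?X \<noteq> 0"
    by (rule h(3)[OF t(1,4)])
  define z where "z = fscale (1 / det (T t)) (mm n (fmat n (g t)) (S t))"
  have gh: "fmat n (g t) \<in> homs m n A ?X"
    using homs_mat_iff[OF gc A Xt] conj_by_intertwines[OF gc t(1) A] by blast
  have zh: "z \<in> homs m n A ?X"
    unfolding z_def by (intro fs.subspace_scale[OF subspace_homs] mm_homs[OF S gh])
  have zm: "matf n z = (1 / det (T t)) \<cdot>\<^sub>m (g t * matf n (S t))"
  proof -
    have "fmat n (g t * matf n (S t)) = mm n (fmat n (g t)) (S t)"
      unfolding fmat_mult[OF gc matf_carrier] fmat_matf[OF homs_fmats[OF S]] ..
    moreover have "matf n (fmat n (g t * matf n (S t))) = g t * matf n (S t)"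
      by (rule matf_fmat[OF mult_carrier_mat[OF gc matf_carrier]])
    ultimately have "matf n (mm n (fmat n (g t)) (S t)) = g t * matf n (S t)"
      by (simp only:)
    then show ?thesis
      unfolding z_def matf_scale by (simp only:)
  qed
  have detz: "det (matf n z) \<noteq> 0"
    using t det_mult[OF gc matf_carrier] by (simp add: zm det_smult)
  have wz: "dot I (w j) z = dot I (w j) (idf n)" if j: "j < d" for j
  proof -
    have "dot I (w j) (mm n (fmat n (g t)) (S t)) = (\<Sum>k<d. c t k * T t $$ (j, k))"
      using j by (simp add: S_def mm_sum_right mm_scale_right dot_sum_right dot_scale_right T_def)
    also have "\<dots> = (\<Sum>k<d. \<Sum>i<d. T t $$ (j, k) * adj_mat (T t) $$ (k, i) * dot I (w i) (idf n))"
      by (simp add: c_def sum_distrib_left sum_distrib_right mult_ac)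
    also have "\<dots> = (\<Sum>i<d. (\<Sum>k<d. T t $$ (j, k) * adj_mat (T t) $$ (k, i)) * dot I (w i) (idf n))"
      by (subst sum.swap) (simp add: sum_distrib_right)
    also have "\<dots> = (\<Sum>i<d. (T t * adj_mat (T t)) $$ (j, i) * dot I (w i) (idf n))"
      using j Tc[of t] adj_mat(1)[OF Tc[of t]]
      by (intro sum.cong) (auto simp: scalar_prod_def atLeast0LessThan)
    also have "\<dots> = (\<Sum>i<d. if i = j then det (T t) * dot I (w i) (idf n) else 0)"
      unfolding adj_mat(2)[OF Tc] using j by (intro sum.cong) auto
    finally show ?thesis
      using j t(2) by (simp add: z_def dot_scale_right)
  qed
  define y where "y k = dot I (w (d + k)) z" for k
  have "(\<Sum>k<d. fscale (dot I (w k) z) (b k)) = (\<Sum>k<d. fscale (dot I (w k) (idf n)) (b k))"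
    by (intro sum.cong refl) (simp add: wz)
  then have "(\<Sum>k<d. fscale (dot I (w k) z) (b k)) = idf n"
    by (simp only: one)
  moreover have "z = (\<Sum>k<d. fscale (dot I (w k) z) (b k)) + (\<Sum>k<?N - d. fscale (y k) (b (d + k)))"
    unfolding y_def by (rule split[OF homs_fmats[OF zh]])
  ultimately have "z = idf n + (\<Sum>k<?N - d. fscale (y k) (b (d + k)))"
    by (simp only:)
  then have zs: "matf n z = slice n (?N - d) (\<lambda>k. b (d + k)) y"
    by (simp add: slice_def)
  have "\<And>s. s < m \<Longrightarrow> matf n z * A ! s = ?X ! s * matf n z"
    using homs_mat_iff[OF matf_carrier A Xt, of z] fmat_matf[OF homs_fmats[OF zh]] zh by simp
  then have "?X = conj_by (matf n z) A"
    by (rule conj_by_unique[OF matf_carrier detz A Xt])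
  then have "f ?X = 0"
    using van[of y] detz unfolding zs by simp
  then show False
    using \<open>f ?X \<noteq> 0\<close> by blast
qed

subsection \<open>Growth of the number of independent functions\<close>

text \<open>
A linear relation between the pullbacks to the slice, cleared of the denominator \<open>det ^ N\<close>, is a relation
between the functions on the image of the slice, hence on the orbit. The pullbacks lie in the span of
\<open>(c N + 1) ^ (n\<^sup>2 - [A, A])\<close> monomials.
\<close>

lemma orbit_functions_bound:
  fixes A :: "'a::alg_closed_field mat list"
  assumes A: "A \<in> mat_tuples m n"
  shows "\<exists>c. \<forall>N k F. (\<forall>t<k. pol (coordf m n) N (F t)) \<longrightarrow> indep_on (conj_orbit n A) F k \<longrightarrow>
    k \<le> (c * N + 1) ^ (n * n - fs.dim (homs m n A A))"
proof -
  define I where "I = {..<n} \<times> {..<n}"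
  let ?d = "fs.dim (homs m n A A)"
  have I: "finite I" "card I = n * n"
    by (simp_all add: I_def)
  have sub: "homs m n A A \<subseteq> supp I"
    unfolding I_def by (rule subset_fmats_supp[OF homs_subset_fmats])
  obtain b w where d: "?d \<le> card I"
    and b: "\<And>k. k < card I \<Longrightarrow> b k \<in> supp I" "\<And>k. k < ?d \<Longrightarrow> b k \<in> homs m n A A"
    and dual: "\<And>j k. j < card I \<Longrightarrow> k < card I \<Longrightarrow> dot I (w j) (b k) = (if j = k then 1 else 0)"
    and expand: "\<And>x. x \<in> supp I \<Longrightarrow> x = (\<Sum>k<card I. fscale (dot I (w k) x) (b k))"
    and kill: "\<And>x k. x \<in> homs m n A A \<Longrightarrow> ?d \<le> k \<Longrightarrow> k < card I \<Longrightarrow> dot I (w k) x = 0"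
    by (rule adapted_basis[OF I(1) sub subspace_homs]) (rule that)
  let ?D = "card I - ?d"
  define Y :: "((nat \<Rightarrow> 'a) \<Rightarrow> 'a) set" where "Y = (\<lambda>k y. y k) ` {..<?D}"
  define G where "G = slice n ?D (\<lambda>k. b (?d + k))"
  have G: "polmat Y n G"
    unfolding Y_def G_def by (rule polmat_slice)
  have Y: "finite Y" "card Y \<le> ?D"
    unfolding Y_def using card_image_le[of "{..<?D}"] by auto
  obtain c where c: "\<forall>N f. pol (coordf m n) N f \<longrightarrow> (\<exists>h. pol Y (c * N) h \<and>
    (\<forall>q. det (G q) \<noteq> 0 \<longrightarrow> f (conj_by (G q) A) * det (G q) ^ N = h q))"
    using orbit_pullback[OF A G] by blast
  have "k \<le> (c * N + 1) ^ ?D"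
    if F: "\<forall>t<k. pol (coordf m n) N (F t)" and ind: "indep_on (conj_orbit n A) F k" for N k F
  proof (rule ccontr)
    assume k: "\<not> k \<le> (c * N + 1) ^ ?D"
    have "\<forall>t. \<exists>h. t < k \<longrightarrow> pol Y (c * N) h \<and>
        (\<forall>q. det (G q) \<noteq> 0 \<longrightarrow> F t (conj_by (G q) A) * det (G q) ^ N = h q)"
      using c F by blast
    from choice[OF this] obtain h where h0: "\<forall>t. t < k \<longrightarrow> pol Y (c * N) (h t) \<and>
        (\<forall>q. det (G q) \<noteq> 0 \<longrightarrow> F t (conj_by (G q) A) * det (G q) ^ N = h t q)" ..
    then have h: "\<And>t. t < k \<Longrightarrow> pol Y (c * N) (h t)"
      "\<And>t q. t < k \<Longrightarrow> det (G q) \<noteq> 0 \<Longrightarrow> F t (conj_by (G q) A) * det (G q) ^ N = h t q"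
      by simp_all
    have "card (monomials Y (c * N)) \<le> (c * N + 1) ^ card Y"
      by (rule card_monomials[OF Y(1)])
    also have "\<dots> \<le> (c * N + 1) ^ ?D"
      by (rule power_increasing[OF Y(2)]) simp
    finally have lt: "card (monomials Y (c * N)) < k"
      using k by linarith
    have hs: "h t \<in> fs.span (monomials Y (c * N))" if "t < k" for t
      by (rule pol_in_span_monomials[OF Y(1) h(1)[OF that]])
    obtain a t0 where a: "t0 < k" "a t0 \<noteq> 0" "(\<Sum>t<k. fscale (a t) (h t)) = 0"
      by (rule family_dependent[OF finite_monomials[OF Y(1)] _ lt, of h]) (erule hs, rule that)
    define f where "f = (\<lambda>X. \<Sum>t<k. a t * F t X)"
    have "f (conj_by (G y) A) = 0" if y: "det (G y) \<noteq> 0" for y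
    proof -
      have "f (conj_by (G y) A) * det (G y) ^ N = (\<Sum>t<k. a t * (F t (conj_by (G y) A) * det (G y) ^ N))"
        by (simp add: f_def sum_distrib_right mult.assoc)
      also have "\<dots> = (\<Sum>t<k. a t * h t y)"
        using h(2) y by (intro sum.cong) auto
      also have "\<dots> = 0"
        using fun_cong[OF a(3), of y] by (simp add: sum_fun_apply)
      finally show ?thesis
        using y by simp
    qed
    note van = this[unfolded G_def]
    have fx: "polyfun (coordf m n) f"
      unfolding f_def
    proof (intro polyfun_sum polyfun_mult polyfun_const)
      fix t assume "t \<in> {..<k}"
      then have "pol (coordf m n) N (F t)"
        using F by simp
      then show "polyfun (coordf m n) (F t)"
        unfolding polyfun_def ..
    qed
    have "f X = 0" if "X \<in> conj_orbit n A" for X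
      by (rule slice_dominant[OF A d[unfolded I_def] b(2) dual[unfolded I_def] expand[unfolded I_def]
            kill[unfolded I_def] fx van[unfolded I_def] that])
    then have "a t0 = 0"
      using ind[unfolded indep_on_def, THEN spec, of a] a(1) by (simp add: f_def)
    then show False
      using a(2) by blast
  qed
  then show ?thesis
    unfolding I(2) by (intro exI[of _ c] allI impI)
qed

lemma closedin_zeros:
  assumes "f \<in> poly_funs m n" and "S \<subseteq> mat_tuples m n"
  shows "closedin (subtopology (zariski m n) S) {x \<in> S. f x = 0}"
proof -
  have "closedin (zariski m n) (zero_locus m n {f})"
    unfolding closedin_zariski using assms(1) by blast
  moreover have "{x \<in> S. f x = 0} = zero_locus m n {f} \<inter> S"
    using assms(2) by (auto simp: zero_locus_def)
  ultimately show ?thesis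
    unfolding closedin_subtopology by blast
qed

lemma irreducible_mult_zero:
  assumes irr: "irreducible_in (subtopology (zariski m n) S) Z" and S: "S \<subseteq> mat_tuples m n"
    and fg: "f \<in> poly_funs m n" "g \<in> poly_funs m n"
    and z: "\<And>x. x \<in> Z \<Longrightarrow> f x * g x = (0 :: 'a::idom)"
  shows "(\<forall>x\<in>Z. f x = 0) \<or> (\<forall>x\<in>Z. g x = 0)"
proof -
  have "Z \<subseteq> S"
    using irr unfolding irreducible_in_def topspace_subtopology by blast
  then have "Z \<subseteq> {x \<in> S. f x = 0} \<union> {x \<in> S. g x = 0}"
    using z by fastforce
  then have "Z \<subseteq> {x \<in> S. f x = 0} \<or> Z \<subseteq> {x \<in> S. g x = 0}"
    using irr closedin_zeros[OF fg(1) S] closedin_zeros[OF fg(2) S] unfolding irreducible_in_def by blast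
  then show ?thesis by blast
qed

lemma proper_closed_subset_polynomial:
  assumes S: "S \<subseteq> mat_tuples m n"
    and Z: "closedin (subtopology (zariski m n) S) Z" and x: "x \<in> S" "x \<notin> Z"
  obtains g where "g \<in> poly_funs m n" "g x \<noteq> 0" "\<And>y. y \<in> Z \<Longrightarrow> g y = (0 :: 'a::idom)"
proof -
  obtain F where F: "F \<subseteq> poly_funs m n" "Z = zero_locus m n F \<inter> S"
    using Z unfolding closedin_subtopology closedin_zariski by blast
  have "x \<notin> zero_locus m n F"
    using F(2) x by blast
  then obtain g where "g \<in> F" "g x \<noteq> 0"
    using x(1) S by (auto simp: zero_locus_def)
  then show ?thesis
    using that[of g] F by (auto simp: zero_locus_def)
qed

text \<open>
Restricting a relation to \<open>Z0\<close>, where \<open>g\<close> vanishes, kills the coefficients of the functions \<open>F\<close>; the rest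
is \<open>g\<close> times a relation between the functions \<open>G\<close>, from which \<open>g\<close> can be cancelled.
\<close>

lemma indep_on_append:
  fixes F G :: "nat \<Rightarrow> 'p \<Rightarrow> 'a::field"
  assumes "Z0 \<subseteq> Z1" and F: "indep_on Z0 F k" and G: "indep_on Z1 G l"
    and g0: "\<And>x. x \<in> Z0 \<Longrightarrow> g x = 0"
    and cancel: "\<And>a. (\<And>x. x \<in> Z1 \<Longrightarrow> g x * (\<Sum>t<l. a t * G t x) = 0) \<Longrightarrow> \<forall>x\<in>Z1. (\<Sum>t<l. a t * G t x) = 0"
  shows "indep_on Z1 (\<lambda>t. if t < k then F t else (\<lambda>x. g x * G (t - k) x)) (k + l)"
  unfolding indep_on_def
proof (intro allI impI)
  fix a t
  assume z: "\<forall>x\<in>Z1. (\<Sum>t<k + l. a t * (if t < k then F t else (\<lambda>x. g x * G (t - k) x)) x) = 0" and t: "t < k + l"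
  have sum: "(\<Sum>t<k + l. a t * (if t < k then F t else (\<lambda>x. g x * G (t - k) x)) x) =
      (\<Sum>t<k. a t * F t x) + g x * (\<Sum>t<l. a (k + t) * G t x)" for x
    unfolding sum_lessThan_add by (simp add: sum_distrib_left mult_ac)
  have zz: "(\<Sum>t<k. a t * F t x) + g x * (\<Sum>t<l. a (k + t) * G t x) = 0" if "x \<in> Z1" for x
    using z that unfolding sum by blast
  have "(\<Sum>t<k. a t * F t x) = 0" if x: "x \<in> Z0" for x
  proof -
    have "x \<in> Z1"
      using x assms(1) by blast
    from zz[OF this] show ?thesis
      by (simp add: g0[OF x])
  qed
  then have a0: "a t = 0" if "t < k" for t
    using F that unfolding indep_on_def by blast
  then have "g x * (\<Sum>t<l. a (k + t) * G t x) = 0" if "x \<in> Z1" for x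
    using zz[OF that] a0 by simp
  then have "\<forall>x\<in>Z1. (\<Sum>t<l. a (k + t) * G t x) = 0"
    using cancel[of "\<lambda>t. a (k + t)"] by blast
  then have "a (k + t) = 0" if "t < l" for t
    using G[unfolded indep_on_def, THEN spec, of "\<lambda>t. a (k + t)"] that by simp
  note a1 = this
  show "a t = 0"
  proof (cases "t < k")
    case False
    then show ?thesis
      using a1[of "t - k"] t by simp
  qed (rule a0)
qed

text \<open>
Let \<open>g\<close> vanish on \<open>Z i\<close> but not on the irreducible set \<open>Z (i + 1)\<close>. If \<open>H i N\<close> denotes the number of
independent functions of degree at most \<open>E N\<close> on \<open>Z i\<close>, then \<open>H (i + 1) (N + 1) \<ge> H i (N + 1) + H (i + 1) N\<close>:
take independent functions on \<open>Z i\<close> and the \<open>g\<close>-multiples of independent functions on \<open>Z (i + 1)\<close>. This is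
Pascal's rule, so \<open>H i N\<close> is at least \<open>N + i choose i\<close>.
\<close>

lemma chain_functions:
  fixes Z :: "nat \<Rightarrow> 'a::field mat list set"
  assumes S: "S \<subseteq> mat_tuples m n"
    and cl: "\<And>i. i \<le> r \<Longrightarrow> closedin (subtopology (zariski m n) S) (Z i)"
    and irr: "\<And>i. i \<le> r \<Longrightarrow> irreducible_in (subtopology (zariski m n) S) (Z i)"
    and strict: "\<And>i. i < r \<Longrightarrow> Z i \<subset> Z (Suc i)"
    and i: "i \<le> r"
  shows "\<exists>E. \<forall>N. \<exists>F. (\<forall>t<(N + i) choose i. pol (coordf m n) (E * N) (F t)) \<and>
    indep_on (Z i) F ((N + i) choose i)"
  using i
proof (induction i)
  case 0
  have "Z 0 \<noteq> {}"
    using irr[of 0] unfolding irreducible_in_def by simp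
  then have "indep_on (Z 0) (\<lambda>_ _. 1) 1"
    by (auto simp: indep_on_def)
  then have "\<exists>F. (\<forall>t<(N + 0) choose 0. pol (coordf m n) (0 * N) (F t)) \<and> indep_on (Z 0) F ((N + 0) choose 0)" for N
    using pol.const[of "coordf m n" 0 1] by (intro exI[of _ "\<lambda>_ _. 1"]) simp
  then show ?case by blast
next
  case (Suc i)
  have ir: "i < r" "Suc i \<le> r" "i \<le> r"
    using Suc.prems by simp_all
  obtain E0 where E0: "\<And>N. \<exists>F. (\<forall>t<(N + i) choose i. pol (coordf m n) (E0 * N) (F t)) \<and>
    indep_on (Z i) F ((N + i) choose i)"
    using Suc.IH[OF ir(3)] by blast
  obtain x where x: "x \<in> Z (Suc i)" "x \<notin> Z i"
    using strict[OF ir(1)] by blast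
  have ZS: "Z (Suc i) \<subseteq> S"
    using irr[OF ir(2)] unfolding irreducible_in_def topspace_subtopology by blast
  then obtain g where g: "g \<in> poly_funs m n" "g x \<noteq> 0" "\<And>y. y \<in> Z i \<Longrightarrow> g y = 0"
    using proper_closed_subset_polynomial[OF S cl[OF ir(3)], of x] x by blast
  obtain e where e: "pol (coordf m n) e g"
    using g(1) unfolding poly_funs_iff_polx polyfun_def by blast
  define E where "E = max E0 e"
  have "\<exists>F. (\<forall>t<(N + Suc i) choose Suc i. pol (coordf m n) (E * N) (F t)) \<and>
    indep_on (Z (Suc i)) F ((N + Suc i) choose Suc i)" for N
  proof (induction N)
    case 0
    have "indep_on (Z (Suc i)) (\<lambda>_ _. 1) 1"
      using x by (auto simp: indep_on_def)
    then show ?case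
      using pol.const[of "coordf m n" 0 1] by (intro exI[of _ "\<lambda>_ _. 1"]) simp
  next
    case (Suc N)
    let ?k = "(Suc N + i) choose i" and ?l = "(N + Suc i) choose Suc i"
    obtain G where G: "\<forall>t<?l. pol (coordf m n) (E * N) (G t)" "indep_on (Z (Suc i)) G ?l"
      using Suc by blast
    obtain F where F: "\<forall>t<?k. pol (coordf m n) (E0 * Suc N) (F t)" "indep_on (Z i) F ?k"
      using E0 by blast
    let ?H = "\<lambda>t. if t < ?k then F t else (\<lambda>x. g x * G (t - ?k) x)"
    have ind: "indep_on (Z (Suc i)) ?H (?k + ?l)"
    proof (rule indep_on_append[OF _ F(2) G(2) g(3)])
      show "Z i \<subseteq> Z (Suc i)"
        using strict[OF ir(1)] by blast
      fix a
      assume z: "\<And>x. x \<in> Z (Suc i) \<Longrightarrow> g x * (\<Sum>t<?l. a t * G t x) = 0"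
      have "polyfun (coordf m n) (\<lambda>x. \<Sum>t<?l. a t * G t x)"
        using G(1) by (intro polyfun_sum polyfun_mult polyfun_const) (auto simp: polyfun_def)
      then have "(\<lambda>x. \<Sum>t<?l. a t * G t x) \<in> poly_funs m n"
        by (simp only: poly_funs_iff_polx)
      from irreducible_mult_zero[OF irr[OF ir(2)] S g(1) this z] g(2) x(1)
      show "\<forall>x\<in>Z (Suc i). (\<Sum>t<?l. a t * G t x) = 0" by blast
    qed
    have deg: "pol (coordf m n) (E * Suc N) (?H t)" if t: "t < ?k + ?l" for t
    proof (cases "t < ?k")
      case True
      have "pol (coordf m n) (E * Suc N) (F t)"
      proof (rule pol_mono)
        show "pol (coordf m n) (E0 * Suc N) (F t)"
          using F(1) True by blast
        show "E0 * Suc N \<le> E * Suc N"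
          by (rule mult_le_mono1) (simp add: E_def)
      qed
      then show ?thesis using True by simp
    next
      case False
      then have "pol (coordf m n) (E * N) (G (t - ?k))"
        using G(1) t by auto
      then have "pol (coordf m n) (E * Suc N) (\<lambda>x. g x * G (t - ?k) x)"
        by (rule pol.mult[OF e]) (simp add: E_def)
      then show ?thesis using False by simp
    qed
    have "(Suc N + Suc i) choose Suc i = ?k + ?l"
      by simp
    then show "\<exists>F. (\<forall>t<(Suc N + Suc i) choose Suc i. pol (coordf m n) (E * Suc N) (F t)) \<and>
      indep_on (Z (Suc i)) F ((Suc N + Suc i) choose Suc i)"
      using ind deg by (intro exI[of _ ?H]) simp
  qed
  then show ?case by blast
qed

text \<open>
At \<open>r M\<close> in place of \<open>N\<close> the binomial coefficient is at least \<open>(M + 1)\<^sup>r\<close>, whereas the right-hand side is at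
most \<open>K\<^sup>D (M + 1)\<^sup>D\<close> with \<open>K\<close> independent of \<open>M\<close>; take \<open>M = K\<^sup>D\<close>.
\<close>

lemma binomial_growth:
  assumes "\<And>N. (N + r) choose r \<le> (c * N + 1) ^ D"
  shows "r \<le> D"
proof (rule ccontr)
  assume "\<not> r \<le> D"
  then have r: "r \<ge> Suc D" "r > 0" by simp_all
  define K where "K = c * r + 1"
  define M where "M = K ^ D"
  have "real (M + 1) = real (r * M + r) / real r"
    using r by (simp add: field_simps)
  then have "real ((M + 1) ^ r) = (real (r * M + r) / real r) ^ r"
    by (simp only: of_nat_power)
  also have "\<dots> \<le> real ((r * M + r) choose r)"
    using binomial_ge_n_over_k_pow_k[of r "r * M + r", where 'a = real] by simp
  finally have "(M + 1) ^ r \<le> (r * M + r) choose r"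
    by linarith
  also have "\<dots> \<le> (c * (r * M) + 1) ^ D"
    by (rule assms)
  also have "\<dots> \<le> (K * (M + 1)) ^ D"
    by (rule power_mono) (simp_all add: K_def algebra_simps)
  also have "\<dots> = M * (M + 1) ^ D"
    unfolding power_mult_distrib M_def[symmetric] ..
  finally have "(M + 1) ^ r \<le> M * (M + 1) ^ D" .
  moreover have "(M + 1) ^ Suc D \<le> (M + 1) ^ r"
    by (rule power_increasing[OF r(1)]) simp
  moreover have "(M + 1) ^ Suc D = M * (M + 1) ^ D + (M + 1) ^ D"
    by simp
  moreover have "(M + 1) ^ D > 0"
    by simp
  ultimately show False
    by linarith
qed

lemma orbit_subset_tuples: "A \<in> mat_tuples m n \<Longrightarrow> conj_orbit n A \<subseteq> mat_tuples m n"
  for A :: "'a::field mat list"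
  using conj_orbit_iff[of A m n] by blast

theorem orbit_dim_le:
  fixes A :: "'a::alg_closed_field mat list"
  assumes A: "A \<in> mat_tuples m n"
  shows "variety_dim m n (conj_orbit n A) \<le> enat (n * n - fs.dim (homs m n A A))"
  unfolding variety_dim_def top_dim_def
proof (rule Sup_least)
  let ?X = "subtopology (zariski m n) (conj_orbit n A)"
  let ?D = "n * n - fs.dim (homs m n A A)"
  fix x assume "x \<in> {enat r | r. \<exists>Z. (\<forall>i\<le>r. closedin ?X (Z i) \<and> irreducible_in ?X (Z i)) \<and> (\<forall>i<r. Z i \<subset> Z (Suc i))}"
  then obtain r Z where x: "x = enat r" and Z: "\<forall>i\<le>r. closedin ?X (Z i) \<and> irreducible_in ?X (Z i)"
    "\<forall>i<r. Z i \<subset> Z (Suc i)"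
    by blast
  obtain E where E: "\<And>N. \<exists>F. (\<forall>t<(N + r) choose r. pol (coordf m n) (E * N) (F t)) \<and>
    indep_on (Z r) F ((N + r) choose r)"
    using chain_functions[OF orbit_subset_tuples[OF A], of r Z r] Z by blast
  obtain c where c: "\<forall>N k F. (\<forall>t<k. pol (coordf m n) N (F t)) \<longrightarrow> indep_on (conj_orbit n A) F k \<longrightarrow>
    k \<le> (c * N + 1) ^ ?D"
    using orbit_functions_bound[OF A] by blast
  have "Z r \<subseteq> conj_orbit n A"
    using Z(1) unfolding irreducible_in_def topspace_subtopology by blast
  then have mono: "indep_on (conj_orbit n A) F k" if "indep_on (Z r) F k" for F k
    using that unfolding indep_on_def by blast
  have "(N + r) choose r \<le> (c * E * N + 1) ^ ?D" for N
    using E[of N] c mono by (metis mult.assoc)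
  then have "r \<le> ?D"
    by (rule binomial_growth)
  then show "x \<le> enat ?D"
    by (simp add: x)
qed

section \<open>Dimension of orbits: the lower bound\<close>

lemma dual_family:
  fixes v :: "nat \<Rightarrow> 'b \<Rightarrow> 'a::field"
  assumes J: "finite J" and v: "\<And>k. k < D \<Longrightarrow> v k \<in> supp J"
    and ind: "\<And>y. (\<Sum>k<D. fscale (y k) (v k)) = 0 \<Longrightarrow> \<forall>k<D. y k = 0"
  obtains P where "\<And>j k. j < D \<Longrightarrow> k < D \<Longrightarrow> dot J (P j) (v k) = (if j = k then 1 else 0)"
proof -
  have inj: "inj_on v {..<D}"
  proof (rule inj_onI, rule ccontr)
    fix i j assume ij: "i \<in> {..<D}" "j \<in> {..<D}" "v i = v j" "i \<noteq> j"
    let ?a = "\<lambda>t. if t = i then 1 else if t = j then - 1 else (0::'a)"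
    have "(\<Sum>t<D. fscale (?a t) (v t)) = (\<Sum>t\<in>{i, j}. fscale (?a t) (v t))"
      using ij by (intro sum.mono_neutral_right) auto
    also have "\<dots> = 0"
      using ij by simp
    finally have "\<forall>k<D. ?a k = 0"
      by (rule ind)
    then have "?a i = 0"
      using ij(1) by blast
    then show False
      by simp
  qed
  have ind': "fs.independent (v ` {..<D})"
  proof (rule fs.independent_if_scalars_zero)
    fix u x assume s: "(\<Sum>x\<in>v ` {..<D}. fscale (u x) x) = 0" and x: "x \<in> v ` {..<D}"
    have "(\<Sum>k<D. fscale (u (v k)) (v k)) = 0"
      using s by (simp add: sum.reindex[OF inj])
    then have "\<forall>k<D. u (v k) = 0"
      by (rule ind)
    then show "u x = 0"
      using x by auto
  qed simp
  have sub: "v ` {..<D} \<subseteq> supp J"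
    using v by auto
  obtain w where w0: "\<And>x. w x \<in> supp J" and w: "\<And>x z. x \<in> v ` {..<D} \<Longrightarrow> z \<in> v ` {..<D} \<Longrightarrow>
      dot J (w x) z = (if x = z then 1 else 0)"
    by (rule dual_basis[OF J sub ind']) (rule that)
  show ?thesis
  proof (rule that[of "\<lambda>j. w (v j)"])
    fix j k assume jk: "j < D" "k < D"
    then show "dot J (w (v j)) (v k) = (if j = k then 1 else 0)"
      using w[of "v j" "v k"] inj_on_eq_iff[OF inj, of j k] by simp
  qed
qed

lemma closed_in_orbit_by_vanishing:
  fixes A :: "'a::field mat list"
  assumes C: "closedin (subtopology (zariski m n) (conj_orbit n A)) C" and A: "A \<in> mat_tuples m n"
    and S: "S \<subseteq> C" and X: "X \<in> conj_orbit n A"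
    and v: "\<And>f. f \<in> poly_funs m n \<Longrightarrow> (\<And>x. x \<in> S \<Longrightarrow> f x = 0) \<Longrightarrow> f X = 0"
  shows "X \<in> C"
proof (rule ccontr)
  assume "X \<notin> C"
  then obtain g where "g \<in> poly_funs m n" "g X \<noteq> 0" "\<And>y. y \<in> C \<Longrightarrow> g y = 0"
    by (rule proper_closed_subset_polynomial[OF orbit_subset_tuples[OF A] C X]) (rule that)
  then show False
    using v[of g] S by blast
qed

text \<open>
The parameters \<open>y\<close> that vanish from index \<open>i\<close> on form the \<open>i\<close>-th member of a flag in the slice.
\<close>

definition flag_image :: "nat \<Rightarrow> nat \<Rightarrow> (nat \<Rightarrow> 'a fmat) \<Rightarrow> 'a::field mat list \<Rightarrow> nat \<Rightarrow> 'a mat list set" where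
  "flag_image n D l A i = {conj_by (slice n D l y) A | y. (\<forall>k\<ge>i. y k = 0) \<and> det (slice n D l y) \<noteq> 0}"

definition flag_closure :: "nat \<Rightarrow> nat \<Rightarrow> nat \<Rightarrow> (nat \<Rightarrow> 'a fmat) \<Rightarrow> 'a::field mat list \<Rightarrow> nat \<Rightarrow> 'a mat list set" where
  "flag_closure m n D l A i = {X \<in> conj_orbit n A. \<forall>f\<in>poly_funs m n.
     (\<forall>x\<in>flag_image n D l A i. f x = 0) \<longrightarrow> f X = 0}"

lemma slice_carrier: "slice n D l y \<in> carrier_mat n n"
  by (simp add: slice_def)

lemma slice_zero: "slice n D l (\<lambda>_. 0) = 1\<^sub>m n"
  by (rule eq_matI) (simp_all add: slice_entry, simp_all add: slice_def matf_def)

lemma flag_image_orbit: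
  assumes "A \<in> mat_tuples m n"
  shows "flag_image n D l A i \<subseteq> conj_orbit n A"
  using conj_by_orbit[OF slice_carrier _ assms] unfolding flag_image_def by blast

lemma flag_image_closure:
  assumes "A \<in> mat_tuples m n"
  shows "flag_image n D l A i \<subseteq> flag_closure m n D l A i"
  using flag_image_orbit[OF assms] unfolding flag_closure_def by blast

lemma flag_image_base: "A \<in> mat_tuples m n \<Longrightarrow> A \<in> flag_image n D l A i"
  unfolding flag_image_def using slice_zero[of n D l] conj_by_one[of A m n]
  by (intro CollectI exI[of _ "\<lambda>_. 0"]) simp

lemma flag_image_mono: "i \<le> j \<Longrightarrow> flag_image n D l A i \<subseteq> flag_image n D l A j"
proof
  fix X assume ij: "i \<le> j" and "X \<in> flag_image n D l A i"
  then obtain y where y: "X = conj_by (slice n D l y) A" "\<forall>k\<ge>i. y k = 0" "det (slice n D l y) \<noteq> 0"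
    unfolding flag_image_def by blast
  then have "\<forall>k\<ge>j. y k = 0"
    using ij by simp
  with y show "X \<in> flag_image n D l A j"
    unfolding flag_image_def by blast
qed

lemma flag_closure_mono: "i \<le> j \<Longrightarrow> flag_closure m n D l A i \<subseteq> flag_closure m n D l A j"
  using flag_image_mono[of i j n D l A] unfolding flag_closure_def by blast

lemma polmat_slice_line: "polmat {\<lambda>t. t} n (\<lambda>t. slice n D l (\<lambda>k. y k + t * (z k - y k)))"
  unfolding polmat_def
proof (intro conjI allI impI slice_carrier)
  fix i j assume ij: "i < n" "j < n"
  show "polyfun {\<lambda>t. t} (\<lambda>t. slice n D l (\<lambda>k. y k + t * (z k - y k)) $$ (i, j))"
    unfolding slice_entry[OF ij] by (intro polyfun_add polyfun_const polyfun_sum polyfun_mult polyfun_coord) auto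
qed

lemma closedin_flag_closure:
  assumes A: "A \<in> mat_tuples m n"
  shows "closedin (subtopology (zariski m n) (conj_orbit n A)) (flag_closure m n D l A i)"
proof -
  let ?F = "{f \<in> poly_funs m n. \<forall>x\<in>flag_image n D l A i. f x = 0}"
  have "closedin (zariski m n) (zero_locus m n ?F)"
    unfolding closedin_zariski by (intro exI[of _ ?F] conjI refl Collect_restrict)
  moreover have "flag_closure m n D l A i = zero_locus m n ?F \<inter> conj_orbit n A"
  proof (rule equalityI; rule subsetI)
    fix X assume "X \<in> flag_closure m n D l A i"
    then have X: "X \<in> conj_orbit n A" "\<And>f. f \<in> ?F \<Longrightarrow> f X = 0"
      by (simp_all add: flag_closure_def)
    then show "X \<in> zero_locus m n ?F \<inter> conj_orbit n A"
      using subsetD[OF orbit_subset_tuples[OF A] X(1)] by (simp add: zero_locus_def)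
  next
    fix X assume "X \<in> zero_locus m n ?F \<inter> conj_orbit n A"
    then show "X \<in> flag_closure m n D l A i"
      by (simp add: flag_closure_def zero_locus_def)
  qed
  ultimately show ?thesis
    unfolding closedin_subtopology by (intro exI[of _ "zero_locus m n ?F"] conjI)
qed

text \<open>
Two points of the image are joined by the image of a line, on which finitely many nonvanishing conditions
can be met at once.
\<close>

lemma irreducible_flag_closure:
  fixes A :: "'a::alg_closed_field mat list"
  assumes A: "A \<in> mat_tuples m n"
  shows "irreducible_in (subtopology (zariski m n) (conj_orbit n A)) (flag_closure m n D l A i)"
  unfolding irreducible_in_def
proof (intro conjI allI impI)
  let ?X = "subtopology (zariski m n) (conj_orbit n A)" and ?Z = "flag_closure m n D l A i"
    and ?S = "flag_image n D l A i"
  show "?Z \<subseteq> topspace ?X"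
    using orbit_subset_tuples[OF A] by (auto simp: topspace_subtopology topspace_zariski flag_closure_def)
  show "?Z \<noteq> {}"
    using flag_image_base[OF A] flag_image_closure[OF A] by blast
  fix C1 C2 assume C: "closedin ?X C1" "closedin ?X C2" "?Z \<subseteq> C1 \<union> C2"
  have SZ: "?S \<subseteq> ?Z"
    by (rule flag_image_closure[OF A])
  have ZC: "?Z \<subseteq> C" if "closedin ?X C" "?S \<subseteq> C" for C
  proof
    fix X assume X: "X \<in> ?Z"
    show "X \<in> C"
      by (rule closed_in_orbit_by_vanishing[OF that(1) A that(2)]) (use X in \<open>auto simp: flag_closure_def\<close>)
  qed
  have "?S \<subseteq> C1 \<or> ?S \<subseteq> C2"
  proof (rule ccontr)
    assume "\<not> (?S \<subseteq> C1 \<or> ?S \<subseteq> C2)"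
    then obtain x1 x2 where x1: "x1 \<in> ?S" "x1 \<notin> C1" and x2: "x2 \<in> ?S" "x2 \<notin> C2"
      by blast
    have o: "x1 \<in> conj_orbit n A" "x2 \<in> conj_orbit n A"
      using x1 x2 flag_image_orbit[OF A] by blast+
    obtain f1 where f1: "f1 \<in> poly_funs m n" "f1 x1 \<noteq> 0" "\<And>y. y \<in> C1 \<Longrightarrow> f1 y = 0"
      by (rule proper_closed_subset_polynomial[OF orbit_subset_tuples[OF A] C(1) o(1) x1(2)]) (rule that)
    obtain f2 where f2: "f2 \<in> poly_funs m n" "f2 x2 \<noteq> 0" "\<And>y. y \<in> C2 \<Longrightarrow> f2 y = 0"
      by (rule proper_closed_subset_polynomial[OF orbit_subset_tuples[OF A] C(2) o(2) x2(2)]) (rule that)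
    obtain y1 where y1: "x1 = conj_by (slice n D l y1) A" "\<forall>k\<ge>i. y1 k = 0" "det (slice n D l y1) \<noteq> 0"
      using x1(1) unfolding flag_image_def by blast
    obtain y2 where y2: "x2 = conj_by (slice n D l y2) A" "\<forall>k\<ge>i. y2 k = 0" "det (slice n D l y2) \<noteq> 0"
      using x2(1) unfolding flag_image_def by blast
    define G where "G t = slice n D l (\<lambda>k. y1 k + t * (y2 k - y1 k))" for t
    have G: "polmat {\<lambda>t. t} n G"
      unfolding G_def by (rule polmat_slice_line)
    have G01: "G 0 = slice n D l y1" "G 1 = slice n D l y2"
      by (simp_all add: G_def)
    have d0: "det (G 0) \<noteq> 0" "det (G 1) \<noteq> 0"
      unfolding G01 by (rule y1(3), rule y2(3))
    have n0: "f1 (conj_by (G 0) A) \<noteq> 0" "f2 (conj_by (G 1) A) \<noteq> 0"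
      unfolding G01 y1(1)[symmetric] y2(1)[symmetric] by (rule f1(2), rule f2(2))
    obtain h1 where h1: "polyfun {\<lambda>t. t} h1" "h1 0 \<noteq> 0"
      "\<And>t. det (G t) \<noteq> 0 \<Longrightarrow> h1 t \<noteq> 0 \<Longrightarrow> f1 (conj_by (G t) A) \<noteq> 0"
      by (rule pullback_nonzero[OF A G f1(1)[unfolded poly_funs_iff_polx] d0(1) n0(1)]) (rule that)
    obtain h2 where h2: "polyfun {\<lambda>t. t} h2" "h2 1 \<noteq> 0"
      "\<And>t. det (G t) \<noteq> 0 \<Longrightarrow> h2 t \<noteq> 0 \<Longrightarrow> f2 (conj_by (G t) A) \<noteq> 0"
      by (rule pullback_nonzero[OF A G f2(1)[unfolded poly_funs_iff_polx] d0(2) n0(2)]) (rule that)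
    have "\<exists>t. \<forall>f\<in>{\<lambda>t. det (G t), h1, h2}. f t \<noteq> 0"
      using polyfun_det[OF G] h1(1,2) h2(1,2) d0 by (intro ex_common_nonzero) auto
    then obtain t where t: "det (G t) \<noteq> 0" "h1 t \<noteq> 0" "h2 t \<noteq> 0"
      by auto
    let ?x = "conj_by (G t) A"
    have "?x \<in> ?S"
      unfolding flag_image_def G_def using t(1) y1(2) y2(2)
      by (intro CollectI exI[of _ "\<lambda>k. y1 k + t * (y2 k - y1 k)"]) (simp add: G_def)
    then have "?x \<in> C1 \<union> C2"
      using SZ C(3) by blast
    then show False
      using f1(3)[of ?x] f2(3)[of ?x] h1(3)[OF t(1,2)] h2(3)[OF t(1,3)] by blast
  qed
  then show "?Z \<subseteq> C1 \<or> ?Z \<subseteq> C2"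
    using ZC C(1,2) by blast
qed

lemma add_eq_rearrange:
  fixes a p x r :: "'b::ab_group_add"
  assumes "a + p = x + r"
  shows "p - r = x - a"
proof -
  have "p - r = (a + p) - (a + r)" by simp
  also have "\<dots> = x - a" unfolding assms by simp
  finally show ?thesis .
qed

text \<open>
If \<open>X\<close> is the conjugate of \<open>A\<close> by \<open>1 + l\<close> with \<open>l = \<Sum>\<^sub>k y\<^sub>k l\<^sub>k\<close>, then \<open>l A\<^sub>s - X\<^sub>s l = X\<^sub>s - A\<^sub>s\<close>, a linear
system for \<open>y\<close> with coefficients polynomial in \<open>X\<close>. At \<open>X = A\<close> it is injective, because the \<open>l\<^sub>k\<close> are
independent modulo \<open>Hom(A, A)\<close>; so \<open>D\<close> linear combinations of its equations, with coefficients \<open>P\<close>, form a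
square system whose matrix \<open>Mm X\<close> is the identity at \<open>X = A\<close>. By Cramer's rule \<open>y\<^sub>i det (Mm X)\<close> is a
polynomial function of \<open>X\<close>.
\<close>

lemma flag_coordinates:
  fixes A :: "'a::field mat list"
  assumes A: "A \<in> mat_tuples m n" and l: "\<And>k. k < D \<Longrightarrow> l k \<in> fmats n"
    and ind: "\<And>y. (\<Sum>k<D. fscale (y k) (l k)) \<in> homs m n A A \<Longrightarrow> \<forall>k<D. y k = 0"
  obtains q f where "polyfun (coordf m n) q" "q A \<noteq> 0" "\<And>i. i < D \<Longrightarrow> polyfun (coordf m n) (f i)"
    and "\<And>y i. i < D \<Longrightarrow> det (slice n D l y) \<noteq> 0 \<Longrightarrow>
      f i (conj_by (slice n D l y) A) = y i * q (conj_by (slice n D l y) A)"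
proof -
  define J where "J = {..<m} \<times> ({..<n} \<times> {..<n})"
  have J: "finite J"
    by (simp add: J_def)
  \<comment> \<open>the linear system \<open>l A\<^sub>s - X\<^sub>s l = X\<^sub>s - A\<^sub>s\<close> that determines \<open>l\<close> from \<open>X = (1 + l) A (1 + l)\<^sup>-\<^sup>1\<close>\<close>
  define M where "M X k = (\<lambda>(s, ij). if s < m then (mm n (l k) (fmat n (A ! s)) - mm n (fmat n (X ! s)) (l k)) ij else 0)"
    for X k
  define R where "R X = (\<lambda>(s, ij). if s < m then (fmat n (X ! s) - fmat n (A ! s)) ij else 0)" for X
  have M_supp: "M X k \<in> supp J" if "k < D" for X k
  proof -
    have "mm n (l k) (fmat n (A ! s)) - mm n (fmat n (X ! s)) (l k) \<in> fmats n" for s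
      by (intro fs.subspace_diff[OF subspace_fmats] mm_fmats l[OF that] fmat_fmats)
    then show ?thesis
      by (auto simp: supp_def fmats_def M_def J_def)
  qed
  have Msum: "(\<Sum>k<D. fscale (y k) (M X k)) (s, ij) =
      (mm n (\<Sum>k<D. fscale (y k) (l k)) (fmat n (A ! s)) - mm n (fmat n (X ! s)) (\<Sum>k<D. fscale (y k) (l k))) ij"
    if "s < m" for y X s ij
    using that by (simp add: sum_fun_apply M_def mm_sum_left mm_sum_right mm_scale_left mm_scale_right
        sum_subtractf right_diff_distrib)
  have indM: "\<forall>k<D. y k = 0" if z: "(\<Sum>k<D. fscale (y k) (M A k)) = 0" for y
  proof (rule ind)
    let ?L = "\<Sum>k<D. fscale (y k) (l k)"
    have "?L \<in> fmats n"
      using l by (intro fs.subspace_sum[OF subspace_fmats] fs.subspace_scale[OF subspace_fmats]) simp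
    moreover have "mm n ?L (fmat n (A ! s)) = mm n (fmat n (A ! s)) ?L" if "s < m" for s
    proof
      fix ij
      show "mm n ?L (fmat n (A ! s)) ij = mm n (fmat n (A ! s)) ?L ij"
        using Msum[OF that, of y A ij] unfolding z by simp
    qed
    ultimately show "?L \<in> homs m n A A"
      by (simp add: homs_def)
  qed
  have MA: "M A k \<in> supp J" if "k < D" for k
    by (rule M_supp[OF that])
  obtain P where P: "\<And>j k. j < D \<Longrightarrow> k < D \<Longrightarrow> dot J (P j) (M A k) = (if j = k then 1 else 0)"
    by (rule dual_family[of J D "M A", OF J MA indM]) (assumption, assumption, rule that)
  define Mm where "Mm X = mat D D (\<lambda>(j, k). dot J (P j) (M X k))" for X
  define bv where "bv X = vec D (\<lambda>j. dot J (P j) (R X))" for X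
  have Mc: "Mm X \<in> carrier_mat D D" for X
    by (simp add: Mm_def)
  have Xij: "polyfun (coordf m n) (\<lambda>X. fmat n (X ! s) (i, j))" if "s < m" for s i j
  proof (cases "i < n \<and> j < n")
    case True
    then have "polyfun (coordf m n) (\<lambda>X. X ! s $$ (i, j))"
      using that unfolding coordf_def by (intro polyfun_coord image_eqI[of _ _ "(s, i, j)"]) auto
    then show ?thesis
      using True by (simp add: fmat_def)
  qed (auto simp: fmat_def polyfun_const)
  have polM: "polyfun (coordf m n) (\<lambda>X. dot J (P j) (M X k))" for j k
    unfolding dot_def
  proof (intro polyfun_sum polyfun_mult polyfun_const)
    fix x assume "x \<in> J"
    then obtain s i j where x: "x = (s, (i, j))" "s < m"
      by (auto simp: J_def)
    have "M X k x = mm n (l k) (fmat n (A ! s)) (i, j) - (\<Sum>r<n. fmat n (X ! s) (i, r) * l k (r, j))" for X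
      using x by (simp add: M_def mm_def)
    then show "polyfun (coordf m n) (\<lambda>X. M X k x)"
      using Xij[OF x(2)] by (simp only:) (intro polyfun_diff polyfun_const polyfun_sum polyfun_mult)
  qed
  have polR: "polyfun (coordf m n) (\<lambda>X. dot J (P j) (R X))" for j
    unfolding dot_def
  proof (intro polyfun_sum polyfun_mult polyfun_const)
    fix x assume "x \<in> J"
    then obtain s i j where x: "x = (s, (i, j))" "s < m"
      by (auto simp: J_def)
    have "R X x = fmat n (X ! s) (i, j) - fmat n (A ! s) (i, j)" for X
      using x by (simp add: R_def)
    then show "polyfun (coordf m n) (\<lambda>X. R X x)"
      using Xij[OF x(2)] by (simp only:) (intro polyfun_diff polyfun_const)
  qed
  have Mm: "polmat (coordf m n) D Mm"
    unfolding polmat_def using Mc polM by (simp add: Mm_def)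
  define q where "q X = det (Mm X)" for X
  define f where "f i X = det (replace_col (Mm X) (bv X) i)" for i X
  show ?thesis
  proof (rule that[of q f])
    show "polyfun (coordf m n) q"
      unfolding q_def by (rule polyfun_det[OF Mm])
    have "Mm A = 1\<^sub>m D"
      using P by (intro eq_matI) (auto simp: Mm_def)
    then show "q A \<noteq> 0"
      by (simp add: q_def)
    fix i assume i: "i < D"
    have "polmat (coordf m n) D (\<lambda>X. replace_col (Mm X) (bv X) i)"
      unfolding polmat_def
    proof (intro conjI allI impI)
      show "replace_col (Mm X) (bv X) i \<in> carrier_mat D D" for X
        by (simp add: replace_col_def Mm_def)
      fix a c assume ac: "a < D" "c < D"
      have "replace_col (Mm X) (bv X) i $$ (a, c) =
          (if c = i then dot J (P a) (R X) else dot J (P a) (M X c))" for X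
        using ac by (simp add: replace_col_def Mm_def bv_def)
      then show "polyfun (coordf m n) (\<lambda>X. replace_col (Mm X) (bv X) i $$ (a, c))"
        using polM polR by (cases "c = i") simp_all
    qed
    then show "polyfun (coordf m n) (f i)"
      unfolding f_def by (rule polyfun_det)
    fix y assume dt: "det (slice n D l y) \<noteq> 0"
    let ?G = "slice n D l y" and ?L = "\<Sum>k<D. fscale (y k) (l k)"
    let ?X = "conj_by ?G A"
    have Lf: "?L \<in> fmats n"
      using l by (intro fs.subspace_sum[OF subspace_fmats] fs.subspace_scale[OF subspace_fmats]) simp
    have Xt: "?X \<in> mat_tuples m n"
      by (rule conj_by_tuples[OF slice_carrier A])
    have fG: "fmat n ?G = idf n + ?L"
      unfolding slice_def by (rule fmat_matf[OF fs.subspace_add[OF subspace_fmats idf_fmats Lf]])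
    have "(\<Sum>k<D. fscale (y k) (M ?X k)) x = R ?X x" for x
    proof -
      obtain s ij where Pair: "x = (s, ij)" by (rule prod.exhaust)
      show ?thesis
      proof (cases "s < m")
        case True
        have "fmat n ?G \<in> homs m n A ?X"
          using homs_mat_iff[OF slice_carrier A Xt] conj_by_intertwines[OF slice_carrier dt A] by blast
        then have "mm n (idf n + ?L) (fmat n (A ! s)) = mm n (fmat n (?X ! s)) (idf n + ?L)"
          using True unfolding fG homs_def by blast
        then have "fmat n (A ! s) + mm n ?L (fmat n (A ! s)) = fmat n (?X ! s) + mm n (fmat n (?X ! s)) ?L"
          by (simp only: mm_add_left mm_add_right mm_id_left[OF fmat_fmats] mm_id_right[OF fmat_fmats])
        then have "mm n ?L (fmat n (A ! s)) - mm n (fmat n (?X ! s)) ?L = fmat n (?X ! s) - fmat n (A ! s)"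
          by (rule add_eq_rearrange)
        then show ?thesis
          unfolding Pair Msum[OF True] using True by (simp add: R_def)
      qed (simp add: Pair R_def sum_fun_apply M_def)
    qed
    then have sys: "(\<Sum>k<D. fscale (y k) (M ?X k)) = R ?X"
      by (rule ext)
    have "Mm ?X *\<^sub>v vec D y = bv ?X"
    proof (rule eq_vecI)
      fix j assume "j < dim_vec (bv ?X)"
      then have j: "j < D" by (simp add: bv_def)
      have "(Mm ?X *\<^sub>v vec D y) $ j = (\<Sum>k<D. dot J (P j) (M ?X k) * y k)"
        using j by (simp add: Mm_def scalar_prod_def atLeast0LessThan)
      also have "\<dots> = dot J (P j) (\<Sum>k<D. fscale (y k) (M ?X k))"
        by (simp add: dot_sum_right dot_scale_right mult.commute)
      finally show "(Mm ?X *\<^sub>v vec D y) $ j = bv ?X $ j"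
        using j by (simp add: sys bv_def)
    qed (simp add: Mm_def bv_def)
    then show "f i ?X = y i * q ?X"
      using cramer_lemma_mat[OF Mc[of ?X], of "vec D y" i] i by (simp add: f_def q_def)
  qed
qed

text \<open>
The function \<open>f\<^sub>i\<close> that recovers the \<open>i\<close>-th coordinate vanishes on the \<open>i\<close>-th member of the flag. On the
next member it does not, as \<open>A\<close> can be moved along the line in direction \<open>l\<^sub>i\<close> to a point where \<open>q \<noteq> 0\<close>.
\<close>

theorem orbit_dim_ge:
  fixes A :: "'a::alg_closed_field mat list"
  assumes A: "A \<in> mat_tuples m n"
  shows "variety_dim m n (conj_orbit n A) \<ge> enat (n * n - fs.dim (homs m n A A))"
proof -
  define I where "I = {..<n} \<times> {..<n}"
  let ?d = "fs.dim (homs m n A A)"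
  have I: "finite I" "card I = n * n" "supp I = fmats n"
    by (simp_all add: I_def fmats_def)
  have sub: "homs m n A A \<subseteq> supp I"
    unfolding I(3) by (rule homs_subset_fmats)
  obtain b w where d: "?d \<le> card I"
    and b: "\<And>k. k < card I \<Longrightarrow> b k \<in> supp I" "\<And>k. k < ?d \<Longrightarrow> b k \<in> homs m n A A"
    and dual: "\<And>j k. j < card I \<Longrightarrow> k < card I \<Longrightarrow> dot I (w j) (b k) = (if j = k then 1 else 0)"
    and expand: "\<And>x. x \<in> supp I \<Longrightarrow> x = (\<Sum>k<card I. fscale (dot I (w k) x) (b k))"
    and kill: "\<And>x k. x \<in> homs m n A A \<Longrightarrow> ?d \<le> k \<Longrightarrow> k < card I \<Longrightarrow> dot I (w k) x = 0"
    by (rule adapted_basis[OF I(1) sub subspace_homs]) (rule that)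
  define D where "D = card I - ?d"
  define l where "l k = b (?d + k)" for k
  have l: "l k \<in> fmats n" if "k < D" for k
    unfolding l_def using b(1)[of "?d + k"] that by (simp add: I(3) D_def)
  have ind: "\<forall>k<D. y k = 0" if L: "(\<Sum>k<D. fscale (y k) (l k)) \<in> homs m n A A" for y
  proof (intro allI impI)
    fix j assume j: "j < D"
    have "0 = dot I (w (?d + j)) (\<Sum>k<D. fscale (y k) (l k))"
      using kill[OF L, of "?d + j"] j by (simp add: D_def)
    also have "\<dots> = (\<Sum>k<D. if k = j then y k else 0)"
      unfolding dot_sum_right dot_scale_right l_def
      using j by (intro sum.cong refl) (auto simp: dual D_def)
    finally show "y j = 0"
      using j by simp
  qed
  obtain q f where q: "polyfun (coordf m n) q" "q A \<noteq> 0"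
    and f: "\<And>i. i < D \<Longrightarrow> polyfun (coordf m n) (f i)"
    and qf: "\<And>y i. i < D \<Longrightarrow> det (slice n D l y) \<noteq> 0 \<Longrightarrow>
      f i (conj_by (slice n D l y) A) = y i * q (conj_by (slice n D l y) A)"
    by (rule flag_coordinates[of A m n D l, OF A l ind]) (assumption, assumption, rule that)
  let ?Z = "flag_closure m n D l A" and ?X = "subtopology (zariski m n) (conj_orbit n A)"
  have strict: "?Z i \<subset> ?Z (Suc i)" if i: "i < D" for i
  proof -
    define e where "e = (\<lambda>k. if k = i then 1 else (0::'a))"
    define G where "G t = slice n D l (\<lambda>k. 0 + t * (e k - 0))" for t
    have G: "polmat {\<lambda>t. t} n G"
      unfolding G_def by (rule polmat_slice_line)
    have G0: "G 0 = 1\<^sub>m n"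
      using slice_zero[of n D l] by (simp add: G_def)
    have d0: "det (G 0) \<noteq> 0" and q0: "q (conj_by (G 0) A) \<noteq> 0"
      unfolding G0 conj_by_one[OF A] using q(2) by simp_all
    obtain h where h: "polyfun {\<lambda>t. t} h" "h 0 \<noteq> 0"
      "\<And>t. det (G t) \<noteq> 0 \<Longrightarrow> h t \<noteq> 0 \<Longrightarrow> q (conj_by (G t) A) \<noteq> 0"
      by (rule pullback_nonzero[OF A G q(1) d0 q0]) (rule that)
    have "\<exists>t. \<forall>f\<in>{\<lambda>t. det (G t), h, \<lambda>t. t}. f t \<noteq> 0"
    proof (rule ex_common_nonzero)
      fix f assume "f \<in> {\<lambda>t. det (G t), h, \<lambda>t. t}"
      then consider "f = (\<lambda>t. det (G t))" | "f = h" | "f = (\<lambda>t. t)"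
        by blast
      then have "polyfun {\<lambda>t. t} f \<and> (\<exists>t. f t \<noteq> 0)"
      proof cases
        case 1
        then show ?thesis using polyfun_det[OF G] d0 by blast
      next
        case 2
        then show ?thesis using h(1,2) by blast
      next
        case 3
        have "polyfun {\<lambda>t. t} (\<lambda>t::'a. t)"
          by (rule polyfun_coord) simp
        then show ?thesis
          using 3 one_neq_zero[where 'a = 'a] by blast
      qed
      then show "polyfun {\<lambda>t. t} f" "\<exists>t. f t \<noteq> 0"
        by blast+
    qed simp
    then obtain t where t: "det (G t) \<noteq> 0" "h t \<noteq> 0" "t \<noteq> 0"
      by auto
    let ?x = "conj_by (G t) A"
    have "f i ?x = t * q ?x"
      using qf[OF i, of "\<lambda>k. 0 + t * (e k - 0)"] t(1) by (simp add: G_def e_def)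
    then have fx: "f i ?x \<noteq> 0"
      using h(3)[OF t(1,2)] t(3) by simp
    have "G t = slice n D l (\<lambda>k. t * e k)"
      by (simp add: G_def)
    then have "?x \<in> flag_image n D l A (Suc i)"
      unfolding flag_image_def using t(1)
      by (intro CollectI exI[of _ "\<lambda>k. t * e k"] conjI allI impI) (simp_all add: e_def)
    then have x1: "?x \<in> ?Z (Suc i)"
      by (rule subsetD[OF flag_image_closure[OF A]])
    have van: "\<forall>z\<in>flag_image n D l A i. f i z = 0"
    proof
      fix z assume "z \<in> flag_image n D l A i"
      then obtain y where "z = conj_by (slice n D l y) A" "\<forall>k\<ge>i. y k = 0" "det (slice n D l y) \<noteq> 0"
        unfolding flag_image_def by blast
      then show "f i z = 0"
        using qf[OF i, of y] by simp
    qed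
    have x0: "?x \<notin> ?Z i"
    proof
      assume "?x \<in> ?Z i"
      then have "\<forall>f\<in>poly_funs m n. (\<forall>x\<in>flag_image n D l A i. f x = 0) \<longrightarrow> f ?x = 0"
        by (simp add: flag_closure_def)
      from bspec[OF this f[OF i, folded poly_funs_iff_polx]] van fx show False
        by blast
    qed
    have "?Z i \<noteq> ?Z (Suc i)"
    proof
      assume "?Z i = ?Z (Suc i)"
      with x0 x1 show False by simp
    qed
    moreover have "?Z i \<subseteq> ?Z (Suc i)"
      by (rule flag_closure_mono) simp
    ultimately show ?thesis
      by (rule psubsetI[rotated])
  qed
  have "(\<forall>i\<le>D. closedin ?X (?Z i) \<and> irreducible_in ?X (?Z i)) \<and> (\<forall>i<D. ?Z i \<subset> ?Z (Suc i))"
    using closedin_flag_closure[OF A] irreducible_flag_closure[OF A] strict by simp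
  then have "\<exists>Z. (\<forall>i\<le>D. closedin ?X (Z i) \<and> irreducible_in ?X (Z i)) \<and> (\<forall>i<D. Z i \<subset> Z (Suc i))"
    by (rule exI[of _ ?Z])
  then have mem: "enat D \<in> {enat r | r. \<exists>Z. (\<forall>i\<le>r. closedin ?X (Z i) \<and> irreducible_in ?X (Z i)) \<and> (\<forall>i<r. Z i \<subset> Z (Suc i))}"
    by (intro CollectI exI[of _ D] conjI[OF refl])
  have D: "n * n - ?d = D"
    by (simp only: D_def I(2))
  show ?thesis
    unfolding D variety_dim_def top_dim_def by (rule Sup_upper[OF mem])
qed

section \<open>The hom-order and dimensions of orbits\<close>

lemma dim_homs_le: "fs.dim (homs m n A B) \<le> n * n"
  for A B :: "'a::field mat list"
proof -
  have "fs.dim (homs m n A B) \<le> fs.dim (fmats n :: 'a fmat set)"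
    by (intro fmats_dim_mono[of "fmats n" n] subset_refl subset_trans[OF homs_subset_fmats fs.span_superset])
  then show ?thesis
    unfolding fmats_def dim_supp[OF finite_square] by (simp add: card_cartesian_product)
qed

theorem lemma2p2:
  fixes A B :: "'a::alg_closed_field mat list" and n m :: nat
  assumes "n \<ge> 2" and "m \<ge> 1"
    and "A \<in> mat_tuples m n" and "B \<in> mat_tuples m n"
    and "hom_less m n A B"
  shows "variety_dim m n (conj_orbit n A) > variety_dim m n (conj_orbit n B)"
proof -
  have "fs.dim (homs m n A A) < fs.dim (homs m n B B)"
    using hom_less_dim_endomorphisms[OF assms(5,3,4,2)] assms(1) by simp
  moreover have "fs.dim (homs m n B B) \<le> n * n"
    by (rule dim_homs_le)
  ultimately have "n * n - fs.dim (homs m n B B) < n * n - fs.dim (homs m n A A)"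
    by linarith
  then have "enat (n * n - fs.dim (homs m n B B)) < enat (n * n - fs.dim (homs m n A A))"
    by simp
  then show ?thesis
    using orbit_dim_le[OF assms(4)] orbit_dim_ge[OF assms(3)] by (meson le_less_trans less_le_trans)
qed

end
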